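(* Let $K\subset[a,b]$ be a closed set and let $n\geq2$ be an integer. Let $\mathrm{id}:[a,b]\to\mathbb{R}$ denote the identity function $\mathrm{id}(x)=x$. Then the following are equivalent: (i) There exists an $n$-times differentiable homeomorphism $h$ of $[a,b]$ onto itself such that $K=h\big(\{x\in[a,b]: h^{(i)}(x)=0\text{ for all }i=1,\dots,n\}\big)$. (ii) $V_{\frac1{n-1}}(\mathrm{id},K)<\infty$ and there exist closed sets $A_m\subset[a,b]$ ($m\in\mathcal{M}\subset\mathbb{N}$) such that $K=\bigcup_{m}A_m$ and $GV_{1/n}(\mathrm{id},A_m,K)<\infty$ for all $m\in\mathcal{M}$. (iii) $V_{\frac1{n-1}}(\mathrm{id},K)<\infty$ and there exist closed sets $A_m\subset[a,b]$ and numbers $\delta_m>0$ ($m\in\mathbb{N}$) such that $K=\bigcup_m A_m$, $A_m\subset A_{m+1}$ for all $m\in\mathbb{N}$, and $\lim_{m\to\infty}\overline{GV}^{\delta_m}_{1/n}(\mathrm{id},A_m,K)=0$.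
   Context: Derivatives: at the endpoints $a,b$ one-sided derivatives are used; "$n$-times differentiable" means the $n$-th derivative exists (finite) at every point of $[a,b]$. Fractional variation: for $f:[a,b]\to\mathbb{R}$ continuous, $\alpha\in(0,1]$ and $K\subset[a,b]$, $V_\alpha(f,K)$ is the supremum of $\sum_{i=1}^N|f(d_i)-f(c_i)|^\alpha$ over all finite sequences of non-overlapping intervals $[c_i,d_i]\subset[a,b]$ with $c_i,d_i\in K$ (it is $0$ if there is no such sequence). Generalized variation ($n\ge2$): for closed sets $\emptyset\neq A\subset K\subset[a,b]$ and $\delta>0$, consider the sums $$\sum_{i=1}^N\Big(V_{\frac1{n-1}}(f,K\cap[x_i,y_i])\Big)^{\frac{n-1}{n}}\qquad( * )$$ for finite collections of non-overlapping intervals $[x_i,y_i]\subset[a,b]$. $GV_{1/n}(f,A,K)$ is the supremum of $( * )$ over collections with $x_i,y_i\in A$ for all $i$. $\overline{GV}^{\delta}_{1/n}(f,A,K)$ is the supremum of $( * )$ over collections with $y_i-x_i\leq\delta$, $x_i,y_i\in K$ and $\{x_i,y_i\}\cap A\neq\emptyset$ for all $i$. If there is no admissible collection the value is $0$; both are $0$ if $A=\emptyset$. *)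

theory Defs
  imports "HOL-Analysis.Analysis"
begin

text \<open>
  Derivatives are taken within \<open>S\<close>, so for \<open>S = {a..b}\<close> with \<open>a < b\<close> they are one-sided
  at the endpoints and do not depend on the values of the function outside \<open>S\<close>.
\<close>

definition nderiv_within :: "real set \<Rightarrow> nat \<Rightarrow> (real \<Rightarrow> real) \<Rightarrow> real \<Rightarrow> real" where
  "nderiv_within S i f = ((\<lambda>g x. vector_derivative g (at x within S)) ^^ i) f"

definition n_times_differentiable_on :: "nat \<Rightarrow> (real \<Rightarrow> real) \<Rightarrow> real set \<Rightarrow> bool" where
  "n_times_differentiable_on n f S \<longleftrightarrow> (\<forall>i<n. nderiv_within S i f differentiable_on S)"

text \<open>
  A finite sequence of \<open>N\<close> intervals \<open>[c i, d i]\<close>, \<open>i < N\<close>. The case \<open>N = 0\<close> is allowed; its sum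
  is \<open>0\<close>, which gives the suprema below the value \<open>0\<close> when there is no nonempty admissible
  collection. In all uses the endpoints lie in \<open>K \<subseteq> {a..b}\<close>, so the requirement that the
  intervals be contained in \<open>{a..b}\<close> holds automatically and is not repeated.
\<close>

definition nonoverlapping :: "nat \<Rightarrow> (nat \<Rightarrow> real) \<Rightarrow> (nat \<Rightarrow> real) \<Rightarrow> bool" where
  "nonoverlapping N c d \<longleftrightarrow>
     (\<forall>i<N. c i < d i) \<and> disjoint_family_on (\<lambda>i. {c i<..<d i}) {..<N}"

definition frac_variation :: "real \<Rightarrow> (real \<Rightarrow> real) \<Rightarrow> real set \<Rightarrow> ennreal" where
  "frac_variation \<alpha> f K =
     (SUP (N, c, d) \<in> {(N, c, d). nonoverlapping N c d \<and> (\<forall>i<N. c i \<in> K \<and> d i \<in> K)}.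
        \<Sum>i<N. ennreal (\<bar>f (d i) - f (c i)\<bar> powr \<alpha>))"

text \<open>Only used for exponents \<open>p > 0\<close>, where \<open>\<infinity>\<close> raised to the power \<open>p\<close> is \<open>\<infinity>\<close>.\<close>

definition ennreal_powr :: "ennreal \<Rightarrow> real \<Rightarrow> ennreal" where
  "ennreal_powr v p = (if v = \<infinity> then \<infinity> else ennreal (enn2real v powr p))"

definition gen_variation_sum ::
    "nat \<Rightarrow> (real \<Rightarrow> real) \<Rightarrow> real set \<Rightarrow> nat \<Rightarrow> (nat \<Rightarrow> real) \<Rightarrow> (nat \<Rightarrow> real) \<Rightarrow> ennreal" where
  "gen_variation_sum n f K N x y =
     (\<Sum>i<N. ennreal_powr (frac_variation (1 / (real n - 1)) f (K \<inter> {x i..y i}))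
                 ((real n - 1) / real n))"

text \<open>\<open>GV n f A K\<close> is $GV_{1/n}(f,A,K)$ and \<open>GV_bar n \<delta> f A K\<close> is
  $\overline{GV}^{\delta}_{1/n}(f,A,K)$.\<close>

definition GV :: "nat \<Rightarrow> (real \<Rightarrow> real) \<Rightarrow> real set \<Rightarrow> real set \<Rightarrow> ennreal" where
  "GV n f A K =
     (SUP (N, x, y) \<in> {(N, x, y). nonoverlapping N x y \<and> (\<forall>i<N. x i \<in> A \<and> y i \<in> A)}.
        gen_variation_sum n f K N x y)"

definition GV_bar :: "nat \<Rightarrow> real \<Rightarrow> (real \<Rightarrow> real) \<Rightarrow> real set \<Rightarrow> real set \<Rightarrow> ennreal" where
  "GV_bar n \<delta> f A K =
     (SUP (N, x, y) \<in> {(N, x, y). nonoverlapping N x y \<and>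
          (\<forall>i<N. y i - x i \<le> \<delta> \<and> x i \<in> K \<and> y i \<in> K \<and> {x i, y i} \<inter> A \<noteq> {})}.
        gen_variation_sum n f K N x y)"

end

theory Submission
  imports Defs "HOL-Probability.Distribution_Functions"
begin

text \<open>
  Write \<open>\<alpha> = 1 / (n - 1)\<close> and \<open>\<gamma> = 1 / n\<close>. The two finiteness conditions are compared with each
  other, and with the existence of the homeomorphism, through the function
  \<open>v t = V\<^sub>\<alpha>(id, K \<inter> [a, t])\<close>. On \<open>K\<close> it is continuous and strictly increasing, it satisfies
  \<open>(t - s) powr \<alpha> \<le> v t - v s\<close>, and \<open>v t - v s\<close> is the variation of \<open>K \<inter> [s, t]\<close>. Hence the sums
  defining \<open>GV\<close> and \<open>GV_bar\<close> are the sums of \<open>(v (y i) - v (x i)) powr (1 - \<gamma>)\<close>, so that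
  \<open>GV n id A K < \<infinity>\<close> says that \<open>v ` A\<close> has finite \<open>(1 - \<gamma>)\<close>-variation.

  The analytic core is that a set \<open>B\<close> of finite \<open>(1 - \<gamma>)\<close>-variation has \<open>dist(t, B) powr (-\<gamma>)\<close>
  integrable (lemma \<open>pole_integral\<close>): for a finite set, integrate between consecutive points; the
  general case follows by monotone convergence along a dense sequence. For countably many such sets,
  restrict the kernels to the places where they are large, so that even after multiplication by
  \<open>2 ^ k\<close> their sum remains integrable. The primitive \<open>G\<close> of that sum (lemma \<open>time_change\<close>) is
  continuous and grows near each point of the \<open>m\<close>-th set at least like \<open>2 ^ k\<close> times the increment
  of \<open>t\<close> divided by the \<open>\<gamma>\<close>-th power of the distance, for every \<open>k \<ge> m\<close>, as soon as the
  distance is small enough in terms of \<open>k\<close>.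

  This yields the equivalence of the second and third conditions. For a pair \<open>x, y\<close> of points of \<open>K\<close>,
  close to each other, one of which lies in a set of index at most \<open>k\<close>,
  \<open>(v y - v x) powr (1 - \<gamma>) \<le> (G (v y) - G (v x)) / 2 ^ k\<close>, and the right hand sides add up to at
  most a constant divided by \<open>2 ^ k\<close> (lemma \<open>GV_bar_tendsto_zero\<close>). Conversely a finite \<open>GV_bar\<close>
  bounds the short intervals in a sum for \<open>GV\<close>, and there are boundedly many long ones.

  If \<open>h\<close> is a flat homeomorphism, Taylor's formula bounds the variation of \<open>K\<close> between two points by
  the supremum of the derivative of order \<open>n - 1\<close> and by the distance of the two preimages. The
  sets of the second condition are, for each \<open>m\<close>, the images of the flat points \<open>x\<close> such that the
  derivative of order \<open>n - 1\<close> is at most \<open>m * \<bar>y - x\<bar>\<close> in absolute value at every \<open>y\<close>. They exhaust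
  the flat points, since the derivative of order \<open>n\<close> exists there.

  For the construction of \<open>h\<close>, add one point on each side of \<open>[a, b]\<close> to \<open>K\<close>, and use \<open>g = G \<circ> v\<close> on
  the enlarged set to prescribe the inverse of \<open>h\<close>. On the interval \<open>[g p, g q]\<close> over a gap \<open>(p, q)\<close>
  of \<open>K\<close> let \<open>h\<close> be a rescaled polynomial step, flat at both ends. The growth of \<open>G\<close> is what makes the
  derivatives of order less than \<open>n\<close> of the glued function tend to zero faster than the distance to
  any given point of \<open>g ` K\<close> (lemmas \<open>gap_estimate\<close> and \<open>H_deriv_Z\<close>). Restricting to the preimage of
  \<open>[a, b]\<close> and rescaling gives \<open>h\<close>; the two added points ensure that \<open>h\<close> is not made flat at \<open>a\<close> or
  \<open>b\<close> unless that point belongs to \<open>K\<close>.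
\<close>


section \<open>Fractional variation of the identity\<close>

lemma nonoverlapping_iff:
  "nonoverlapping N c d \<longleftrightarrow>
     (\<forall>i<N. c i < d i) \<and> (\<forall>i<N. \<forall>j<N. i \<noteq> j \<longrightarrow> d i \<le> c j \<or> d j \<le> c i)"
proof (cases "\<forall>i<N. c i < d i")
  case True
  have "({c i<..<d i} \<inter> {c j<..<d j} = {}) \<longleftrightarrow> d i \<le> c j \<or> d j \<le> c i"
    if "i < N" "j < N" for i j
  proof
    assume *: "{c i<..<d i} \<inter> {c j<..<d j} = {}"
    show "d i \<le> c j \<or> d j \<le> c i"
    proof (rule ccontr)
      assume "\<not> ?thesis"
      with True that have "max (c i) (c j) < min (d i) (d j)" by auto
      then obtain z where "max (c i) (c j) < z" "z < min (d i) (d j)" using dense by blast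
      with * show False by auto
    qed
  qed auto
  with True show ?thesis
    unfolding nonoverlapping_def disjoint_family_on_def by auto
qed (auto simp: nonoverlapping_def)

text \<open>
  Intervals may be abutting and are not listed in any order; the proof peels off the rightmost one.
\<close>

lemma sum_increments_le:
  fixes W :: "real \<Rightarrow> real"
  assumes "nonoverlapping N c d" and "mono_on E W" and "\<And>i. i < N \<Longrightarrow> c i \<in> E \<and> d i \<in> E"
    and "\<And>z. z \<in> E \<Longrightarrow> lo \<le> W z \<and> W z \<le> hi" and "lo \<le> hi"
  shows "(\<Sum>i<N. W (d i) - W (c i)) \<le> hi - lo"
proof -
  have "(\<Sum>i\<in>S. W (d i) - W (c i)) \<le> h - lo"
    if "finite S" "S \<subseteq> {..<N}" "\<forall>i\<in>S. W (d i) \<le> h" "lo \<le> h" for S h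
    using that
  proof (induction S arbitrary: h rule: finite_psubset_induct)
    case (psubset S)
    show ?case
    proof (cases "S = {}")
      case True
      then show ?thesis using psubset by simp
    next
      case False
      obtain i where i: "i \<in> S" "\<forall>j\<in>S. d j \<le> d i"
      proof -
        have "Max (d ` S) \<in> d ` S" using psubset False by simp
        then obtain i where "i \<in> S" "Max (d ` S) = d i" by auto
        then show ?thesis using that[of i] psubset(1) by (metis Max_ge finite_imageI image_eqI)
      qed
      have iN: "i < N" using i psubset by auto
      have "W (d j) \<le> W (c i)" if j: "j \<in> S - {i}" for j
      proof -
        have jN: "j < N" using j psubset by auto
        have "d j \<le> c i"
          using assms(1) i j iN jN unfolding nonoverlapping_iff by fastforce
        then show ?thesis using assms(2,3) iN jN by (simp add: mono_on_def)
      qed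
      then have "(\<Sum>j\<in>S-{i}. W (d j) - W (c j)) \<le> W (c i) - lo"
        using psubset i assms(3,4) iN by (intro psubset.IH) auto
      moreover have "W (d i) \<le> h" using psubset.prems i by auto
      ultimately show ?thesis
        using i psubset.hyps sum.remove[of S i "\<lambda>j. W (d j) - W (c j)"] by linarith
    qed
  qed
  then show ?thesis using assms by auto
qed

lemma mono_on_if_powr_increments:
  fixes W :: "real \<Rightarrow> real"
  assumes "\<And>s t. s \<in> K \<Longrightarrow> t \<in> K \<Longrightarrow> s < t \<Longrightarrow> (t - s) powr \<alpha> \<le> W t - W s"
  shows "mono_on K W"
proof (rule mono_onI)
  fix r s assume "r \<in> K" "s \<in> K" "r \<le> s"
  then show "W r \<le> W s"
    using assms[of r s] by (smt (verit) powr_ge_zero)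
qed

lemma frac_variation_least:
  assumes "\<And>N c d. nonoverlapping N c d \<Longrightarrow> (\<And>i. i < N \<Longrightarrow> c i \<in> K \<and> d i \<in> K) \<Longrightarrow>
             (\<Sum>i<N. ennreal (\<bar>f (d i) - f (c i)\<bar> powr \<alpha>)) \<le> B"
  shows "frac_variation \<alpha> f K \<le> B"
  unfolding frac_variation_def
proof (rule SUP_least, clarify)
  fix N and c d :: "nat \<Rightarrow> real"
  assume "nonoverlapping N c d" "\<forall>i<N. c i \<in> K \<and> d i \<in> K"
  then show "(\<Sum>i<N. ennreal (\<bar>f (d i) - f (c i)\<bar> powr \<alpha>)) \<le> B"
    by (intro assms) auto
qed

lemma frac_variation_upper:
  assumes "nonoverlapping N c d" "\<And>i. i < N \<Longrightarrow> c i \<in> K \<and> d i \<in> K"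
  shows "(\<Sum>i<N. ennreal (\<bar>f (d i) - f (c i)\<bar> powr \<alpha>)) \<le> frac_variation \<alpha> f K"
  unfolding frac_variation_def using assms by (intro SUP_upper2[of "(N, c, d)"]) auto

text \<open>
  Every later upper bound for a variation is obtained by exhibiting a function \<open>W\<close> on \<open>K\<close> whose
  increments dominate the terms of the sum.
\<close>

lemma frac_variation_id_le:
  fixes W :: "real \<Rightarrow> real"
  assumes W: "\<And>s t. s \<in> K \<Longrightarrow> t \<in> K \<Longrightarrow> s < t \<Longrightarrow> (t - s) powr \<alpha> \<le> W t - W s"
    and b: "\<And>z. z \<in> K \<Longrightarrow> lo \<le> W z \<and> W z \<le> hi" "lo \<le> hi"
  shows "frac_variation \<alpha> id K \<le> ennreal (hi - lo)"
proof (rule frac_variation_least)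
  fix N and c d :: "nat \<Rightarrow> real"
  assume cd: "nonoverlapping N c d" "\<And>i. i < N \<Longrightarrow> c i \<in> K \<and> d i \<in> K"
  have "mono_on K W" by (rule mono_on_if_powr_increments) (rule W)
  moreover have "(\<Sum>i<N. \<bar>d i - c i\<bar> powr \<alpha>) \<le> (\<Sum>i<N. W (d i) - W (c i))"
    using W cd by (intro sum_mono) (auto simp: nonoverlapping_iff)
  ultimately have "(\<Sum>i<N. \<bar>d i - c i\<bar> powr \<alpha>) \<le> hi - lo"
    using sum_increments_le[OF cd(1), of K W lo hi] cd(2) b by auto
  then show "(\<Sum>i<N. ennreal (\<bar>id (d i) - id (c i)\<bar> powr \<alpha>)) \<le> ennreal (hi - lo)"
    by (simp add: ennreal_leI)
qed

lemma frac_variation_mono: "K \<subseteq> L \<Longrightarrow> frac_variation \<alpha> f K \<le> frac_variation \<alpha> f L"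
  unfolding frac_variation_def by (intro SUP_subset_mono) auto

lemma nonoverlapping_extend:
  assumes "nonoverlapping N c d" "\<And>i. i < N \<Longrightarrow> d i \<le> p" "p < q"
  shows "nonoverlapping (Suc N) (c(N := p)) (d(N := q))"
  using assms by (auto simp: nonoverlapping_iff less_Suc_eq)

lemma frac_variation_extend:
  assumes "p \<in> K" "q \<in> K" "x \<le> p" "p < q"
  shows "frac_variation \<alpha> id (K \<inter> {x..p}) + ennreal ((q - p) powr \<alpha>)
           \<le> frac_variation \<alpha> id (K \<inter> {x..q})"
proof -
  let ?e = "ennreal ((q - p) powr \<alpha>)" and ?V = "frac_variation \<alpha> id (K \<inter> {x..q})"
  have step: "(\<Sum>i<N. ennreal (\<bar>id (d i) - id (c i)\<bar> powr \<alpha>)) + ?e \<le> ?V"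
    if cd: "nonoverlapping N c d" "\<And>i. i < N \<Longrightarrow> c i \<in> K \<inter> {x..p} \<and> d i \<in> K \<inter> {x..p}" for N c d
  proof -
    have *: "nonoverlapping (Suc N) (c(N := p)) (d(N := q))"
      using cd assms by (intro nonoverlapping_extend) auto
    have "(\<Sum>i<Suc N. ennreal (\<bar>id ((d(N := q)) i) - id ((c(N := p)) i)\<bar> powr \<alpha>)) \<le> ?V"
      using cd(2) assms by (intro frac_variation_upper[OF *]) (force simp: less_Suc_eq)
    moreover have "(\<Sum>i<N. ennreal (\<bar>id ((d(N := q)) i) - id ((c(N := p)) i)\<bar> powr \<alpha>)) =
       (\<Sum>i<N. ennreal (\<bar>id (d i) - id (c i)\<bar> powr \<alpha>))"
      by (intro sum.cong) auto
    ultimately show ?thesis using assms by simp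
  qed
  have "?e \<le> ?V" using step[of 0] by (simp add: nonoverlapping_iff)
  moreover have "frac_variation \<alpha> id (K \<inter> {x..p}) \<le> ?V - ?e"
    using step by (intro frac_variation_least) (simp add: ennreal_le_minus_iff)
  ultimately show ?thesis by (auto simp: ennreal_le_minus_iff)
qed

text \<open>
  The variation of the identity on the part of \<open>K\<close> between a base point \<open>x\<close> and \<open>t\<close>, as a real
  number. The value is meaningful when the variation of \<open>K\<close> is finite.
\<close>

definition running_variation :: "real \<Rightarrow> real set \<Rightarrow> real \<Rightarrow> real \<Rightarrow> real" where
  "running_variation \<alpha> K x t = enn2real (frac_variation \<alpha> id (K \<inter> {x..t}))"

context
  fixes \<alpha> :: real and K :: "real set"
  assumes \<alpha>: "0 < \<alpha>" "\<alpha> \<le> 1" and fin: "frac_variation \<alpha> id K < \<infinity>"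
begin

lemma running_variation_ennreal: "ennreal (running_variation \<alpha> K x t) = frac_variation \<alpha> id (K \<inter> {x..t})"
proof -
  have "frac_variation \<alpha> id (K \<inter> {x..t}) < \<infinity>"
    using fin by (rule le_less_trans[OF frac_variation_mono, rotated]) auto
  then show ?thesis unfolding running_variation_def by (simp add: less_top)
qed

lemma running_variation_nonneg: "0 \<le> running_variation \<alpha> K x t"
  by (simp add: running_variation_def)

lemma running_variation_mono: "t \<le> t' \<Longrightarrow> running_variation \<alpha> K x t \<le> running_variation \<alpha> K x t'"
  using frac_variation_mono[of "K \<inter> {x..t}" "K \<inter> {x..t'}" \<alpha> id]
  by (auto simp: running_variation_ennreal[symmetric] running_variation_nonneg subset_eq)

lemma running_variation_increment:
  assumes "p \<in> K" "q \<in> K" "x \<le> p" "p < q"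
  shows "(q - p) powr \<alpha> \<le> running_variation \<alpha> K x q - running_variation \<alpha> K x p"
  using frac_variation_extend[OF assms, of \<alpha>] running_variation_nonneg
  by (auto simp: running_variation_ennreal[symmetric] simp flip: ennreal_plus)

lemma powr_diff_split:
  fixes c x d :: real
  assumes "c \<le> x" "x \<le> d"
  shows "(d - c) powr \<alpha> \<le> (x - c) powr \<alpha> + (d - x) powr \<alpha>"
proof (cases "c = x \<or> x = d")
  case False
  define A B where "A = x - c" and "B = d - x"
  have pos: "A > 0" "B > 0" using assms False by (auto simp: A_def B_def)
  have 1: "A / (A + B) \<le> (A / (A + B)) powr \<alpha>" "B / (A + B) \<le> (B / (A + B)) powr \<alpha>"
    using pos \<alpha> powr_mono'[of \<alpha> 1 "A/(A+B)"] powr_mono'[of \<alpha> 1 "B/(A+B)"] by auto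
  have "1 = A / (A + B) + B / (A + B)" using pos by (simp flip: add_divide_distrib)
  also have "\<dots> \<le> (A / (A + B)) powr \<alpha> + (B / (A + B)) powr \<alpha>" using 1 by simp
  also have "\<dots> = (A powr \<alpha> + B powr \<alpha>) / (A + B) powr \<alpha>"
    using pos by (simp add: powr_divide add_divide_distrib)
  finally have "(A + B) powr \<alpha> \<le> A powr \<alpha> + B powr \<alpha>" using pos by (simp add: field_simps)
  then show ?thesis by (simp add: A_def B_def)
qed auto

text \<open>
  Additivity: for \<open>\<alpha> \<le> 1\<close>, splitting an interval at a point of \<open>K\<close> does not decrease the sum.
\<close>

lemma frac_variation_interval:
  assumes "p \<in> K" "q \<in> K" "x \<le> p" "p \<le> q"
  shows "frac_variation \<alpha> id (K \<inter> {p..q}) = ennreal (running_variation \<alpha> K x q - running_variation \<alpha> K x p)"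
proof (rule antisym)
  show "frac_variation \<alpha> id (K \<inter> {p..q}) \<le> ennreal (running_variation \<alpha> K x q - running_variation \<alpha> K x p)"
    using assms by (intro frac_variation_id_le[where W = "running_variation \<alpha> K x"] running_variation_increment)
       (auto intro: running_variation_mono)
next
  \<comment> \<open>Gluing the variation up to \<open>p\<close> and the variation counted from \<open>p\<close> dominates all increments.\<close>
  define W where "W t = (if t \<le> p then running_variation \<alpha> K x t else running_variation \<alpha> K x p + running_variation \<alpha> K p t)" for t
  have "frac_variation \<alpha> id (K \<inter> {x..q}) \<le> ennreal (running_variation \<alpha> K x p + running_variation \<alpha> K p q - 0)"
  proof (rule frac_variation_id_le[where W = W])
    fix s t assume st: "s \<in> K \<inter> {x..q}" "t \<in> K \<inter> {x..q}" "s < t"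
    consider "t \<le> p" | "s \<le> p" "p < t" | "p < s" by linarith
    then show "(t - s) powr \<alpha> \<le> W t - W s"
    proof cases
      case 1
      then show ?thesis using st assms running_variation_increment[of s t x] by (auto simp: W_def)
    next
      case 2
      have "(p - s) powr \<alpha> \<le> running_variation \<alpha> K x p - running_variation \<alpha> K x s"
        using running_variation_increment[of s p x] 2 st assms by (cases "s = p") auto
      moreover have "(t - p) powr \<alpha> \<le> running_variation \<alpha> K p t"
        using running_variation_increment[of p t p] running_variation_nonneg[of p p] 2 st assms by auto
      ultimately show ?thesis using powr_diff_split[of s p t] 2 by (simp add: W_def)
    next
      case 3
      then show ?thesis using st assms running_variation_increment[of s t p] by (auto simp: W_def)
    qed
  next
    fix z assume "z \<in> K \<inter> {x..q}"
    then show "0 \<le> W z \<and> W z \<le> running_variation \<alpha> K x p + running_variation \<alpha> K p q"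
      using running_variation_nonneg[of p q] running_variation_nonneg running_variation_mono[of z p x] running_variation_mono[of z q p]
      by (auto simp: W_def intro: add_increasing2)
  qed (simp add: running_variation_nonneg)
  then have "running_variation \<alpha> K x q - running_variation \<alpha> K x p \<le> running_variation \<alpha> K p q"
    by (simp add: running_variation_ennreal[symmetric] running_variation_nonneg flip: ennreal_plus)
  then show "ennreal (running_variation \<alpha> K x q - running_variation \<alpha> K x p) \<le> frac_variation \<alpha> id (K \<inter> {p..q})"
    by (simp add: running_variation_ennreal[symmetric] ennreal_leI)
qed

lemma frac_variation_family:
  assumes "p \<in> K" "q \<in> K" "x \<le> p" "p \<le> q" "0 < e"
  obtains N c d where "nonoverlapping N c d" "\<And>i. i < N \<Longrightarrow> c i \<in> K \<inter> {p..q} \<and> d i \<in> K \<inter> {p..q}"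
    "running_variation \<alpha> K x q - running_variation \<alpha> K x p - e < (\<Sum>i<N. (d i - c i) powr \<alpha>)"
proof (cases "running_variation \<alpha> K x q - running_variation \<alpha> K x p - e < 0")
  case True
  then show ?thesis using that[of 0] by (simp add: nonoverlapping_iff)
next
  case False
  have "ennreal (running_variation \<alpha> K x q - running_variation \<alpha> K x p - e) < frac_variation \<alpha> id (K \<inter> {p..q})"
    using False assms by (subst frac_variation_interval[OF assms(1-4)]) (auto simp: ennreal_less_iff)
  then obtain N c d where cd: "nonoverlapping N c d" "\<forall>i<N. c i \<in> K \<inter> {p..q} \<and> d i \<in> K \<inter> {p..q}"
    and s: "ennreal (running_variation \<alpha> K x q - running_variation \<alpha> K x p - e) < (\<Sum>i<N. ennreal (\<bar>id (d i) - id (c i)\<bar> powr \<alpha>))"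
    unfolding frac_variation_def less_SUP_iff by (auto simp: case_prod_unfold)
  have "(\<Sum>i<N. \<bar>d i - c i\<bar> powr \<alpha>) = (\<Sum>i<N. (d i - c i) powr \<alpha>)"
    using cd by (intro sum.cong) (auto simp: nonoverlapping_iff)
  then show ?thesis using that[OF cd(1)] cd(2) s False by (auto simp: ennreal_less_iff)
qed

text \<open>
  Continuity from the right along \<open>K\<close>. A family that is almost optimal on the right of \<open>p\<close> has all
  its endpoints other than \<open>p\<close> beyond any \<open>y > p\<close> sufficiently close to \<open>p\<close>. Hence moving \<open>p\<close> to
  \<open>y\<close> changes its sum by at most \<open>(y - p) powr \<alpha>\<close>, which forces \<open>v y - v p\<close> to be small.
\<close>

lemma running_variation_right:
  assumes "p \<in> K" "x \<le> p" "0 < e"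
  shows "\<exists>\<eta>>0. \<forall>y\<in>K. p < y \<and> y < p + \<eta> \<longrightarrow> running_variation \<alpha> K x y - running_variation \<alpha> K x p < e"
proof (cases "\<exists>y0\<in>K. p < y0")
  case False
  then show ?thesis by (auto intro!: exI[of _ 1])
next
  case True
  then obtain y0 where y0: "y0 \<in> K" "p < y0" by blast
  obtain N c d where cd: "nonoverlapping N c d"
    "\<And>i. i < N \<Longrightarrow> c i \<in> K \<inter> {p..y0} \<and> d i \<in> K \<inter> {p..y0}"
    "running_variation \<alpha> K x y0 - running_variation \<alpha> K x p - e/2 < (\<Sum>i<N. (d i - c i) powr \<alpha>)"
    using frac_variation_family[of p y0 x "e/2"] assms y0 by auto
  define F where "F = {z \<in> insert y0 (c ` {..<N} \<union> d ` {..<N}). p < z}"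
  have F: "finite F" "y0 \<in> F" using y0 by (auto simp: F_def)
  define \<eta> where "\<eta> = min (Min F - p) ((e/2) powr (1/\<alpha>))"
  have "Min F \<in> F" using F by (intro Min_in) auto
  then have "\<eta> > 0" using assms by (auto simp: \<eta>_def F_def)
  moreover have "running_variation \<alpha> K x y - running_variation \<alpha> K x p < e" if y: "y \<in> K" "p < y" "y < p + \<eta>" for y
  proof -
    have yF: "y \<le> z" if "z \<in> F" for z
      using Min_le[OF F(1) that] y by (simp add: \<eta>_def)
    have small: "(y - p) powr \<alpha> \<le> e/2"
    proof -
      have "(y - p) powr \<alpha> \<le> ((e/2) powr (1/\<alpha>)) powr \<alpha>"
        using y \<alpha> by (intro powr_mono2) (auto simp: \<eta>_def)
      then show ?thesis using \<alpha> assms by (simp add: powr_powr)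
    qed
    \<comment> \<open>dominates the increments over \<open>p\<close> and the points of \<open>K\<close> from \<open>y\<close> on; it jumps only by
       \<open>(y - p) powr \<alpha>\<close> between \<open>p\<close> and \<open>y\<close>\<close>
    define W where "W t = (if t = p then 0 else (y - p) powr \<alpha> + running_variation \<alpha> K x t - running_variation \<alpha> K x y)" for t
    define E where "E = {p} \<union> (K \<inter> {y..y0})"
    have yy0: "y \<le> y0" using yF F by auto
    have EW: "(t - s) powr \<alpha> \<le> W t - W s" if "s \<in> E" "t \<in> E" "s < t" for s t
    proof (cases "s = p")
      case True
      with that y have ty: "y \<le> t" "t \<in> K" by (auto simp: E_def)
      have "(t - y) powr \<alpha> \<le> running_variation \<alpha> K x t - running_variation \<alpha> K x y"
        using running_variation_increment[of y t x] y ty assms by (cases "t = y") auto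
      then show ?thesis using True that powr_diff_split[of p y t] ty y by (auto simp: W_def)
    next
      case False
      then have "s \<in> K" "t \<in> K" "y \<le> s" using that y by (auto simp: E_def)
      then show ?thesis using that running_variation_increment[of s t x] y assms by (auto simp: W_def)
    qed
    have inE: "c i \<in> E \<and> d i \<in> E" if "i < N" for i
      using cd(2)[OF that] yF[of "c i"] yF[of "d i"] that by (force simp: E_def F_def)
    have "(\<Sum>i<N. (d i - c i) powr \<alpha>) \<le> (\<Sum>i<N. W (d i) - W (c i))"
      using EW inE cd(1) by (intro sum_mono) (auto simp: nonoverlapping_iff)
    also have "\<dots> \<le> ((y - p) powr \<alpha> + running_variation \<alpha> K x y0 - running_variation \<alpha> K x y) - 0"
    proof (rule sum_increments_le[OF cd(1)])
      show "mono_on E W" using EW by (rule mono_on_if_powr_increments)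
      show "c i \<in> E \<and> d i \<in> E" if "i < N" for i by (rule inE[OF that])
      show "0 \<le> W z \<and> W z \<le> (y - p) powr \<alpha> + running_variation \<alpha> K x y0 - running_variation \<alpha> K x y" if "z \<in> E" for z
        using that running_variation_mono[of y y0 x] running_variation_mono[of z y0 x] running_variation_mono[of y z x] yy0
        by (auto simp: W_def E_def) (smt (verit) powr_ge_zero)+
      show "0 \<le> (y - p) powr \<alpha> + running_variation \<alpha> K x y0 - running_variation \<alpha> K x y"
        using running_variation_mono[of y y0 x] yy0 by (smt (verit) powr_ge_zero)
    qed
    finally show ?thesis using cd(3) small by linarith
  qed
  ultimately show ?thesis by blast
qed

lemma running_variation_left:
  assumes "q \<in> K" "x \<le> q" "0 < e"
  shows "\<exists>\<eta>>0. \<forall>y\<in>K. x \<le> y \<and> y < q \<and> q - \<eta> < y \<longrightarrow> running_variation \<alpha> K x q - running_variation \<alpha> K x y < e"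
proof (cases "\<exists>y0\<in>K. x \<le> y0 \<and> y0 < q")
  case False
  then show ?thesis by (auto intro!: exI[of _ 1])
next
  case True
  then obtain y0 where y0: "y0 \<in> K" "x \<le> y0" "y0 < q" by blast
  obtain N c d where cd: "nonoverlapping N c d"
    "\<And>i. i < N \<Longrightarrow> c i \<in> K \<inter> {y0..q} \<and> d i \<in> K \<inter> {y0..q}"
    "running_variation \<alpha> K x q - running_variation \<alpha> K x y0 - e/2 < (\<Sum>i<N. (d i - c i) powr \<alpha>)"
    using frac_variation_family[of y0 q x "e/2"] assms y0 by auto
  define F where "F = {z \<in> insert y0 (c ` {..<N} \<union> d ` {..<N}). z < q}"
  have F: "finite F" "y0 \<in> F" using y0 by (auto simp: F_def)
  define \<eta> where "\<eta> = min (q - Max F) ((e/2) powr (1/\<alpha>))"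
  have "Max F \<in> F" using F by (intro Max_in) auto
  then have "\<eta> > 0" using assms by (auto simp: \<eta>_def F_def)
  moreover have "running_variation \<alpha> K x q - running_variation \<alpha> K x y < e" if y: "y \<in> K" "x \<le> y" "y < q" "q - \<eta> < y" for y
  proof -
    have yF: "z \<le> y" if "z \<in> F" for z
      using Max_ge[OF F(1) that] y by (simp add: \<eta>_def)
    have small: "(q - y) powr \<alpha> \<le> e/2"
    proof -
      have "(q - y) powr \<alpha> \<le> ((e/2) powr (1/\<alpha>)) powr \<alpha>"
        using y \<alpha> by (intro powr_mono2) (auto simp: \<eta>_def)
      then show ?thesis using \<alpha> assms by (simp add: powr_powr)
    qed
    define W where "W t = (if t = q then (q - y) powr \<alpha> + running_variation \<alpha> K x y else running_variation \<alpha> K x t)" for t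
    define E where "E = {q} \<union> (K \<inter> {y0..y})"
    have yy0: "y0 \<le> y" using yF F by auto
    have EW: "(t - s) powr \<alpha> \<le> W t - W s" if "s \<in> E" "t \<in> E" "s < t" for s t
    proof (cases "t = q")
      case True
      with that y have ty: "s \<le> y" "s \<in> K" "x \<le> s" using y0 by (auto simp: E_def)
      have "(y - s) powr \<alpha> \<le> running_variation \<alpha> K x y - running_variation \<alpha> K x s"
        using running_variation_increment[of s y x] y ty by (cases "s = y") auto
      then show ?thesis using True that powr_diff_split[of s y q] ty y by (auto simp: W_def)
    next
      case False
      then have "s \<in> K" "t \<in> K" "x \<le> s" "s \<noteq> q" using that y y0 by (auto simp: E_def)
      then show ?thesis using that False running_variation_increment[of s t x] by (auto simp: W_def)
    qed
    have inE: "c i \<in> E \<and> d i \<in> E" if "i < N" for i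
      using cd(2)[OF that] yF[of "c i"] yF[of "d i"] that by (force simp: E_def F_def)
    have "(\<Sum>i<N. (d i - c i) powr \<alpha>) \<le> (\<Sum>i<N. W (d i) - W (c i))"
      using EW inE cd(1) by (intro sum_mono) (auto simp: nonoverlapping_iff)
    also have "\<dots> \<le> ((q - y) powr \<alpha> + running_variation \<alpha> K x y) - running_variation \<alpha> K x y0"
    proof (rule sum_increments_le[OF cd(1)])
      show "mono_on E W" using EW by (rule mono_on_if_powr_increments)
      show "c i \<in> E \<and> d i \<in> E" if "i < N" for i by (rule inE[OF that])
      show "running_variation \<alpha> K x y0 \<le> W z \<and> W z \<le> (q - y) powr \<alpha> + running_variation \<alpha> K x y" if "z \<in> E" for z
        using that running_variation_mono[of y0 y x] running_variation_mono[of z y x] running_variation_mono[of y0 z x] yy0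
        by (auto simp: W_def E_def) (smt (verit) powr_ge_zero)+
      show "running_variation \<alpha> K x y0 \<le> (q - y) powr \<alpha> + running_variation \<alpha> K x y"
        using running_variation_mono[of y0 y x] yy0 by (smt (verit) powr_ge_zero)
    qed
    finally show ?thesis using cd(3) small by linarith
  qed
  ultimately show ?thesis by blast
qed

lemma continuous_on_running_variation:
  assumes "K \<subseteq> {x..}"
  shows "continuous_on K (running_variation \<alpha> K x)"
  unfolding continuous_on_iff
proof (intro ballI allI impI)
  fix p e :: real assume "p \<in> K" "0 < e"
  obtain \<eta>1 where 1: "\<eta>1 > 0" "\<forall>y\<in>K. p < y \<and> y < p + \<eta>1 \<longrightarrow> running_variation \<alpha> K x y - running_variation \<alpha> K x p < e"
    using running_variation_right[of p x e] \<open>p \<in> K\<close> \<open>0 < e\<close> assms by auto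
  obtain \<eta>2 where 2: "\<eta>2 > 0"
    "\<forall>y\<in>K. x \<le> y \<and> y < p \<and> p - \<eta>2 < y \<longrightarrow> running_variation \<alpha> K x p - running_variation \<alpha> K x y < e"
    using running_variation_left[of p x e] \<open>p \<in> K\<close> \<open>0 < e\<close> assms by auto
  have "dist (running_variation \<alpha> K x y) (running_variation \<alpha> K x p) < e" if "y \<in> K" "dist y p < min \<eta>1 \<eta>2" for y
    using that 1 2 \<open>0 < e\<close> assms running_variation_mono[of y p x] running_variation_mono[of p y x]
    by (cases y p rule: linorder_cases) (auto simp: dist_real_def)
  then show "\<exists>d>0. \<forall>y\<in>K. dist y p < d \<longrightarrow> dist (running_variation \<alpha> K x y) (running_variation \<alpha> K x p) < e"
    using 1 2 by (intro exI[of _ "min \<eta>1 \<eta>2"]) auto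
qed

end

section \<open>A time change with prescribed poles\<close>

lemma nn_integral_powr_pole:
  fixes p L \<gamma> :: real
  assumes "\<gamma> < 1" "0 \<le> L"
  shows "(\<integral>\<^sup>+t. ennreal (\<bar>t - p\<bar> powr (-\<gamma>)) * indicator {p - L..p + L} t \<partial>lborel)
           \<le> ennreal (2 / (1 - \<gamma>) * L powr (1 - \<gamma>))"
proof -
  let ?I = "ennreal (L powr (1 - \<gamma>) / (1 - \<gamma>))"
  let ?f = "\<lambda>x. ennreal (\<bar>x\<bar> powr (-\<gamma>)) * indicator {0..L} x"
  have "(\<integral>\<^sup>+x. ?f x \<partial>lborel) = (\<integral>\<^sup>+x. ennreal (x powr (-\<gamma>)) * indicator {0..L} x \<partial>lborel)"
    by (intro nn_integral_cong) (auto simp: indicator_def)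
  also have "\<dots> = ?I"
    using has_integral_powr_from_0[of "-\<gamma>" L] assms
    by (intro nn_integral_has_integral_lebesgue') auto
  finally have I: "(\<integral>\<^sup>+x. ?f x \<partial>lborel) = ?I" .
  have R: "(\<integral>\<^sup>+t. ennreal (\<bar>t - p\<bar> powr (-\<gamma>)) * indicator {p..p + L} t \<partial>lborel) = ?I"
    by (subst nn_integral_real_affine[where c = 1 and t = p], measurable)
      (simp, subst I[symmetric], auto intro!: nn_integral_cong simp: indicator_def)
  have Le: "(\<integral>\<^sup>+t. ennreal (\<bar>t - p\<bar> powr (-\<gamma>)) * indicator {p - L..p} t \<partial>lborel) = ?I"
    by (subst nn_integral_real_affine[where c = "-1" and t = p], measurable)
      (simp, subst I[symmetric], auto intro!: nn_integral_cong simp: indicator_def)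
  have "(\<integral>\<^sup>+t. ennreal (\<bar>t - p\<bar> powr (-\<gamma>)) * indicator {p - L..p + L} t \<partial>lborel) \<le>
     (\<integral>\<^sup>+t. ennreal (\<bar>t - p\<bar> powr (-\<gamma>)) * indicator {p - L..p} t
            + ennreal (\<bar>t - p\<bar> powr (-\<gamma>)) * indicator {p..p + L} t \<partial>lborel)"
    by (intro nn_integral_mono) (auto simp: indicator_def)
  also have "\<dots> = ?I + ?I"
    by (subst nn_integral_add) (auto simp: R Le)
  also have "\<dots> = ennreal (2 / (1 - \<gamma>) * L powr (1 - \<gamma>))"
    using assms by (simp flip: ennreal_plus)
  finally show ?thesis .
qed

text \<open>
  For \<open>\<gamma> > 0\<close> and \<open>t\<close> at positive distance from \<open>F\<close> this is \<open>dist(t, F) powr (-\<gamma>)\<close>, written as a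
  supremum over the poles. At a pole itself
  the term of that pole is \<open>0 powr (-\<gamma>) = 0\<close> instead of \<open>\<infinity>\<close>, which is harmless since bounds are
  claimed only for \<open>t\<close> different from the pole.
\<close>

definition pole_sup :: "real \<Rightarrow> real set \<Rightarrow> real \<Rightarrow> ennreal" where
  "pole_sup \<gamma> F t = (SUP p\<in>F. ennreal (\<bar>t - p\<bar> powr (-\<gamma>)))"

lemma pole_sup_measurable [measurable (raw)]:
  "countable F \<Longrightarrow> pole_sup \<gamma> F \<in> borel_measurable borel"
  unfolding pole_sup_def by (intro borel_measurable_SUP) auto

lemma powr_pole_antimono:
  fixes s t \<gamma> :: real
  assumes "0 < \<gamma>" "0 < s" "s \<le> t" shows "t powr (-\<gamma>) \<le> s powr (-\<gamma>)"
  using assms by (intro powr_mono2') auto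

lemma pole_const:
  fixes s w b \<gamma> :: real
  shows "4 / (1 - \<gamma>) * (s + w) + (2 / (1 - \<gamma>) * b + 2 / (1 - \<gamma>) * b) = 4 / (1 - \<gamma>) * (s + b + w)"
proof -
  have c: "4 / (1 - \<gamma>) = 2 * (2 / (1 - \<gamma>))" by simp
  have "2 * \<kappa> * (s + w) + (\<kappa> * b + \<kappa> * b) = 2 * \<kappa> * (s + b + w)" for \<kappa> :: real
    by (simp add: algebra_simps)
  then show ?thesis unfolding c .
qed

text \<open>
  Induction on the largest point. On the new interval from \<open>m\<close> to \<open>q\<close> only the poles \<open>m\<close> and \<open>q\<close>
  matter, and to the left of \<open>m\<close> the new pole \<open>q\<close> is dominated by \<open>m\<close>. The term \<open>V powr (1 - \<gamma>)\<close>
  accounts for the part to the left of the smallest point.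
\<close>

lemma pole_sup_finite_aux:
  fixes F :: "real set"
  assumes \<gamma>: "0 < \<gamma>" "\<gamma> < 1" and "finite F"
  shows "F \<noteq> {} \<Longrightarrow> F \<subseteq> {0..V} \<Longrightarrow>
    \<exists>N c d. nonoverlapping N c d \<and> (\<forall>i<N. c i \<in> F \<and> d i \<in> F) \<and>
      (\<integral>\<^sup>+t. pole_sup \<gamma> F t * indicator {0..Max F} t \<partial>lborel)
        \<le> ennreal (4 / (1 - \<gamma>) * ((\<Sum>i<N. (d i - c i) powr (1 - \<gamma>)) + V powr (1 - \<gamma>)))"
  using \<open>finite F\<close>
proof (induction F rule: finite_linorder_max_induct)
  case empty
  then show ?case by simp
next
  case (insert q F)
  let ?C = "4 / (1 - \<gamma>)"
  have q: "0 \<le> q" "q \<le> V" using insert.prems by auto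
  show ?case
  proof (cases "F = {}")
    case True
    have "(\<integral>\<^sup>+t. pole_sup \<gamma> {q} t * indicator {0..q} t \<partial>lborel) \<le>
       (\<integral>\<^sup>+t. ennreal (\<bar>t - q\<bar> powr (-\<gamma>)) * indicator {q - q..q + q} t \<partial>lborel)"
      using q by (intro nn_integral_mono) (auto simp: pole_sup_def indicator_def)
    also have "\<dots> \<le> ennreal (2 / (1 - \<gamma>) * q powr (1 - \<gamma>))"
      using \<gamma> q by (intro nn_integral_powr_pole) auto
    also have "\<dots> \<le> ennreal (?C * V powr (1 - \<gamma>))"
      using \<gamma> q by (intro ennreal_leI mult_mono divide_right_mono powr_mono2) auto
    finally show ?thesis using True by (intro exI[of _ 0]) (auto simp: nonoverlapping_iff)
  next
    case False
    define m where "m = Max F"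
    have m: "m \<in> F" "\<And>p. p \<in> F \<Longrightarrow> p \<le> m" "m < q"
      using insert False by (auto simp: m_def)
    have Mx: "Max (insert q F) = q"
      using insert.hyps by (intro Max_eqI) (auto intro: less_imp_le)
    obtain N c d where cd: "nonoverlapping N c d" "\<forall>i<N. c i \<in> F \<and> d i \<in> F"
      and int: "(\<integral>\<^sup>+t. pole_sup \<gamma> F t * indicator {0..m} t \<partial>lborel)
        \<le> ennreal (?C * ((\<Sum>i<N. (d i - c i) powr (1 - \<gamma>)) + V powr (1 - \<gamma>)))"
      using insert.IH insert.prems False unfolding m_def by auto
    let ?p = "\<lambda>x t. ennreal (\<bar>t - x\<bar> powr (-\<gamma>)) * indicator {x - (q - m)..x + (q - m)} t"
    have pt: "pole_sup \<gamma> (insert q F) t * indicator {0..q} t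
       \<le> pole_sup \<gamma> F t * indicator {0..m} t + (?p m t + ?p q t)" for t
    proof -
      consider "t < 0 \<or> q < t" | "0 \<le> t" "t < m" | "0 \<le> t" "t = m" | "m < t" "t \<le> q" by linarith
      then show ?thesis
      proof cases
        case 1
        then show ?thesis by (auto simp: indicator_def)
      next
        case 2
        have "ennreal (\<bar>t - q\<bar> powr (-\<gamma>)) \<le> pole_sup \<gamma> F t"
          unfolding pole_sup_def using 2 m \<gamma>
          by (intro SUP_upper2[OF m(1)] ennreal_leI powr_pole_antimono) auto
        then have "pole_sup \<gamma> (insert q F) t \<le> pole_sup \<gamma> F t"
          by (simp add: pole_sup_def)
        then show ?thesis using 2 m by (simp add: indicator_def add_increasing2)
      next
        case 3
        have "pole_sup \<gamma> (insert q F) t \<le> pole_sup \<gamma> F t + ennreal (\<bar>t - q\<bar> powr (-\<gamma>))"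
          by (auto simp: pole_sup_def)
        then show ?thesis using 3 m by (simp add: indicator_def)
      next
        case 4
        have "pole_sup \<gamma> F t \<le> ennreal (\<bar>t - m\<bar> powr (-\<gamma>))"
          unfolding pole_sup_def using 4 m(2) \<gamma>
          by (intro SUP_least ennreal_leI powr_pole_antimono) (force simp: abs_if)+
        then have "pole_sup \<gamma> (insert q F) t \<le> ennreal (\<bar>t - m\<bar> powr (-\<gamma>)) + ennreal (\<bar>t - q\<bar> powr (-\<gamma>))"
          by (auto simp: pole_sup_def intro: add_increasing2)
        then show ?thesis using 4 m by (simp add: indicator_def)
      qed
    qed
    have F: "countable F" using insert by (simp add: countable_finite)
    note [measurable] = pole_sup_measurable[OF F]
    have "(\<integral>\<^sup>+t. pole_sup \<gamma> (insert q F) t * indicator {0..q} t \<partial>lborel) \<le>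
       (\<integral>\<^sup>+t. pole_sup \<gamma> F t * indicator {0..m} t + (?p m t + ?p q t) \<partial>lborel)"
      by (intro nn_integral_mono pt)
    also have "\<dots> = (\<integral>\<^sup>+t. pole_sup \<gamma> F t * indicator {0..m} t \<partial>lborel) +
        ((\<integral>\<^sup>+t. ?p m t \<partial>lborel) + (\<integral>\<^sup>+t. ?p q t \<partial>lborel))"
      by (simp add: nn_integral_add)
    also have "\<dots> \<le> ennreal (?C * ((\<Sum>i<N. (d i - c i) powr (1 - \<gamma>)) + V powr (1 - \<gamma>))) +
       (ennreal (2 / (1 - \<gamma>) * (q - m) powr (1 - \<gamma>)) + ennreal (2 / (1 - \<gamma>) * (q - m) powr (1 - \<gamma>)))"
      using \<gamma> m by (intro add_mono int nn_integral_powr_pole) auto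
    also have "\<dots> = ennreal (?C * ((\<Sum>i<N. (d i - c i) powr (1 - \<gamma>)) + (q - m) powr (1 - \<gamma>) + V powr (1 - \<gamma>)))"
      using \<gamma> by (simp only: pole_const[symmetric]) (simp flip: ennreal_plus add: sum_nonneg)
    also have "(\<Sum>i<N. (d i - c i) powr (1 - \<gamma>)) + (q - m) powr (1 - \<gamma>) =
       (\<Sum>i<Suc N. ((d(N := q)) i - (c(N := m)) i) powr (1 - \<gamma>))"
      by simp
    finally have "(\<integral>\<^sup>+t. pole_sup \<gamma> (insert q F) t * indicator {0..q} t \<partial>lborel) \<le>
      ennreal (?C * ((\<Sum>i<Suc N. ((d(N := q)) i - (c(N := m)) i) powr (1 - \<gamma>)) + V powr (1 - \<gamma>)))" .
    moreover have "nonoverlapping (Suc N) (c(N := m)) (d(N := q))"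
      using cd m by (intro nonoverlapping_extend) auto
    moreover have "\<forall>i<Suc N. (c(N := m)) i \<in> insert q F \<and> (d(N := q)) i \<in> insert q F"
      using cd(2) m by (auto simp: less_Suc_eq)
    ultimately show ?thesis unfolding Mx
      by (intro exI[of _ "Suc N"] exI[of _ "c(N := m)"] exI[of _ "d(N := q)"] conjI)
  qed
qed

lemma pole_sup_finite:
  fixes F :: "real set"
  assumes \<gamma>: "0 < \<gamma>" "\<gamma> < 1" and F: "finite F" "F \<noteq> {}" "F \<subseteq> {0..V}"
    and M: "\<And>N c d. nonoverlapping N c d \<Longrightarrow> (\<And>i. i < N \<Longrightarrow> c i \<in> F \<and> d i \<in> F) \<Longrightarrow>
        (\<Sum>i<N. (d i - c i) powr (1 - \<gamma>)) \<le> M"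
  shows "(\<integral>\<^sup>+t. pole_sup \<gamma> F t * indicator {0..V} t \<partial>lborel)
        \<le> ennreal (4 / (1 - \<gamma>) * (M + 2 * V powr (1 - \<gamma>)))"
proof -
  define m where "m = Max F"
  have m: "m \<in> F" "\<And>p. p \<in> F \<Longrightarrow> p \<le> m"
    using F Max_in[of F] by (auto simp: m_def)
  then have m0: "0 \<le> m" "m \<le> V" using F by auto
  obtain N c d where cd: "nonoverlapping N c d" "\<forall>i<N. c i \<in> F \<and> d i \<in> F"
    and int: "(\<integral>\<^sup>+t. pole_sup \<gamma> F t * indicator {0..m} t \<partial>lborel)
        \<le> ennreal (4 / (1 - \<gamma>) * ((\<Sum>i<N. (d i - c i) powr (1 - \<gamma>)) + V powr (1 - \<gamma>)))"
    using pole_sup_finite_aux[OF \<gamma> F(1), of V] F unfolding m_def by auto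
  have sM: "0 \<le> (\<Sum>i<N. (d i - c i) powr (1 - \<gamma>))" "(\<Sum>i<N. (d i - c i) powr (1 - \<gamma>)) \<le> M"
    using cd by (auto intro: M sum_nonneg)
  let ?p = "\<lambda>t. ennreal (\<bar>t - m\<bar> powr (-\<gamma>)) * indicator {m - V..m + V} t"
  have pt: "pole_sup \<gamma> F t * indicator {0..V} t \<le> pole_sup \<gamma> F t * indicator {0..m} t + ?p t" for t
  proof (cases "m < t \<and> t \<le> V")
    case True
    have "pole_sup \<gamma> F t \<le> ennreal (\<bar>t - m\<bar> powr (-\<gamma>))"
      unfolding pole_sup_def using True m(2) \<gamma>
      by (intro SUP_least ennreal_leI powr_pole_antimono) (force simp: abs_if)+
    then show ?thesis using True m m0 by (auto simp: indicator_def)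
  qed (auto simp: indicator_def add_increasing2)
  have cF: "countable F" using F by (simp add: countable_finite)
  note [measurable] = pole_sup_measurable[OF cF]
  have "(\<integral>\<^sup>+t. pole_sup \<gamma> F t * indicator {0..V} t \<partial>lborel) \<le>
       (\<integral>\<^sup>+t. pole_sup \<gamma> F t * indicator {0..m} t + ?p t \<partial>lborel)"
    by (intro nn_integral_mono pt)
  also have "\<dots> = (\<integral>\<^sup>+t. pole_sup \<gamma> F t * indicator {0..m} t \<partial>lborel) + (\<integral>\<^sup>+t. ?p t \<partial>lborel)"
    by (simp add: nn_integral_add)
  also have "\<dots> \<le> ennreal (4 / (1 - \<gamma>) * ((\<Sum>i<N. (d i - c i) powr (1 - \<gamma>)) + V powr (1 - \<gamma>)))
      + ennreal (2 / (1 - \<gamma>) * V powr (1 - \<gamma>))"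
    using \<gamma> m m0 by (intro add_mono int nn_integral_powr_pole) auto
  also have "\<dots> \<le> ennreal (4 / (1 - \<gamma>) * (M + V powr (1 - \<gamma>))) + ennreal (4 / (1 - \<gamma>) * V powr (1 - \<gamma>))"
    using \<gamma> sM by (intro add_mono ennreal_leI mult_mono divide_right_mono) auto
  also have "\<dots> = ennreal (4 / (1 - \<gamma>) * (M + 2 * V powr (1 - \<gamma>)))"
    using \<gamma> sM by (subst ennreal_plus[symmetric]) (auto simp: ring_distribs)
  finally show ?thesis .
qed

text \<open>
  A set of finite \<open>(1 - \<gamma>)\<close>-variation admits an integrable function that dominates
  \<open>\<bar>t - t0\<bar> powr (-\<gamma>)\<close> simultaneously for all its points \<open>t0\<close>.
\<close>

lemma pole_integral:
  fixes B :: "real set"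
  assumes \<gamma>: "0 < \<gamma>" "\<gamma> < 1" and B: "B \<subseteq> {0..V}"
    and M: "\<And>N c d. nonoverlapping N c d \<Longrightarrow> (\<And>i. i < N \<Longrightarrow> c i \<in> B \<and> d i \<in> B) \<Longrightarrow>
        (\<Sum>i<N. (d i - c i) powr (1 - \<gamma>)) \<le> M"
  shows "\<exists>\<phi> :: real \<Rightarrow> ennreal. \<phi> \<in> borel_measurable borel \<and>
     (\<integral>\<^sup>+t. \<phi> t * indicator {0..V} t \<partial>lborel) < \<infinity> \<and>
     (\<forall>t0\<in>B. \<forall>t. t \<noteq> t0 \<longrightarrow> ennreal (\<bar>t - t0\<bar> powr (-\<gamma>)) \<le> \<phi> t)"
proof -
  \<comment> \<open>poles on a countable dense subset suffice, and give a measurable supremum\<close>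
  obtain D where D: "countable D" "D \<subseteq> B" "B \<subseteq> closure D"
    by (rule separable)
  have "(\<integral>\<^sup>+t. pole_sup \<gamma> D t * indicator {0..V} t \<partial>lborel) < \<infinity>"
  proof (cases "D = {}")
    case True
    then show ?thesis by (simp add: pole_sup_def bot_ennreal)
  next
    case False
    define e where "e = from_nat_into D"
    have D_eq: "D = range e" using D False by (simp add: e_def range_from_nat_into)
    let ?F = "\<lambda>j. e ` {..j::nat}"
    have cF: "countable (?F j)" for j by simp
    note [measurable] = pole_sup_measurable[OF cF]
    have sup: "pole_sup \<gamma> D t = (SUP j. pole_sup \<gamma> (?F j) t)" for t
    proof (rule antisym)
      show "pole_sup \<gamma> D t \<le> (SUP j. pole_sup \<gamma> (?F j) t)"
        unfolding D_eq pole_sup_def[of \<gamma> "range e"]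
      proof (rule SUP_least)
        fix p assume "p \<in> range e"
        then obtain j where "p = e j" by auto
        then have "ennreal (\<bar>t - p\<bar> powr (-\<gamma>)) \<le> pole_sup \<gamma> (?F j) t"
          unfolding pole_sup_def by (intro SUP_upper) auto
        then show "ennreal (\<bar>t - p\<bar> powr (-\<gamma>)) \<le> (SUP j. pole_sup \<gamma> (?F j) t)"
          by (rule SUP_upper2[OF UNIV_I])
      qed
      show "(SUP j. pole_sup \<gamma> (?F j) t) \<le> pole_sup \<gamma> D t"
        unfolding pole_sup_def D_eq by (intro SUP_least SUP_upper) auto
    qed
    have "(\<integral>\<^sup>+t. pole_sup \<gamma> D t * indicator {0..V} t \<partial>lborel) =
        (\<integral>\<^sup>+t. (SUP j. pole_sup \<gamma> (?F j) t * indicator {0..V} t) \<partial>lborel)"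
      by (simp add: sup SUP_mult_right_ennreal)
    also have "\<dots> = (SUP j. \<integral>\<^sup>+t. pole_sup \<gamma> (?F j) t * indicator {0..V} t \<partial>lborel)"
      by (intro nn_integral_monotone_convergence_SUP)
         (auto simp: incseq_def le_fun_def pole_sup_def intro!: mult_right_mono SUP_subset_mono)
    also have "\<dots> \<le> ennreal (4 / (1 - \<gamma>) * (M + 2 * V powr (1 - \<gamma>)))"
    proof (intro SUP_least pole_sup_finite \<gamma>)
      fix j
      have FB: "?F j \<subseteq> B" using D D_eq by auto
      show "finite (?F j)" "?F j \<noteq> {}" by auto
      show "?F j \<subseteq> {0..V}" using FB B by (rule subset_trans)
      show "(\<Sum>i<N. (d i - c i) powr (1 - \<gamma>)) \<le> M"
        if "nonoverlapping N c d" "\<And>i. i < N \<Longrightarrow> c i \<in> ?F j \<and> d i \<in> ?F j" for N c d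
        using that FB by (intro M) blast+
    qed
    also have "\<dots> < \<infinity>" by simp
    finally show ?thesis .
  qed
  moreover have "ennreal (\<bar>t - t0\<bar> powr (-\<gamma>)) \<le> pole_sup \<gamma> D t" if t: "t0 \<in> B" "t \<noteq> t0" for t t0
  proof -
    obtain s where s: "\<And>n. s n \<in> D" "s \<longlonglongrightarrow> t0"
      using D t closure_sequential by blast
    have "(\<lambda>n. ennreal (\<bar>t - s n\<bar> powr (-\<gamma>))) \<longlonglongrightarrow> ennreal (\<bar>t - t0\<bar> powr (-\<gamma>))"
      using t s by (intro tendsto_ennrealI tendsto_intros) auto
    then show ?thesis
      by (rule LIMSEQ_le_const2) (auto simp: pole_sup_def intro!: SUP_upper s exI[of _ 0])
  qed
  ultimately show ?thesis using pole_sup_measurable[OF D(1)] by blast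
qed

lemma nn_integral_truncate:
  fixes \<phi> :: "real \<Rightarrow> ennreal"
  assumes [measurable]: "\<phi> \<in> borel_measurable borel"
    and fin: "(\<integral>\<^sup>+t. \<phi> t * indicator S t \<partial>lborel) < \<infinity>" and [measurable]: "S \<in> sets borel" and "0 < e"
  shows "\<exists>L::nat. (\<integral>\<^sup>+t. \<phi> t * indicator {s. of_nat L < \<phi> s} t * indicator S t \<partial>lborel) < e"
proof -
  let ?f = "\<lambda>i::nat. \<lambda>t. \<phi> t * indicator {s. of_nat i < \<phi> s} t * indicator S t"
  have 0: "(\<integral>\<^sup>+t. ?f 0 t \<partial>lborel) < \<infinity>"
    by (rule le_less_trans[OF nn_integral_mono fin]) (auto simp: indicator_def)
  have "AE t in lborel. \<phi> t * indicator S t \<noteq> \<infinity>"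
    using fin by (intro nn_integral_PInf_AE) auto
  then have "AE t in lborel. (INF i. ?f i t) = 0"
  proof eventually_elim
    case (elim t)
    show ?case
    proof (cases "t \<in> S")
      case True
      with elim have "\<phi> t < top" by (simp add: less_top)
      then obtain i where "\<phi> t < of_nat i" using ennreal_Ex_less_of_nat by blast
      then have "?f i t = 0" by (auto simp: indicator_def)
      moreover have "(INF i. ?f i t) \<le> ?f i t" by (rule INF_lower) simp
      ultimately show ?thesis by (simp only: le_zero_eq)
    qed simp
  qed
  then have "(\<integral>\<^sup>+t. (INF i. ?f i t) \<partial>lborel) = 0"
    by (subst nn_integral_0_iff_AE) auto
  moreover have "(\<integral>\<^sup>+t. (INF i. ?f i t) \<partial>lborel) = (INF i. \<integral>\<^sup>+t. ?f i t \<partial>lborel)"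
  proof (rule nn_integral_monotone_convergence_INF_AE[where i = 0])
    fix i :: nat
    have "?f (Suc i) t \<le> ?f i t" for t
    proof -
      have "(of_nat i :: ennreal) < \<phi> t" if "of_nat (Suc i) < \<phi> t"
        using of_nat_mono[of i "Suc i"] that by (rule le_less_trans) simp
      then show ?thesis by (auto simp: indicator_def simp del: of_nat_Suc)
    qed
    then show "AE t in lborel. ?f (Suc i) t \<le> ?f i t" by simp
  qed (use 0 in auto)
  ultimately have "(INF i. \<integral>\<^sup>+t. ?f i t \<partial>lborel) < e" using \<open>0 < e\<close> by simp
  then show ?thesis by (auto simp: INF_less_iff)
qed

text \<open>
  The second bound with arbitrary \<open>k \<ge> m\<close> is the decisive one: near a point of \<open>B m\<close> the function
  \<open>G\<close> increases faster than any multiple of \<open>(t' - t) * r powr (-\<gamma>)\<close>, where \<open>r\<close> bounds the distance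
  to that point.
\<close>

lemma time_change:
  fixes B :: "nat \<Rightarrow> real set"
  assumes \<gamma>: "0 < \<gamma>" "\<gamma> < 1" and V: "0 \<le> V" and B: "\<And>m. B m \<subseteq> {0..V}"
    and M: "\<And>m. \<exists>M. \<forall>N c d. nonoverlapping N c d \<longrightarrow> (\<forall>i<N. c i \<in> B m \<and> d i \<in> B m) \<longrightarrow>
        (\<Sum>i<N. (d i - c i) powr (1 - \<gamma>)) \<le> M"
  obtains G :: "real \<Rightarrow> real" and \<delta> :: "nat \<Rightarrow> real"
    where "continuous_on UNIV G" "\<And>k. 0 < \<delta> k"
      "\<And>t t'. 0 \<le> t \<Longrightarrow> t \<le> t' \<Longrightarrow> t' \<le> V \<Longrightarrow> t' - t \<le> G t' - G t"
      "\<And>k m t0 t t' r. m \<le> k \<Longrightarrow> t0 \<in> B m \<Longrightarrow> 0 \<le> t \<Longrightarrow> t \<le> t' \<Longrightarrow> t' \<le> V \<Longrightarrow>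
         \<bar>t - t0\<bar> \<le> r \<Longrightarrow> \<bar>t' - t0\<bar> \<le> r \<Longrightarrow> r \<le> \<delta> k \<Longrightarrow>
         2 ^ k * (t' - t) * r powr (-\<gamma>) \<le> G t' - G t"
proof -
  have "\<exists>\<phi> :: real \<Rightarrow> ennreal. \<phi> \<in> borel_measurable borel \<and>
     (\<integral>\<^sup>+t. \<phi> t * indicator {0..V} t \<partial>lborel) < \<infinity> \<and>
     (\<forall>t0\<in>B m. \<forall>t. t \<noteq> t0 \<longrightarrow> ennreal (\<bar>t - t0\<bar> powr (-\<gamma>)) \<le> \<phi> t)" for m
    using M[of m] by (elim exE) (rule pole_integral[OF \<gamma> B], blast)
  then obtain \<phi> :: "nat \<Rightarrow> real \<Rightarrow> ennreal" where
    [measurable]: "\<And>m. \<phi> m \<in> borel_measurable borel"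
    and fin: "\<And>m. (\<integral>\<^sup>+t. \<phi> m t * indicator {0..V} t \<partial>lborel) < \<infinity>"
    and low: "\<And>m t0 t. t0 \<in> B m \<Longrightarrow> t \<noteq> t0 \<Longrightarrow> ennreal (\<bar>t - t0\<bar> powr (-\<gamma>)) \<le> \<phi> m t"
    by metis
  define \<Phi> where "\<Phi> k t = (\<Sum>m\<le>k. \<phi> m t)" for k t
  have [measurable]: "\<Phi> k \<in> borel_measurable borel" for k unfolding \<Phi>_def by measurable
  have "(\<integral>\<^sup>+t. \<Phi> k t * indicator {0..V} t \<partial>lborel) < \<infinity>" for k
    unfolding \<Phi>_def sum_distrib_right using fin by (subst nn_integral_sum) auto
  \<comment> \<open>keep only the large values of the \<open>k\<close>-th kernel, so that the remaining integral, even when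
     multiplied by \<open>2 ^ k\<close>, is summable over \<open>k\<close>\<close>
  then have "\<exists>L::nat. (\<integral>\<^sup>+t. \<Phi> k t * indicator {s. of_nat L < \<Phi> k s} t * indicator {0..V} t \<partial>lborel)
      < ennreal ((1/4) ^ k)" for k
    by (intro nn_integral_truncate) auto
  then obtain L :: "nat \<Rightarrow> nat" where
    L: "\<And>k. (\<integral>\<^sup>+t. \<Phi> k t * indicator {s. of_nat (L k) < \<Phi> k s} t * indicator {0..V} t \<partial>lborel)
      < ennreal ((1/4) ^ k)" by metis
  define T where "T k t = \<Phi> k t * indicator {s. of_nat (L k) < \<Phi> k s} t * indicator {0..V} t" for k t
  have [measurable]: "T k \<in> borel_measurable borel" for k unfolding T_def by measurable
  define \<Psi> where "\<Psi> t = indicator {0..V} t + (\<Sum>k. ennreal (2 ^ k) * T k t)" for t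
  have [measurable]: "\<Psi> \<in> borel_measurable borel" unfolding \<Psi>_def by measurable
  have "(\<integral>\<^sup>+t. \<Psi> t \<partial>lborel) = ennreal V + (\<Sum>k. ennreal (2 ^ k) * (\<integral>\<^sup>+t. T k t \<partial>lborel))"
    unfolding \<Psi>_def using V
    by (subst nn_integral_add) (auto simp: nn_integral_suminf nn_integral_cmult)
  also have "\<dots> \<le> ennreal V + (\<Sum>k. ennreal ((1/2) ^ k))"
  proof (intro add_left_mono suminf_le)
    fix k
    have "ennreal (2 ^ k) * (\<integral>\<^sup>+t. T k t \<partial>lborel) \<le> ennreal (2 ^ k) * ennreal ((1/4) ^ k)"
      using L[of k] unfolding T_def by (intro mult_left_mono) auto
    also have "\<dots> = ennreal ((1/2) ^ k)"
      by (subst ennreal_mult[symmetric]) (auto simp flip: power_mult_distrib)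
    finally show "ennreal (2 ^ k) * (\<integral>\<^sup>+t. T k t \<partial>lborel) \<le> ennreal ((1/2) ^ k)" .
  qed auto
  also have "(\<Sum>k. ennreal ((1/2) ^ k)) = ennreal (\<Sum>k. (1/2) ^ k)"
    by (intro suminf_ennreal2) (auto intro: summable_geometric)
  also have "ennreal V + ennreal (\<Sum>k. (1/2) ^ k) < \<infinity>" by simp
  finally have fin\<Psi>: "(\<integral>\<^sup>+t. \<Psi> t \<partial>lborel) < \<infinity>" .
  define \<mu> where "\<mu> = density lborel \<Psi>"
  interpret finite_borel_measure \<mu>
  proof (intro finite_borel_measure.intro finite_measureI finite_borel_measure_axioms.intro)
    have "emeasure \<mu> (space \<mu>) = (\<integral>\<^sup>+t. \<Psi> t \<partial>lborel)"
      unfolding \<mu>_def by (subst emeasure_density) auto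
    then show "emeasure \<mu> (space \<mu>) \<noteq> \<infinity>" using fin\<Psi> by simp
    show "sets \<mu> = sets borel" by (simp add: \<mu>_def)
  qed
  define G where "G = cdf \<mu>"
  have G_low: "c * (t' - t) \<le> G t' - G t"
    if "t \<le> t'" "0 \<le> c" "AE s in lborel. t < s \<and> s \<le> t' \<longrightarrow> ennreal c \<le> \<Psi> s" for c t t'
  proof (cases "t = t'")
    case False
    then have tt: "t < t'" using that by simp
    have "ennreal (c * (t' - t)) = (\<integral>\<^sup>+s. ennreal c * indicator {t<..t'} s \<partial>lborel)"
      using that by (simp add: nn_integral_cmult ennreal_mult)
    also have "\<dots> \<le> (\<integral>\<^sup>+s. \<Psi> s * indicator {t<..t'} s \<partial>lborel)"
      using that(3) by (intro nn_integral_mono_AE) (auto simp: indicator_def)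
    also have "\<dots> = emeasure \<mu> {t<..t'}" by (simp add: \<mu>_def emeasure_density)
    also have "\<dots> = ennreal (G t' - G t)"
      unfolding G_def using tt by (subst cdf_diff_eq) (auto simp: emeasure_eq_measure)
    finally show ?thesis
      using cdf_nondecreasing[of t t'] tt by (simp add: G_def)
  qed simp
  \<comment> \<open>within this distance of a pole the kernel exceeds the truncation level \<open>L k\<close>\<close>
  define \<delta> where "\<delta> k = (real (L k) + 1) powr (- 1 / \<gamma>)" for k
  show ?thesis
  proof (rule that[of G \<delta>])
    have "measure \<mu> {x} = 0" for x
    proof -
      have "emeasure \<mu> {x} = (\<integral>\<^sup>+s. \<Psi> s * indicator {x} s \<partial>lborel)"
        by (simp add: \<mu>_def emeasure_density)
      also have "\<dots> = 0" by (intro nn_integral_null_set) auto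
      finally show ?thesis by (simp add: measure_def)
    qed
    then show "continuous_on UNIV G"
      by (simp add: G_def continuous_on_eq_continuous_within isCont_cdf)
    show "0 < \<delta> k" for k by (simp add: \<delta>_def)
    show "t' - t \<le> G t' - G t" if "0 \<le> t" "t \<le> t'" "t' \<le> V" for t t'
      using G_low[of t t' 1] that by (auto simp: \<Psi>_def indicator_def)
    show "2 ^ k * (t' - t) * r powr (-\<gamma>) \<le> G t' - G t"
      if k: "m \<le> k" "t0 \<in> B m" and t: "0 \<le> t" "t \<le> t'" "t' \<le> V"
        and r: "\<bar>t - t0\<bar> \<le> r" "\<bar>t' - t0\<bar> \<le> r" "r \<le> \<delta> k" for k m t0 t t' r
    proof -
      have *: "ennreal (2 ^ k * r powr (-\<gamma>)) \<le> \<Psi> s" if s: "s \<noteq> t0" "t < s" "s \<le> t'" for s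
      proof -
        have sr: "\<bar>s - t0\<bar> \<le> r" "0 < \<bar>s - t0\<bar>" using s r by auto
        have "real (L k) < \<delta> k powr (-\<gamma>)" using \<gamma> by (simp add: \<delta>_def powr_powr)
        also have "\<dots> \<le> r powr (-\<gamma>)"
          using sr r(3) \<gamma> by (intro powr_pole_antimono) auto
        finally have Lr: "real (L k) < r powr (-\<gamma>)" .
        have "ennreal (r powr (-\<gamma>)) \<le> ennreal (\<bar>s - t0\<bar> powr (-\<gamma>))"
          using sr \<gamma> by (intro ennreal_leI powr_pole_antimono) auto
        also have "\<dots> \<le> \<phi> m s" using low k s by simp
        also have "\<dots> \<le> \<Phi> k s" unfolding \<Phi>_def using k by (intro member_le_sum) auto
        finally have 1: "ennreal (r powr (-\<gamma>)) \<le> \<Phi> k s" .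
        have "of_nat (L k) < ennreal (r powr (-\<gamma>))"
          using Lr by (simp add: ennreal_of_nat_eq_real_of_nat ennreal_less_iff)
        with 1 have "of_nat (L k) < \<Phi> k s" by simp
        then have "T k s = \<Phi> k s" using s t by (simp add: T_def)
        then have "ennreal (2 ^ k * r powr (-\<gamma>)) \<le> ennreal (2 ^ k) * T k s"
          using 1 by (simp add: ennreal_mult mult_left_mono)
        also have "\<dots> \<le> (\<Sum>k. ennreal (2 ^ k) * T k s)"
          using sum_le_suminf[of "\<lambda>k. ennreal (2 ^ k) * T k s" "{k}"] by simp
        also have "\<dots> \<le> \<Psi> s" by (simp add: \<Psi>_def add_increasing)
        finally show ?thesis .
      qed
      have "AE s in lborel. t < s \<and> s \<le> t' \<longrightarrow> ennreal (2 ^ k * r powr (-\<gamma>)) \<le> \<Psi> s"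
        using AE_lborel_singleton[of t0] by (rule eventually_mono) (use * in blast)
      then have "2 ^ k * r powr (-\<gamma>) * (t' - t) \<le> G t' - G t"
        by (intro G_low t(2)) auto
      then show ?thesis by argo
    qed
  qed
qed

section \<open>Conditions in terms of GV and GV-bar\<close>

lemma ennreal_powr_ennreal: "0 \<le> r \<Longrightarrow> ennreal_powr (ennreal r) p = ennreal (r powr p)"
  by (simp add: ennreal_powr_def)

lemma ennreal_powr_mono:
  assumes "v \<le> w" "0 \<le> p" shows "ennreal_powr v p \<le> ennreal_powr w p"
proof (cases "w = \<infinity>")
  case False
  with assms have "v \<noteq> \<infinity>" by (auto simp: top_unique)
  with assms False show ?thesis
    by (auto simp: ennreal_powr_def less_top intro!: ennreal_leI powr_mono2 enn2real_mono)
qed (simp add: ennreal_powr_def)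

lemma GV_upper:
  assumes "nonoverlapping N x y" "\<And>i. i < N \<Longrightarrow> x i \<in> A \<and> y i \<in> A"
  shows "gen_variation_sum n f K N x y \<le> GV n f A K"
  unfolding GV_def using assms by (intro SUP_upper2[of "(N, x, y)"]) auto

lemma GV_least:
  assumes "\<And>N x y. nonoverlapping N x y \<Longrightarrow> (\<And>i. i < N \<Longrightarrow> x i \<in> A \<and> y i \<in> A) \<Longrightarrow>
    gen_variation_sum n f K N x y \<le> C"
  shows "GV n f A K \<le> C"
  unfolding GV_def using assms by (intro SUP_least) auto

lemma GV_bar_upper:
  assumes "nonoverlapping N x y"
    "\<And>i. i < N \<Longrightarrow> y i - x i \<le> \<delta> \<and> x i \<in> K \<and> y i \<in> K \<and> {x i, y i} \<inter> A \<noteq> {}"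
  shows "gen_variation_sum n f K N x y \<le> GV_bar n \<delta> f A K"
  unfolding GV_bar_def using assms by (intro SUP_upper2[of "(N, x, y)"]) auto

lemma GV_bar_least:
  assumes "\<And>N x y. nonoverlapping N x y \<Longrightarrow>
    (\<And>i. i < N \<Longrightarrow> y i - x i \<le> \<delta> \<and> x i \<in> K \<and> y i \<in> K \<and> {x i, y i} \<inter> A \<noteq> {}) \<Longrightarrow>
    gen_variation_sum n f K N x y \<le> C"
  shows "GV_bar n \<delta> f A K \<le> C"
  unfolding GV_bar_def using assms by (intro SUP_least) auto

lemma GV_empty: "GV n f {} K = 0"
proof -
  have "GV n f {} K \<le> 0"
  proof (rule GV_least)
    fix N and x y :: "nat \<Rightarrow> real"
    assume "\<And>i. i < N \<Longrightarrow> x i \<in> {} \<and> y i \<in> {}"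
    then have "N = 0" by (cases N) auto
    then show "gen_variation_sum n f K N x y \<le> 0" by (simp add: gen_variation_sum_def)
  qed
  then show ?thesis by simp
qed

text \<open>
  A set \<open>K\<close> of finite \<open>1 / (n - 1)\<close>-variation inside an interval, with its running variation \<open>v\<close>.
\<close>

locale flat_image =
  fixes n :: nat and K :: "real set" and lo hi :: real
  assumes n: "n \<ge> 2" and K: "K \<subseteq> {lo..hi}"
    and fin: "frac_variation (1 / (real n - 1)) id K < \<infinity>"
begin

abbreviation "\<alpha> \<equiv> 1 / (real n - 1)"
abbreviation "\<gamma> \<equiv> 1 / real n"
abbreviation "v \<equiv> running_variation \<alpha> K lo"
abbreviation "V \<equiv> v hi"

lemma \<alpha>: "0 < \<alpha>" "\<alpha> \<le> 1" and \<gamma>: "0 < \<gamma>" "\<gamma> < 1"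
  using n by (auto simp: field_simps)

lemma v_increment: "s \<in> K \<Longrightarrow> t \<in> K \<Longrightarrow> s < t \<Longrightarrow> (t - s) powr \<alpha> \<le> v t - v s"
  using running_variation_increment[OF \<alpha> fin] K by auto

lemma v_strict: "s \<in> K \<Longrightarrow> t \<in> K \<Longrightarrow> s < t \<Longrightarrow> v s < v t"
  using v_increment[of s t] powr_gt_zero[of "t - s" \<alpha>] by linarith

lemma v_le_iff: "s \<in> K \<Longrightarrow> t \<in> K \<Longrightarrow> v s \<le> v t \<longleftrightarrow> s \<le> t"
  using v_strict[of s t] v_strict[of t s] by (cases s t rule: linorder_cases) auto

lemma v_range: "t \<in> K \<Longrightarrow> 0 \<le> v t \<and> v t \<le> V"
  using running_variation_nonneg[OF \<alpha> fin] running_variation_mono[OF \<alpha> fin] K by auto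

lemma V_nonneg: "0 \<le> V"
  by (rule running_variation_nonneg[OF \<alpha> fin])

lemma v_continuous: "continuous_on K v"
  using K by (intro continuous_on_running_variation[OF \<alpha> fin]) auto

text \<open>
  The exponent \<open>(n - 1) / n\<close> is \<open>1 - \<gamma>\<close>.
\<close>

lemma gen_variation_sum_eq:
  assumes "nonoverlapping N x y" "\<And>i. i < N \<Longrightarrow> x i \<in> K \<and> y i \<in> K"
  shows "gen_variation_sum n id K N x y = ennreal (\<Sum>i<N. (v (y i) - v (x i)) powr (1 - \<gamma>))"
proof -
  have e: "(real n - 1) / real n = 1 - \<gamma>" using n by (simp add: field_simps)
  have "ennreal_powr (frac_variation \<alpha> id (K \<inter> {x i..y i})) ((real n - 1) / real n) =
      ennreal ((v (y i) - v (x i)) powr (1 - \<gamma>))" if "i < N" for i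
  proof -
    have "frac_variation \<alpha> id (K \<inter> {x i..y i}) = ennreal (v (y i) - v (x i))"
    proof (rule frac_variation_interval[OF \<alpha> fin])
      show "x i \<in> K" "y i \<in> K" using assms(2)[OF that] by auto
      then show "lo \<le> x i" using K by auto
      show "x i \<le> y i" using assms(1) that by (auto simp: nonoverlapping_iff less_imp_le)
    qed
    moreover have "0 \<le> v (y i) - v (x i)"
      using v_le_iff assms that by (auto simp: nonoverlapping_iff less_imp_le)
    ultimately show ?thesis unfolding e by (simp only: ennreal_powr_ennreal)
  qed
  then show ?thesis unfolding gen_variation_sum_def by (subst sum_ennreal[symmetric]) auto
qed

lemma GV_image_bound:
  assumes "A \<subseteq> K" "GV n id A K < \<infinity>"
  shows "\<exists>M. \<forall>N c d. nonoverlapping N c d \<longrightarrow> (\<forall>i<N. c i \<in> v ` A \<and> d i \<in> v ` A) \<longrightarrow>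
        (\<Sum>i<N. (d i - c i) powr (1 - \<gamma>)) \<le> M"
proof (intro exI[of _ "enn2real (GV n id A K)"] allI impI)
  fix N c d
  assume cd: "nonoverlapping N c d" "\<forall>i<N. c i \<in> v ` A \<and> d i \<in> v ` A"
  define x y where "x i = inv_into A v (c i)" and "y i = inv_into A v (d i)" for i
  have xy: "x i \<in> A" "y i \<in> A" "v (x i) = c i" "v (y i) = d i" if "i < N" for i
    using cd(2) that by (auto simp: x_def y_def f_inv_into_f inv_into_into)
  have le: "v s \<le> v t \<longleftrightarrow> s \<le> t" if "s \<in> A" "t \<in> A" for s t
    using that assms(1) by (intro v_le_iff) auto
  have no: "nonoverlapping N x y"
    using cd(1) unfolding nonoverlapping_iff not_le[symmetric]
    by (auto simp: xy simp flip: le)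
  have xyK: "x i \<in> K \<and> y i \<in> K" if "i < N" for i using xy[OF that] assms(1) by auto
  have "ennreal (\<Sum>i<N. (v (y i) - v (x i)) powr (1 - \<gamma>)) \<le> GV n id A K"
    using GV_upper[OF no, of A n id K] xy by (subst gen_variation_sum_eq[OF no xyK, symmetric]) auto
  also have "(\<Sum>i<N. (v (y i) - v (x i)) powr (1 - \<gamma>)) = (\<Sum>i<N. (d i - c i) powr (1 - \<gamma>))"
    by (intro sum.cong) (auto simp: xy)
  finally show "(\<Sum>i<N. (d i - c i) powr (1 - \<gamma>)) \<le> enn2real (GV n id A K)"
    by (metis assms(2) ennreal_enn2real ennreal_le_iff enn2real_nonneg infinity_ennreal_def)
qed

lemma time_change_v:
  fixes A :: "nat \<Rightarrow> real set"
  assumes "\<And>m. A m \<subseteq> K" "\<And>m. GV n id (A m) K < \<infinity>"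
  obtains G :: "real \<Rightarrow> real" and \<delta> :: "nat \<Rightarrow> real"
    where "continuous_on UNIV G" "\<And>k. 0 < \<delta> k"
      "\<And>t t'. 0 \<le> t \<Longrightarrow> t \<le> t' \<Longrightarrow> t' \<le> V \<Longrightarrow> t' - t \<le> G t' - G t"
      "\<And>k m x0 t t' r. m \<le> k \<Longrightarrow> x0 \<in> A m \<Longrightarrow> 0 \<le> t \<Longrightarrow> t \<le> t' \<Longrightarrow> t' \<le> V \<Longrightarrow>
         \<bar>t - v x0\<bar> \<le> r \<Longrightarrow> \<bar>t' - v x0\<bar> \<le> r \<Longrightarrow> r \<le> \<delta> k \<Longrightarrow>
         2 ^ k * (t' - t) * r powr (-\<gamma>) \<le> G t' - G t"
proof (rule time_change[OF \<gamma> V_nonneg, where B = "\<lambda>m. v ` A m"])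
  show "v ` A m \<subseteq> {0..V}" for m using v_range assms(1) by force
  show "\<exists>M. \<forall>N c d. nonoverlapping N c d \<longrightarrow> (\<forall>i<N. c i \<in> v ` A m \<and> d i \<in> v ` A m) \<longrightarrow>
        (\<Sum>i<N. (d i - c i) powr (1 - \<gamma>)) \<le> M" for m
    by (rule GV_image_bound[OF assms])
  fix G :: "real \<Rightarrow> real" and \<delta> :: "nat \<Rightarrow> real"
  assume *: "continuous_on UNIV G" "\<And>k. 0 < \<delta> k"
      "\<And>t t'. 0 \<le> t \<Longrightarrow> t \<le> t' \<Longrightarrow> t' \<le> V \<Longrightarrow> t' - t \<le> G t' - G t"
      "\<And>k m t0 t t' r. m \<le> k \<Longrightarrow> t0 \<in> v ` A m \<Longrightarrow> 0 \<le> t \<Longrightarrow> t \<le> t' \<Longrightarrow> t' \<le> V \<Longrightarrow>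
         \<bar>t - t0\<bar> \<le> r \<Longrightarrow> \<bar>t' - t0\<bar> \<le> r \<Longrightarrow> r \<le> \<delta> k \<Longrightarrow>
         2 ^ k * (t' - t) * r powr (-\<gamma>) \<le> G t' - G t"
  show thesis
    by (rule that[OF *(1,2,3)]) (auto intro: *(4))
qed

text \<open>
  The limit is zero because the time change gains the factor \<open>2 ^ k\<close> near the sets of index at most
  \<open>k\<close>.
\<close>

lemma GV_bar_tendsto_zero:
  fixes A :: "nat \<Rightarrow> real set"
  assumes "closed K" and A: "\<And>m. A m \<subseteq> K" "\<And>m. GV n id (A m) K < \<infinity>"
  shows "\<exists>\<delta>. (\<forall>k. 0 < \<delta> k) \<and> (\<lambda>k. GV_bar n (\<delta> k) id (\<Union>m\<le>k. A m) K) \<longlonglongrightarrow> 0"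
proof -
  obtain G \<delta> where "continuous_on UNIV G" and G: "\<And>k. 0 < \<delta> k"
      "\<And>t t'. 0 \<le> t \<Longrightarrow> t \<le> t' \<Longrightarrow> t' \<le> V \<Longrightarrow> t' - t \<le> G t' - G t"
      "\<And>k m x0 t t' r. m \<le> k \<Longrightarrow> x0 \<in> A m \<Longrightarrow> 0 \<le> t \<Longrightarrow> t \<le> t' \<Longrightarrow> t' \<le> V \<Longrightarrow>
         \<bar>t - v x0\<bar> \<le> r \<Longrightarrow> \<bar>t' - v x0\<bar> \<le> r \<Longrightarrow> r \<le> \<delta> k \<Longrightarrow>
         2 ^ k * (t' - t) * r powr (-\<gamma>) \<le> G t' - G t"
    by (rule time_change_v[of A, OF A]) (rule that)
  have "compact K"
    using assms(1) bounded_subset[OF bounded_closed_interval K] by (simp add: compact_eq_bounded_closed)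
  then have "uniformly_continuous_on K v"
    using v_continuous compact_uniformly_continuous by blast
  then have "\<exists>d>0. \<forall>x\<in>K. \<forall>y\<in>K. dist y x < d \<longrightarrow> dist (v y) (v x) < \<delta> k" for k
    using G(1)[of k] unfolding uniformly_continuous_on_def by blast
  then obtain d where d: "\<And>k. 0 < d k"
    "\<And>k x y. x \<in> K \<Longrightarrow> y \<in> K \<Longrightarrow> dist y x < d k \<Longrightarrow> dist (v y) (v x) < \<delta> k" by metis
  have mono: "mono_on K (\<lambda>x. G (v x))"
  proof (rule mono_onI)
    fix s t assume "s \<in> K" "t \<in> K" "s \<le> t"
    then show "G (v s) \<le> G (v t)"
      using G(2)[of "v s" "v t"] v_range[of s] v_range[of t] v_le_iff[of s t] by auto
  qed
  have G0V: "G 0 \<le> G t \<and> G t \<le> G V" if "0 \<le> t" "t \<le> V" for t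
    using G(2)[of 0 t] G(2)[of t V] that by auto
  have bound: "GV_bar n (d k / 2) id (\<Union>m\<le>k. A m) K \<le> ennreal ((G V - G 0) * (1/2) ^ k)" for k
  proof (rule GV_bar_least)
    fix N x y
    assume xy: "nonoverlapping N x y" "\<And>i. i < N \<Longrightarrow> y i - x i \<le> d k / 2 \<and> x i \<in> K \<and> y i \<in> K \<and>
      {x i, y i} \<inter> (\<Union>m\<le>k. A m) \<noteq> {}"
    have "(v (y i) - v (x i)) powr (1 - \<gamma>) \<le> (1/2) ^ k * (G (v (y i)) - G (v (x i)))" if i: "i < N" for i
    proof -
      have xyi: "x i < y i" "x i \<in> K" "y i \<in> K" using xy i by (auto simp: nonoverlapping_iff)
      define r where "r = v (y i) - v (x i)"
      have r: "0 < r" using v_strict xyi by (simp add: r_def)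
      \<comment> \<open>the endpoint in the union serves as the pole, and \<open>r\<close> is the distance to the other endpoint\<close>
      have "dist (y i) (x i) < d k" using xy(2)[OF i] xyi d(1)[of k] by (simp add: dist_real_def)
      then have "r \<le> \<delta> k" using d(2)[of "x i" "y i" k] xyi by (auto simp: r_def dist_real_def)
      moreover obtain m x0 where "m \<le> k" "x0 \<in> A m" "x0 = x i \<or> x0 = y i"
        using xy(2)[OF i] by blast
      ultimately have "2 ^ k * (v (y i) - v (x i)) * r powr (-\<gamma>) \<le> G (v (y i)) - G (v (x i))"
        using v_range[OF xyi(2)] v_range[OF xyi(3)] r
        by (intro G(3)[of m k x0]) (auto simp: r_def)
      moreover have "r * r powr (-\<gamma>) = r powr (1 - \<gamma>)"
        using r powr_add[of r 1 "-\<gamma>"] by simp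
      moreover have "2 ^ k * r * r powr (-\<gamma>) = 2 ^ k * (r * r powr (-\<gamma>))" by simp
      ultimately have "2 ^ k * r powr (1 - \<gamma>) \<le> G (v (y i)) - G (v (x i))"
        unfolding r_def[symmetric] by simp
      then show ?thesis unfolding r_def[symmetric] by (simp add: field_simps)
    qed
    then have "(\<Sum>i<N. (v (y i) - v (x i)) powr (1 - \<gamma>))
        \<le> (\<Sum>i<N. (1/2) ^ k * (G (v (y i)) - G (v (x i))))"
      by (intro sum_mono) auto
    also have "\<dots> = (1/2) ^ k * (\<Sum>i<N. G (v (y i)) - G (v (x i)))"
      by (simp add: sum_distrib_left)
    also have "\<dots> \<le> (1/2) ^ k * (G V - G 0)"
      using xy(2) v_range G0V V_nonneg
      by (intro mult_left_mono sum_increments_le[OF xy(1) mono]) auto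
    finally have "(\<Sum>i<N. (v (y i) - v (x i)) powr (1 - \<gamma>)) \<le> (G V - G 0) * (1/2) ^ k"
      by (simp only: mult.commute)
    moreover have "gen_variation_sum n id K N x y = ennreal (\<Sum>i<N. (v (y i) - v (x i)) powr (1 - \<gamma>))"
      by (rule gen_variation_sum_eq[OF xy(1)]) (use xy(2) in blast)
    ultimately show "gen_variation_sum n id K N x y \<le> ennreal ((G V - G 0) * (1/2) ^ k)"
      by (simp only: ennreal_leI)
  qed
  have "(\<lambda>k. ennreal ((G V - G 0) * (1/2) ^ k)) \<longlonglongrightarrow> ennreal ((G V - G 0) * 0)"
    by (intro tendsto_ennrealI tendsto_mult tendsto_const LIMSEQ_power_zero) auto
  then have "(\<lambda>k. ennreal ((G V - G 0) * (1/2) ^ k)) \<longlonglongrightarrow> 0" by simp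
  then have "(\<lambda>k. GV_bar n (d k / 2) id (\<Union>m\<le>k. A m) K) \<longlonglongrightarrow> 0"
    by (rule tendsto_sandwich[OF _ _ tendsto_const, rotated 2]) (auto simp: bound)
  then show ?thesis using d(1) by (intro exI[of _ "\<lambda>k. d k / 2"]) auto
qed

end

lemma nonoverlapping_sum_subset:
  fixes F :: "nat \<Rightarrow> ennreal"
  assumes "nonoverlapping N x y" "S \<subseteq> {..<N}"
  obtains h N' where "nonoverlapping N' (x \<circ> h) (y \<circ> h)" "\<And>j. j < N' \<Longrightarrow> h j \<in> S"
    "(\<Sum>j<N'. F (h j)) = (\<Sum>i\<in>S. F i)"
proof -
  have "finite S" using assms(2) finite_subset by blast
  then obtain h where h: "bij_betw h {0..<card S} S"
    using ex_bij_betw_nat_finite by blast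
  then have h': "bij_betw h {..<card S} S" by (simp add: atLeast0LessThan)
  have hS: "h j \<in> S" if "j < card S" for j using h' that by (auto simp: bij_betw_def)
  have "h i \<noteq> h j" if "i < card S" "j < card S" "i \<noteq> j" for i j
    using h' that by (auto simp: bij_betw_def inj_on_def)
  then have "nonoverlapping (card S) (x \<circ> h) (y \<circ> h)"
    using assms hS unfolding nonoverlapping_iff by (auto simp: subset_iff)
  then show ?thesis using that[of "card S" h] hS sum.reindex_bij_betw[OF h'] by blast
qed

text \<open>
  Intervals of length at most \<open>\<delta>\<close> are controlled by \<open>GV_bar\<close>; at most \<open>(hi - lo) / \<delta>\<close> intervals are
  longer, and each of them contributes at most the value for the whole of \<open>K\<close>.
\<close>

lemma GV_finite_if_GV_bar_finite:
  fixes K :: "real set"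
  assumes n: "n \<ge> 2" and K: "K \<subseteq> {lo..hi}" "lo \<le> hi" and A: "A \<subseteq> K" and "0 < \<delta>"
    and fin: "frac_variation (1 / (real n - 1)) id K < \<infinity>" "GV_bar n \<delta> id A K < \<infinity>"
  shows "GV n id A K < \<infinity>"
proof -
  define F where "F L = ennreal_powr (frac_variation (1 / (real n - 1)) id L) ((real n - 1) / real n)" for L
  have F_mono: "F L \<le> F K" if "L \<subseteq> K" for L
    using that n unfolding F_def by (intro ennreal_powr_mono frac_variation_mono) auto
  have F_fin: "F K < \<infinity>" using fin(1) by (simp add: F_def ennreal_powr_def)
  define Q where "Q = nat \<lceil>(hi - lo) / \<delta>\<rceil>"
  have "GV n id A K \<le> GV_bar n \<delta> id A K + of_nat Q * F K"
  proof (rule GV_least)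
    fix N x y
    assume xy: "nonoverlapping N x y" "\<And>i. i < N \<Longrightarrow> x i \<in> A \<and> y i \<in> A"
    define S where "S = {i\<in>{..<N}. y i - x i \<le> \<delta>}"
    have SN: "S \<subseteq> {..<N}" by (auto simp: S_def)
    obtain h N' where h: "nonoverlapping N' (x \<circ> h) (y \<circ> h)" "\<And>j. j < N' \<Longrightarrow> h j \<in> S"
      "(\<Sum>j<N'. F (K \<inter> {x (h j)..y (h j)})) = (\<Sum>i\<in>S. F (K \<inter> {x i..y i}))"
      by (rule nonoverlapping_sum_subset[OF xy(1) SN, where F = "\<lambda>i. F (K \<inter> {x i..y i})"]) (rule that)
    have "(\<Sum>i\<in>S. F (K \<inter> {x i..y i})) = gen_variation_sum n id K N' (x \<circ> h) (y \<circ> h)"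
      unfolding h(3)[symmetric] by (simp add: gen_variation_sum_def F_def)
    also have "\<dots> \<le> GV_bar n \<delta> id A K"
      using h(2) xy(2) A by (intro GV_bar_upper h(1)) (auto simp: S_def subset_iff)
    finally have short: "(\<Sum>i\<in>S. F (K \<inter> {x i..y i})) \<le> GV_bar n \<delta> id A K" .
    have "real (card ({..<N} - S)) * \<delta> = (\<Sum>i\<in>{..<N} - S. \<delta>)" by simp
    also have "\<dots> \<le> (\<Sum>i\<in>{..<N} - S. y i - x i)" by (intro sum_mono) (auto simp: S_def)
    also have "\<dots> \<le> (\<Sum>i<N. y i - x i)"
      using xy(1) by (intro sum_mono2) (auto simp: nonoverlapping_iff less_imp_le)
    also have "\<dots> \<le> hi - lo"
      using xy A K sum_increments_le[OF xy(1), of K "\<lambda>x. x" lo hi] by (auto simp: mono_on_def subset_iff)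
    finally have "real (card ({..<N} - S)) \<le> (hi - lo) / \<delta>" using \<open>0 < \<delta>\<close> by (simp add: field_simps)
    then have cQ: "card ({..<N} - S) \<le> Q" unfolding Q_def by linarith
    have "(\<Sum>i\<in>{..<N} - S. F (K \<inter> {x i..y i})) \<le> (\<Sum>i\<in>{..<N} - S. F K)"
      by (intro sum_mono F_mono) auto
    also have "\<dots> = of_nat (card ({..<N} - S)) * F K" by simp
    also have "\<dots> \<le> of_nat Q * F K" using cQ by (intro mult_right_mono) (auto simp: of_nat_mono)
    finally have long: "(\<Sum>i\<in>{..<N} - S. F (K \<inter> {x i..y i})) \<le> of_nat Q * F K" .
    have "gen_variation_sum n id K N x y = (\<Sum>i<N. F (K \<inter> {x i..y i}))"
      by (simp add: gen_variation_sum_def F_def)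
    also have "\<dots> = (\<Sum>i\<in>{..<N} - S. F (K \<inter> {x i..y i})) + (\<Sum>i\<in>S. F (K \<inter> {x i..y i}))"
      by (intro sum.subset_diff) (auto simp: S_def)
    finally show "gen_variation_sum n id K N x y \<le> GV_bar n \<delta> id A K + of_nat Q * F K"
      using add_mono[OF long short] by (simp add: add.commute)
  qed
  also have "\<dots> < \<infinity>"
    using fin(2) F_fin ennreal_mult_less_top[of "of_nat Q" "F K"] by (simp add: of_nat_less_top)
  finally show ?thesis .
qed

text \<open>
  \<open>K\<close> is a countable union of closed sets along which the generalized variation is finite.
\<close>

definition GV_cover :: "nat \<Rightarrow> real \<Rightarrow> real \<Rightarrow> real set \<Rightarrow> bool" where
  "GV_cover n a b K \<longleftrightarrow> (\<exists>(M :: nat set) (A :: nat \<Rightarrow> real set).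
          (\<forall>m\<in>M. closed (A m) \<and> A m \<subseteq> {a..b}) \<and> K = (\<Union>m\<in>M. A m) \<and>
          (\<forall>m\<in>M. GV n id (A m) K < \<infinity>))"

lemma GV_cover_iff_GV_bar:
  fixes a b :: real and K :: "real set" and n :: nat
  assumes "a < b" and "closed K" and "K \<subseteq> {a..b}" and "n \<ge> 2"
    and fin: "frac_variation (1 / (real n - 1)) id K < \<infinity>"
  shows "GV_cover n a b K \<longleftrightarrow> (\<exists>(A :: nat \<Rightarrow> real set) (\<delta> :: nat \<Rightarrow> real).
          (\<forall>m. closed (A m) \<and> A m \<subseteq> {a..b} \<and> \<delta> m > 0) \<and> K = (\<Union>m. A m) \<and>
          (\<forall>m. A m \<subseteq> A (Suc m)) \<and>
          (\<lambda>m. GV_bar n (\<delta> m) id (A m) K) \<longlonglongrightarrow> 0)" (is "_ \<longleftrightarrow> ?R")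
proof
  assume "GV_cover n a b K"
  then obtain M :: "nat set" and A where MA: "\<forall>m\<in>M. closed (A m) \<and> A m \<subseteq> {a..b}"
    "K = (\<Union>m\<in>M. A m)" "\<forall>m\<in>M. GV n id (A m) K < \<infinity>"
    unfolding GV_cover_def by blast
  define A' where "A' m = (if m \<in> M then A m else {})" for m
  interpret flat_image n K a b
    by (rule flat_image.intro[OF assms(4,3) fin])
  have A': "A' m \<subseteq> K \<and> GV n id (A' m) K < \<infinity> \<and> closed (A' m)" for m
  proof (cases "m \<in> M")
    case True
    moreover have "A m \<subseteq> K" using True MA(2) by blast
    ultimately show ?thesis using MA(1,3) by (simp only: A'_def if_True)
  next
    case False
    then show ?thesis by (simp add: A'_def GV_empty)
  qed
  then have A'K: "\<And>m. A' m \<subseteq> K" and A'GV: "\<And>m. GV n id (A' m) K < \<infinity>"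
    and A'cl: "\<And>m. closed (A' m)" by blast+
  obtain \<delta> where \<delta>: "\<forall>k. 0 < \<delta> k" "(\<lambda>k. GV_bar n (\<delta> k) id (\<Union>m\<le>k. A' m) K) \<longlonglongrightarrow> 0"
    using GV_bar_tendsto_zero[of A', OF assms(2) A'K A'GV] by blast
  \<comment> \<open>finite unions make the sequence increasing and keep it closed\<close>
  define C where "C k = (\<Union>m\<le>k. A' m)" for k
  have "K = (\<Union>k. C k)"
  proof
    show "K \<subseteq> (\<Union>k. C k)"
    proof
      fix z assume "z \<in> K"
      then obtain m where "m \<in> M" "z \<in> A m" using MA(2) by blast
      then have "z \<in> C m" by (auto simp: C_def A'_def)
      then show "z \<in> (\<Union>k. C k)" by blast
    qed
    show "(\<Union>k. C k) \<subseteq> K" using A'K by (auto simp only: C_def UN_subset_iff UN_iff)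
  qed
  moreover have "\<forall>k. closed (C k) \<and> C k \<subseteq> {a..b} \<and> 0 < \<delta> k"
  proof
    fix k
    have "closed (C k)" unfolding C_def by (intro closed_UN ballI A'cl) simp
    moreover have "C k \<subseteq> K" using A'K unfolding C_def by blast
    ultimately show "closed (C k) \<and> C k \<subseteq> {a..b} \<and> 0 < \<delta> k" using assms(3) \<delta>(1) by blast
  qed
  moreover have "\<forall>k. C k \<subseteq> C (Suc k)" unfolding C_def by (intro allI UN_mono) auto
  moreover have "(\<lambda>k. GV_bar n (\<delta> k) id (C k) K) \<longlonglongrightarrow> 0" using \<delta>(2) by (simp only: C_def)
  ultimately show ?R by (intro exI[of _ C] exI[of _ \<delta>] conjI)
next
  assume ?R
  then obtain A \<delta> where A': "\<forall>m. closed (A m) \<and> A m \<subseteq> {a..b} \<and> \<delta> m > 0" "K = (\<Union>m. A m)"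
    "\<forall>m. A m \<subseteq> A (Suc m)" "(\<lambda>m. GV_bar n (\<delta> m) id (A m) K) \<longlonglongrightarrow> 0"
    by (elim exE conjE) (rule that)
  have A: "closed (A m)" "A m \<subseteq> {a..b}" "\<delta> m > 0" "A m \<subseteq> A (Suc m)" for m
    using A'(1,3) by auto
  have "\<forall>\<^sub>F m in sequentially. GV_bar n (\<delta> m) id (A m) K < 1"
    by (rule order_tendstoD(2)[OF A'(4)]) simp
  then obtain m0 where m0: "\<And>m. m \<ge> m0 \<Longrightarrow> GV_bar n (\<delta> m) id (A m) K < 1"
    unfolding eventually_sequentially by blast
  have inc: "A i \<subseteq> A j" if "i \<le> j" for i j by (rule lift_Suc_mono_le[of A, OF A(4) that])
  have K_eq: "K = (\<Union>m\<in>{m0..}. A m)"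
  proof
    show "K \<subseteq> (\<Union>m\<in>{m0..}. A m)"
    proof
      fix z assume "z \<in> K"
      then obtain m where "z \<in> A m" using A'(2) by blast
      then have "z \<in> A (max m0 m)" using inc[of m "max m0 m"] by auto
      then show "z \<in> (\<Union>m\<in>{m0..}. A m)" by (auto intro!: UN_I[of "max m0 m"])
    qed
    show "(\<Union>m\<in>{m0..}. A m) \<subseteq> K" unfolding A'(2) by (rule UN_mono) auto
  qed
  have "GV n id (A m) K < \<infinity>" if "m \<in> {m0..}" for m
  proof (rule GV_finite_if_GV_bar_finite[OF assms(4,3) _ _ A(3)[of m] fin])
    show "a \<le> b" using assms(1) by simp
    show "A m \<subseteq> K" unfolding A'(2) by (rule UN_upper) simp
    show "GV_bar n (\<delta> m) id (A m) K < \<infinity>" 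
      by (rule less_trans[OF m0 ennreal_one_less_top[folded infinity_ennreal_def]]) (use that in simp)
  qed
  then have "\<forall>m\<in>{m0..}. GV n id (A m) K < \<infinity>" by (rule ballI)
  moreover have "\<forall>m\<in>{m0..}. closed (A m) \<and> A m \<subseteq> {a..b}" using A(1,2) by blast
  ultimately have "(\<forall>m\<in>{m0..}. closed (A m) \<and> A m \<subseteq> {a..b}) \<and> K = (\<Union>m\<in>{m0..}. A m) \<and>
    (\<forall>m\<in>{m0..}. GV n id (A m) K < \<infinity>)" by (intro conjI K_eq)
  then show "GV_cover n a b K" unfolding GV_cover_def by (intro exI)
qed

section \<open>From a flat homeomorphism to finite variation\<close>

lemma nderiv_within_0 [simp]: "nderiv_within S 0 f = f"
  by (simp add: nderiv_within_def)

lemma nderiv_within_Suc: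
  "nderiv_within S (Suc i) f x = vector_derivative (nderiv_within S i f) (at x within S)"
  by (simp add: nderiv_within_def)

lemma nderiv_within_has_derivative:
  assumes "n_times_differentiable_on n f S" "i < n" "x \<in> S"
  shows "(nderiv_within S i f has_real_derivative nderiv_within S (Suc i) f x) (at x within S)"
proof -
  have "nderiv_within S i f differentiable (at x within S)"
    using assms by (auto simp: n_times_differentiable_on_def differentiable_on_def)
  then show ?thesis
    unfolding nderiv_within_Suc has_real_derivative_iff_has_vector_derivative
    by (simp add: vector_derivative_works)
qed

lemma nderiv_within_eq:
  fixes H :: "nat \<Rightarrow> real \<Rightarrow> real"
  assumes "a < b" and H: "\<And>i x. i < n \<Longrightarrow> x \<in> {a..b} \<Longrightarrow>
      (H i has_real_derivative H (Suc i) x) (at x within {a..b})"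
  shows "i \<le> n \<Longrightarrow> x \<in> {a..b} \<Longrightarrow> nderiv_within {a..b} i (H 0) x = H i x"
proof (induction i arbitrary: x)
  case (Suc i)
  have i: "i < n" using Suc.prems by simp
  have "(H i has_vector_derivative H (Suc i) x) (at x within {a..b})"
    using H[OF i Suc.prems(2)] by (simp only: has_real_derivative_iff_has_vector_derivative)
  then have "(nderiv_within {a..b} i (H 0) has_vector_derivative H (Suc i) x) (at x within {a..b})"
    by (rule has_vector_derivative_transform[OF Suc.prems(2), rotated])
       (use Suc.IH i in simp)
  then show ?case
    unfolding nderiv_within_Suc
    using vector_derivative_within_cbox[of a b x "nderiv_within {a..b} i (H 0)" "H (Suc i) x"] assms(1) Suc.prems(2)
    by simp
qed simp

lemma n_times_differentiable_onI:
  fixes H :: "nat \<Rightarrow> real \<Rightarrow> real"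
  assumes "a < b" and H: "\<And>i x. i < n \<Longrightarrow> x \<in> {a..b} \<Longrightarrow>
      (H i has_real_derivative H (Suc i) x) (at x within {a..b})"
  shows "n_times_differentiable_on n (H 0) {a..b}"
  unfolding n_times_differentiable_on_def
proof (intro allI impI)
  fix i assume i: "i < n"
  show "nderiv_within {a..b} i (H 0) differentiable_on {a..b}"
    unfolding differentiable_on_def
  proof
    fix x assume x: "x \<in> {a..b}"
    have "H i differentiable (at x within {a..b})"
      using H[OF i x] unfolding real_differentiable_def by blast
    then show "nderiv_within {a..b} i (H 0) differentiable (at x within {a..b})"
    proof (rule differentiable_transform_within[OF _ zero_less_one x])
      fix z assume "z \<in> {a..b}"
      then show "H i z = nderiv_within {a..b} i (H 0) z"
        using nderiv_within_eq[of a b n H, OF assms, of i z] i by simp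
    qed
  qed
qed

text \<open>
  Repeated use of the mean value inequality; \<open>H i\<close> plays the role of the derivative of order \<open>i\<close>.
\<close>

lemma flat_taylor:
  fixes H :: "nat \<Rightarrow> real \<Rightarrow> real"
  assumes "convex S" and H: "\<And>i x. i < k \<Longrightarrow> x \<in> S \<Longrightarrow> (H i has_real_derivative H (Suc i) x) (at x within S)"
    and s: "s \<in> S" "\<And>i. 1 \<le> i \<Longrightarrow> i \<le> k \<Longrightarrow> H i s = 0" and k: "1 \<le> k"
    and M: "\<And>x. x \<in> S \<Longrightarrow> \<bar>H k x\<bar> \<le> M" and "0 \<le> M" and "t \<in> S"
  shows "\<bar>H 0 t - H 0 s\<bar> \<le> M * \<bar>t - s\<bar> ^ k"
proof -
  have "\<forall>t\<in>S. \<bar>H (k - j) t - H (k - j) s\<bar> \<le> M * \<bar>t - s\<bar> ^ j" if "j \<le> k" for j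
    using that
  proof (induction j)
    case 0
    then show ?case using s(2)[of k] k M by simp
  next
    case (Suc j)
    show ?case
    proof
      fix t assume t: "t \<in> S"
      let ?i = "k - Suc j" and ?C = "closed_segment s t"
      have i: "?i < k" "Suc ?i = k - j" "1 \<le> k - j" "k - j \<le> k" using Suc.prems by auto
      have C: "?C \<subseteq> S" using assms(1) s(1) t by (rule closed_segment_subset[rotated 2])
      have "norm (H ?i t - H ?i s) \<le> (M * \<bar>t - s\<bar> ^ j) * norm (t - s)"
      proof (rule field_differentiable_bound[of ?C _ "H (k - j)"])
        show "(H ?i has_field_derivative H (k - j) z) (at z within ?C)" if "z \<in> ?C" for z
          using H[OF i(1), of z] that C i(2) by (auto intro: has_field_derivative_subset)
        show "norm (H (k - j) z) \<le> M * \<bar>t - s\<bar> ^ j" if "z \<in> ?C" for z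
        proof -
          have "\<bar>H (k - j) z - H (k - j) s\<bar> \<le> M * \<bar>z - s\<bar> ^ j"
            using Suc C that by auto
          also have "\<dots> \<le> M * \<bar>t - s\<bar> ^ j"
            using that \<open>0 \<le> M\<close> by (intro mult_left_mono power_mono) (auto simp: closed_segment_eq_real_ivl split: if_splits)
          finally show ?thesis using s(2)[OF i(3,4)] by simp
        qed
      qed auto
      then show "\<bar>H ?i t - H ?i s\<bar> \<le> M * \<bar>t - s\<bar> ^ Suc j" by (simp add: mult_ac)
    qed
  qed
  from this[of k] show ?thesis using \<open>t \<in> S\<close> by simp
qed

lemma homeomorphism_real_interval_monotone:
  fixes g :: "real \<Rightarrow> real"
  assumes "homeomorphism {a..b} {a..b} h g"
  obtains \<sigma> where "\<sigma> = 1 \<or> \<sigma> = - 1" "\<And>s t. s \<in> {a..b} \<Longrightarrow> t \<in> {a..b} \<Longrightarrow> s < t \<Longrightarrow> \<sigma> * g s < \<sigma> * g t"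
proof -
  have "continuous_on {a..b} g" "inj_on g {a..b}"
    using assms by (auto simp: homeomorphism_def intro: inj_on_inverseI[of _ h])
  then have "strict_mono_on {a..b} g \<or> strict_antimono_on {a..b} g"
    using injective_eq_monotone_map[of "{a..b}" g] is_interval_cc by blast
  then show ?thesis
  proof
    assume "strict_mono_on {a..b} g"
    then show ?thesis using that[of 1] by (auto simp: monotone_on_def)
  next
    assume "strict_antimono_on {a..b} g"
    then show ?thesis using that[of "-1"] by (auto simp: monotone_on_def)
  qed
qed

text \<open>
  A homeomorphism \<open>h\<close> of \<open>[a, b]\<close> whose set of flat points is mapped onto \<open>K\<close>, with inverse \<open>g\<close>. The sign
  \<open>\<sigma>\<close> makes \<open>\<sigma> * g\<close> increasing, whether or not \<open>h\<close> preserves the orientation.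
\<close>

locale flat_homeo =
  fixes a b :: real and K :: "real set" and n :: nat and h g :: "real \<Rightarrow> real" and \<sigma> :: real
  assumes ab: "a < b" and clK: "closed K" and Kab: "K \<subseteq> {a..b}" and n: "n \<ge> 2"
    and hom: "homeomorphism {a..b} {a..b} h g" and diff: "n_times_differentiable_on n h {a..b}"
    and K_eq: "K = h ` {x \<in> {a..b}. \<forall>i\<in>{1..n}. nderiv_within {a..b} i h x = 0}"
    and \<sigma>: "\<sigma> = 1 \<or> \<sigma> = - 1" and \<sigma>g: "\<And>s t. s \<in> {a..b} \<Longrightarrow> t \<in> {a..b} \<Longrightarrow> s < t \<Longrightarrow> \<sigma> * g s < \<sigma> * g t"
begin

text \<open>
  \<open>D i\<close> is the derivative of order \<open>i\<close>, \<open>k = n - 1\<close> is the highest order for which it must be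
  continuous, \<open>Z\<close> is the
  set of flat points and \<open>W\<close> the increasing version of the inverse.
\<close>

definition "D i = nderiv_within {a..b} i h"
definition "k = n - 1"
definition "Z = {x \<in> {a..b}. \<forall>i\<in>{1..n}. D i x = 0}"
definition "W x = \<sigma> * g x"

lemma D: "i < n \<Longrightarrow> x \<in> {a..b} \<Longrightarrow> (D i has_real_derivative D (Suc i) x) (at x within {a..b})"
  unfolding D_def by (rule nderiv_within_has_derivative[OF diff])

lemma k: "1 \<le> k" "k < n" "Suc k = n" "real n - 1 = real k"
  using n by (auto simp: k_def)

lemma g: "x \<in> {a..b} \<Longrightarrow> g x \<in> {a..b}" "x \<in> {a..b} \<Longrightarrow> h (g x) = x" "x \<in> {a..b} \<Longrightarrow> g (h x) = x"
    "x \<in> {a..b} \<Longrightarrow> h x \<in> {a..b}" "continuous_on {a..b} g" "continuous_on {a..b} h"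
  using hom unfolding homeomorphism_def by auto

lemma K_Z: "K = h ` Z" "Z = g ` K"
proof -
  show 1: "K = h ` Z" using K_eq by (simp add: Z_def D_def)
  show "Z = g ` K"
    unfolding 1 image_image by (auto simp: Z_def g(3) image_iff)
qed

lemma W_mono: "s \<in> {a..b} \<Longrightarrow> t \<in> {a..b} \<Longrightarrow> s \<le> t \<Longrightarrow> W s \<le> W t"
  using \<sigma>g[of s t] by (cases "s = t") (auto simp: W_def)

lemma abs_g: "s \<in> {a..b} \<Longrightarrow> t \<in> {a..b} \<Longrightarrow> s \<le> t \<Longrightarrow> \<bar>g t - g s\<bar> = W t - W s"
  using W_mono[of s t] \<sigma> by (auto simp: W_def)

text \<open>
  For \<open>s, t\<close> in \<open>K\<close> the preimages are flat points, so \<open>\<bar>t - s\<bar>\<close> is at most \<open>C\<close> times the \<open>k\<close>-th power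
  of the distance of the preimages.
\<close>

lemma frac_variation_bound:
  assumes xy: "a \<le> x" "x \<le> y" "y \<le> b" and C: "0 \<le> C" "\<And>z. z \<in> g ` {x..y} \<Longrightarrow> \<bar>D k z\<bar> \<le> C"
  shows "frac_variation (1 / real k) id (K \<inter> {x..y}) \<le> ennreal (C powr (1 / real k) * (W y - W x))"
proof -
  have sub: "{x..y} \<subseteq> {a..b}" using xy by auto
  let ?c = "C powr (1 / real k)"
  have "frac_variation (1 / real k) id (K \<inter> {x..y}) \<le> ennreal (?c * W y - ?c * W x)"
  proof (rule frac_variation_id_le[where W = "\<lambda>x. ?c * W x"])
    fix s t assume st: "s \<in> K \<inter> {x..y}" "t \<in> K \<inter> {x..y}" "s < t"
    then have st': "s \<in> {a..b}" "t \<in> {a..b}" using sub by auto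
    let ?S = "g ` {x..y}" and ?d = "\<bar>g t - g s\<bar>"
    have "\<bar>D 0 (g t) - D 0 (g s)\<bar> \<le> C * ?d ^ k"
    proof (rule flat_taylor[where S = ?S and H = D])
      show "convex ?S"
        using connected_continuous_image[OF continuous_on_subset[OF g(5) sub]]
        by (simp add: is_interval_connected_1[symmetric] is_interval_convex_1[symmetric])
      show "(D i has_real_derivative D (Suc i) z) (at z within ?S)" if "i < k" "z \<in> ?S" for i z
        by (rule has_field_derivative_subset[OF D]) (use that k sub g(1) in auto)
      show "g s \<in> ?S" "g t \<in> ?S" using st by auto
      have "g s \<in> Z" using st K_Z(2) by auto
      then show "D i (g s) = 0" if "1 \<le> i" "i \<le> k" for i using that k by (auto simp: Z_def)
    qed (use k C in auto)
    then have "t - s \<le> C * ?d ^ k" using g(2)[OF st'(1)] g(2)[OF st'(2)] st(3) by (simp add: D_def)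
    then have "(t - s) powr (1 / real k) \<le> (C * ?d ^ k) powr (1 / real k)"
      using st(3) by (intro powr_mono2) auto
    also have "\<dots> = ?c * (?d ^ k) powr (1 / real k)"
      using C by (intro powr_mult) 
    also have "(?d ^ k) powr (1 / real k) = ?d"
      using k by (cases "?d = 0") (simp_all add: powr_realpow[symmetric] powr_powr)
    finally show "(t - s) powr (1 / real k) \<le> ?c * W t - ?c * W s"
      using abs_g[OF st'] st(3) by (simp add: right_diff_distrib)
  next
    fix z assume "z \<in> K \<inter> {x..y}"
    then show "?c * W x \<le> ?c * W z \<and> ?c * W z \<le> ?c * W y"
      using xy by (intro conjI mult_left_mono W_mono) auto
  qed (use xy in \<open>intro mult_left_mono W_mono; auto\<close>)
  then show ?thesis by (simp add: right_diff_distrib)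
qed

lemma D_bounded: "\<exists>M>0. \<forall>z\<in>{a..b}. \<bar>D k z\<bar> \<le> M"
proof -
  have "continuous_on {a..b} (D k)"
    using D[of k] k by (intro DERIV_continuous_on) auto
  then have "bounded (D k ` {a..b})"
    by (intro compact_imp_bounded compact_continuous_image) auto
  then show ?thesis by (auto simp: bounded_pos)
qed

lemma frac_variation_finite: "frac_variation (1 / (real n - 1)) id K < \<infinity>"
proof -
  obtain M where M: "M > 0" "\<forall>z\<in>{a..b}. \<bar>D k z\<bar> \<le> M" using D_bounded by blast
  have "frac_variation (1 / real k) id (K \<inter> {a..b}) \<le> ennreal (M powr (1 / real k) * (W b - W a))"
    using ab M g(1) by (intro frac_variation_bound) auto
  also have "\<dots> < \<infinity>" by simp
  also have "K \<inter> {a..b} = K" using Kab by auto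
  finally show ?thesis unfolding k(4) .
qed

text \<open>
  The flat points at which the difference quotients of \<open>D k\<close> are bounded by \<open>m\<close> on all of \<open>[a, b]\<close>.
\<close>

definition "Zm m = {x \<in> Z. \<forall>y\<in>{a..b}. \<bar>D k y\<bar> \<le> real m * \<bar>y - x\<bar>}"

lemma Zm_cover: "Z = (\<Union>m. Zm m)"
proof
  show "Z \<subseteq> (\<Union>m. Zm m)"
  proof
    fix x assume x: "x \<in> Z"
    then have xab: "x \<in> {a..b}" and D0: "D k x = 0" "D (Suc k) x = 0" using k by (auto simp: Z_def)
    obtain M where M: "M > 0" "\<forall>z\<in>{a..b}. \<bar>D k z\<bar> \<le> M" using D_bounded by blast
    have "((\<lambda>y. (D k y - D k x) / (y - x)) \<longlongrightarrow> 0) (at x within {a..b})"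
      using D[OF k(2) xab] D0 by (simp add: has_field_derivative_iff)
    then obtain d where d: "d > 0" "\<forall>y\<in>{a..b}. y \<noteq> x \<and> dist y x < d \<longrightarrow> dist ((D k y - D k x) / (y - x)) 0 < 1"
      unfolding Lim_within zero_less_dist_iff using zero_less_one by blast
    obtain m :: nat where m: "max 1 (M / d) \<le> real m" using real_arch_simple by blast
    have "\<bar>D k y\<bar> \<le> real m * \<bar>y - x\<bar>" if y: "y \<in> {a..b}" for y
    proof (cases "y = x")
      case True then show ?thesis using D0 by simp
    next
      case False
      show ?thesis
      proof (cases "\<bar>y - x\<bar> < d")
        case True
        then have "\<bar>D k y / (y - x)\<bar> < 1" using d y False D0 by (auto simp: dist_real_def)
        then have "\<bar>D k y\<bar> \<le> 1 * \<bar>y - x\<bar>" using False by (simp add: abs_divide field_simps)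
        also have "\<dots> \<le> real m * \<bar>y - x\<bar>" using m by (intro mult_right_mono) auto
        finally show ?thesis .
      next
        case False
        have "\<bar>D k y\<bar> \<le> M / d * d" using M y d by simp
        also have "\<dots> \<le> real m * \<bar>y - x\<bar>" using m False d M by (intro mult_mono) auto
        finally show ?thesis .
      qed
    qed
    then have "x \<in> Zm m" using x by (auto simp: Zm_def)
    then show "x \<in> (\<Union>m. Zm m)" by blast
  qed
qed (auto simp: Zm_def)

lemma compact_Zm: "compact (Zm m)"
proof -
  have "compact K" using clK bounded_subset[OF bounded_closed_interval Kab] by (simp add: compact_eq_bounded_closed)
  then have "compact Z"
    unfolding K_Z(2) by (intro compact_continuous_image continuous_on_subset[OF g(5) Kab])
  moreover have "closed (\<Inter>y\<in>{a..b}. {x. \<bar>D k y\<bar> \<le> real m * \<bar>y - x\<bar>})"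
    by (intro closed_INT ballI closed_Collect_le continuous_intros)
  moreover have "Zm m = Z \<inter> (\<Inter>y\<in>{a..b}. {x. \<bar>D k y\<bar> \<le> real m * \<bar>y - x\<bar>})"
    by (auto simp: Zm_def)
  ultimately show ?thesis by (simp add: compact_Int_closed)
qed

text \<open>
  Between two points of \<open>Zm m\<close> at distance \<open>w\<close> the bound for \<open>D k\<close> is \<open>m * w\<close>, so the variation is at most
  \<open>(m * w) powr (1 / k) * w\<close>; its \<open>(k / n)\<close>-th power is linear in \<open>w\<close>.
\<close>

lemma GV_Zm: "GV n id (h ` Zm m) K < \<infinity>"
proof -
  define c where "c = real m powr (1 / real k * (real k / real n))"
  have "GV n id (h ` Zm m) K \<le> ennreal (c * (W b - W a))"
  proof (rule GV_least)
    fix N x y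
    assume no: "nonoverlapping N x y" and xy: "\<And>i. i < N \<Longrightarrow> x i \<in> h ` Zm m \<and> y i \<in> h ` Zm m"
    have hZ: "h ` Zm m \<subseteq> {a..b}" using g(4) by (auto simp: Zm_def Z_def)
    have "ennreal_powr (frac_variation (1 / real k) id (K \<inter> {x i..y i})) (real k / real n)
        \<le> ennreal (c * (W (y i) - W (x i)))" if i: "i < N" for i
    proof -
      have xi: "x i \<in> {a..b}" "y i \<in> {a..b}" "x i < y i" using xy[OF i] hZ no i by (auto simp: nonoverlapping_iff)
      have gx: "g (x i) \<in> Zm m" using xy[OF i] g(3) by (auto simp: Zm_def Z_def)
      define w where "w = W (y i) - W (x i)"
      have w: "0 < w" using \<sigma>g[OF xi] by (simp add: w_def W_def)
      have V: "frac_variation (1 / real k) id (K \<inter> {x i..y i}) \<le> ennreal ((real m * w) powr (1 / real k) * w)"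
        unfolding w_def
      proof (rule frac_variation_bound)
        fix z assume "z \<in> g ` {x i..y i}"
        then obtain s where s: "z = g s" "x i \<le> s" "s \<le> y i" by auto
        then have s': "s \<in> {a..b}" using xi by auto
        have "\<bar>D k z\<bar> \<le> real m * \<bar>z - g (x i)\<bar>" using gx g(1)[OF s'] s by (auto simp: Zm_def)
        also have "\<bar>z - g (x i)\<bar> = W s - W (x i)" using abs_g[OF xi(1) s'] s by simp
        also have "real m * \<dots> \<le> real m * (W (y i) - W (x i))"
          using W_mono[OF s' xi(2)] s by (intro mult_left_mono) auto
        finally show "\<bar>D k z\<bar> \<le> real m * (W (y i) - W (x i))" .
      next
        show "0 \<le> real m * (W (y i) - W (x i))" using w by (simp add: w_def)
      qed (use xi in auto)
      have cw: "((real m * w) powr (1 / real k) * w) powr (real k / real n) = c * w"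
      proof -
        have e: "(1 / real k + 1) * (real k / real n) = 1"
        proof -
          have *: "r > 0 \<Longrightarrow> q = r + 1 \<Longrightarrow> (1 / r + 1) * (r / q) = 1" for r q :: real
            by (simp add: divide_simps)
          show ?thesis
          proof (rule *)
            show "0 < real k" using k(1) by linarith
            show "real n = real k + 1" using k(4) by linarith
          qed
        qed
        have "w powr (1 / real k) * w = w powr (1 / real k + 1)"
          using w by (simp add: powr_add)
        then have 1: "(real m * w) powr (1 / real k) * w = real m powr (1 / real k) * w powr (1 / real k + 1)"
          by (simp only: powr_mult mult.assoc)
        have "((real m * w) powr (1 / real k) * w) powr (real k / real n)
            = c * w powr ((1 / real k + 1) * (real k / real n))"
          unfolding 1 by (simp only: powr_mult powr_powr c_def)
        also have "\<dots> = c * w" using w unfolding e by simp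
        finally show ?thesis .
      qed
      from V have "ennreal_powr (frac_variation (1 / real k) id (K \<inter> {x i..y i})) (real k / real n)
          \<le> ennreal_powr (ennreal ((real m * w) powr (1 / real k) * w)) (real k / real n)"
        by (intro ennreal_powr_mono) auto
      also have "\<dots> = ennreal (((real m * w) powr (1 / real k) * w) powr (real k / real n))"
        using w by (intro ennreal_powr_ennreal) auto
      also have "\<dots> = ennreal (c * w)" by (simp only: cw)
      finally show ?thesis by (simp only: w_def)
    qed
    then have "gen_variation_sum n id K N x y \<le> (\<Sum>i<N. ennreal (c * (W (y i) - W (x i))))"
      unfolding gen_variation_sum_def k(4) by (intro sum_mono) auto
    also have "\<dots> = ennreal (\<Sum>i<N. c * (W (y i) - W (x i)))"
    proof (rule sum_ennreal)
      fix i assume "i \<in> {..<N}"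
      then have "x i \<in> {a..b}" "y i \<in> {a..b}" "x i \<le> y i"
        using no xy[of i] hZ by (auto simp: nonoverlapping_iff less_imp_le)
      then have "0 \<le> W (y i) - W (x i)" using W_mono by simp
      then show "0 \<le> c * (W (y i) - W (x i))" unfolding c_def by (intro mult_nonneg_nonneg) auto
    qed
    also have "\<dots> \<le> ennreal (c * (W b - W a))"
    proof (rule ennreal_leI)
      have "(\<Sum>i<N. W (y i) - W (x i)) \<le> W b - W a"
      proof (rule sum_increments_le[OF no, where E = "{a..b}" and W = W])
        show "mono_on {a..b} W" using W_mono by (auto simp: mono_on_def)
        show "x i \<in> {a..b} \<and> y i \<in> {a..b}" if "i < N" for i using xy[OF that] hZ by blast
        show "W a \<le> W z \<and> W z \<le> W b" if "z \<in> {a..b}" for z using that ab W_mono by auto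
        show "W a \<le> W b" using ab W_mono by auto
      qed
      then show "(\<Sum>i<N. c * (W (y i) - W (x i))) \<le> c * (W b - W a)"
        unfolding sum_distrib_left[symmetric] by (intro mult_left_mono) (auto simp: c_def)
    qed
    finally show "gen_variation_sum n id K N x y \<le> ennreal (c * (W b - W a))" .
  qed
  also have "\<dots> < \<infinity>" by simp
  finally show ?thesis .
qed

lemma GV_cover: "GV_cover n a b K"
proof -
  have "closed (h ` Zm m) \<and> h ` Zm m \<subseteq> {a..b}" for m
  proof -
    have sub: "Zm m \<subseteq> {a..b}" by (auto simp: Zm_def Z_def)
    have "compact (h ` Zm m)"
      by (intro compact_continuous_image continuous_on_subset[OF g(6) sub] compact_Zm)
    then show ?thesis using sub g(4) by (auto intro: compact_imp_closed)
  qed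
  moreover have "K = (\<Union>m\<in>UNIV. h ` Zm m)"
    unfolding K_Z(1) by (subst Zm_cover) blast
  ultimately have "(\<forall>m\<in>UNIV. closed (h ` Zm m) \<and> h ` Zm m \<subseteq> {a..b}) \<and> K = (\<Union>m\<in>UNIV. h ` Zm m) \<and>
    (\<forall>m\<in>UNIV. GV n id (h ` Zm m) K < \<infinity>)"
    using GV_Zm by blast
  then show ?thesis
    unfolding GV_cover_def by (intro exI[of _ UNIV] exI[of _ "\<lambda>m. h ` Zm m"])
qed

end

section \<open>Gluing smooth steps along the gaps of K\<close>

lemma pderiv_surj: "\<exists>q. pderiv q = (p :: real poly)"
proof
  let ?q = "\<Sum>i\<le>degree p. monom (coeff p i / real (Suc i)) (Suc i)"
  have "pderiv (sum f A) = (\<Sum>i\<in>A. pderiv (f i))" for f :: "nat \<Rightarrow> real poly" and A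
    by (induction A rule: infinite_finite_induct) (auto simp: pderiv_add)
  then have "pderiv ?q = (\<Sum>i\<le>degree p. monom (coeff p i) i)"
    by (simp add: pderiv_monom del: of_nat_Suc)
  then show "pderiv ?q = p" by (simp add: poly_as_sum_of_monoms)
qed

lemma pderiv_power_dvd:
  fixes p :: "real poly"
  assumes "[:-c, 1:] ^ Suc j dvd p"
  shows "[:-c, 1:] ^ j dvd pderiv p"
proof -
  obtain r where "p = [:-c, 1:] ^ Suc j * r" using assms by (auto elim: dvdE)
  then have "pderiv p = [:-c, 1:] ^ Suc j * pderiv r + r * (smult (of_nat (Suc j)) ([:-c, 1:] ^ j) * pderiv [:-c, 1:])"
    by (simp only: pderiv_mult pderiv_power_Suc)
  also have "\<dots> = [:-c, 1:] ^ j * ([:-c, 1:] * pderiv r + r * (smult (of_nat (Suc j)) (pderiv [:-c, 1:])))"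
    by (simp add: algebra_simps)
  finally show ?thesis by simp
qed

lemma pderiv_funpow_root:
  fixes p :: "real poly"
  assumes "[:-c, 1:] ^ N dvd p" "j < N"
  shows "poly ((pderiv ^^ j) p) c = 0"
proof -
  have "[:-c, 1:] ^ (N - j) dvd (pderiv ^^ j) p"
    using assms(2)
  proof (induction j)
    case (Suc j)
    then have "[:-c, 1:] ^ Suc (N - Suc j) dvd (pderiv ^^ j) p" by (simp add: Suc_diff_Suc)
    then show ?case by (simp add: pderiv_power_dvd)
  qed (use assms in simp)
  then have "[:-c, 1:] dvd (pderiv ^^ j) p"
    using assms(2) by (meson dvd_power dvd_trans zero_less_diff)
  then show ?thesis by (simp add: poly_eq_0_iff_dvd)
qed

lemma poly_quadratic_bound:
  fixes p :: "real poly"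
  assumes "poly (pderiv p) c = 0"
  shows "\<exists>C>0. \<forall>\<theta>\<in>{0..1}. \<bar>poly p \<theta> - poly p c\<bar> \<le> C * (\<theta> - c)\<^sup>2"
proof -
  have "poly (p - [:poly p c:]) c = 0" by simp
  then obtain r where r: "p - [:poly p c:] = [:-c, 1:] * r" unfolding poly_eq_0_iff_dvd by (elim dvdE)
  have "pderiv (p - [:poly p c:]) = [:-c, 1:] * pderiv r + r"
    unfolding r by (simp only: pderiv_mult) (simp add: pderiv_pCons)
  then have "poly (pderiv p) c = poly r c" by (simp add: pderiv_diff pderiv_pCons)
  then have "poly r c = 0" using assms by simp
  then obtain q where q: "r = [:-c, 1:] * q" unfolding poly_eq_0_iff_dvd by (elim dvdE)
  have eq: "poly p \<theta> - poly p c = (\<theta> - c)\<^sup>2 * poly q \<theta>" for \<theta>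
    using arg_cong[OF r, of "\<lambda>p. poly p \<theta>"] unfolding q by (simp add: power2_eq_square algebra_simps)
  have "bounded (poly q ` {0..1})"
    by (intro compact_imp_bounded compact_continuous_image continuous_intros) auto
  then obtain C where C: "C > 0" "\<And>\<theta>. \<theta> \<in> {0..1} \<Longrightarrow> \<bar>poly q \<theta>\<bar> \<le> C" by (auto simp: bounded_pos)
  have "\<bar>poly p \<theta> - poly p c\<bar> \<le> C * (\<theta> - c)\<^sup>2" if "\<theta> \<in> {0..1}" for \<theta>
  proof -
    have "\<bar>poly p \<theta> - poly p c\<bar> = \<bar>poly q \<theta>\<bar> * (\<theta> - c)\<^sup>2" unfolding eq by (simp add: abs_mult)
    also have "\<dots> \<le> C * (\<theta> - c)\<^sup>2" using C(2)[OF that] by (intro mult_right_mono) auto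
    finally show ?thesis .
  qed
  then show ?thesis using C(1) by blast
qed

text \<open>
  \<open>\<psi> 0\<close> is a function that rises from \<open>0\<close> to \<open>1\<close> on \<open>[0, 1]\<close> and is flat at both ends, and \<open>\<psi> k\<close> is its
  derivative of order \<open>k\<close>. All derivatives up to order \<open>n\<close> approach their boundary values
  quadratically, with constant \<open>C\<close>.
\<close>

definition smooth_step :: "nat \<Rightarrow> (nat \<Rightarrow> real \<Rightarrow> real) \<Rightarrow> real \<Rightarrow> bool" where
  "smooth_step n \<psi> C \<longleftrightarrow> 0 < C \<and>
     (\<forall>k \<theta>. (\<psi> k has_real_derivative \<psi> (Suc k) \<theta>) (at \<theta>)) \<and>
     \<psi> 0 0 = 0 \<and> \<psi> 0 1 = 1 \<and> (\<forall>\<theta>. 0 < \<theta> \<and> \<theta> < 1 \<longrightarrow> 0 < \<psi> 1 \<theta>) \<and>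
     (\<forall>k c. 1 \<le> k \<and> k \<le> n \<and> c \<in> {0, 1} \<longrightarrow> \<psi> k c = 0) \<and>
     (\<forall>k c \<theta>. k \<le> n \<and> c \<in> {0, 1} \<and> \<theta> \<in> {0..1} \<longrightarrow> \<bar>\<psi> k \<theta> - \<psi> k c\<bar> \<le> C * (\<theta> - c)\<^sup>2)"

text \<open>
  The normalized primitive of \<open>x ^ N * (1 - x) ^ N\<close> for \<open>N = n + 2\<close>. Its derivatives of order \<open>1\<close> to
  \<open>n + 1\<close> vanish at both ends, and one order more than \<open>n\<close> is needed for the quadratic bound.
\<close>

lemma smooth_step_exists: "\<exists>\<psi> C. smooth_step n \<psi> C"
proof -
  define N where "N = n + 2"
  define p :: "real poly" where "p = [:0, 1:] ^ N * [:1, -1:] ^ N"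
  obtain q where q: "pderiv q = p" using pderiv_surj by blast
  define L where "L = poly q 1 - poly q 0"
  have p_pos: "0 < poly p \<theta>" if "0 < \<theta>" "\<theta> < 1" for \<theta>
    using that by (simp add: p_def)
  have "0 < L"
    using poly_MVT[of 0 1 q] p_pos unfolding L_def q by force
  define P where "P = smult (1 / L) (q - [:poly q 0:])"
  define \<psi> where "\<psi> k = poly ((pderiv ^^ k) P)" for k
  have P': "pderiv P = smult (1 / L) p" by (simp add: P_def pderiv_smult pderiv_diff q pderiv_pCons)
  have dvd: "[:-c, 1:] ^ N dvd p" if "c \<in> {0, 1}" for c
  proof (cases "c = 0")
    case False
    have "[:1, -1:] ^ N = [:-1, 1:] ^ N * ([:-1:] :: real poly) ^ N"
      unfolding power_mult_distrib[symmetric] by simp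
    with False that show ?thesis by (simp add: p_def)
  qed (simp add: p_def)
  have root: "\<psi> k c = 0" if k: "1 \<le> k" "k \<le> Suc n" and c: "c \<in> {0, 1}" for k c
  proof -
    obtain j where j: "k = Suc j" "j < N" using k by (cases k) (auto simp: N_def)
    have "[:-c, 1:] ^ N dvd pderiv P" unfolding P' by (intro dvd_smult dvd c)
    from pderiv_funpow_root[OF this j(2)] show ?thesis
      unfolding \<psi>_def j(1) by (simp add: funpow_Suc_right del: funpow.simps)
  qed
  have "\<exists>C>0. \<forall>\<theta>\<in>{0..1}. \<bar>\<psi> k \<theta> - \<psi> k c\<bar> \<le> C * (\<theta> - c)\<^sup>2" if "k \<le> n" "c \<in> {0, 1}" for k c
    using poly_quadratic_bound[of "(pderiv ^^ k) P" c] root[of "Suc k" c] that by (simp add: \<psi>_def)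
  then obtain Cf where Cf: "\<And>k c. k \<le> n \<Longrightarrow> c \<in> {0, 1} \<Longrightarrow> 0 < Cf k c"
    "\<And>k c \<theta>. k \<le> n \<Longrightarrow> c \<in> {0, 1} \<Longrightarrow> \<theta> \<in> {0..1} \<Longrightarrow> \<bar>\<psi> k \<theta> - \<psi> k c\<bar> \<le> Cf k c * (\<theta> - c)\<^sup>2"
    by metis
  define C where "C = (\<Sum>k\<le>n. \<Sum>c\<in>{0, 1}. Cf k c)"
  have CfC: "Cf k c \<le> C" if "k \<le> n" "c \<in> {0, 1}" for k c
  proof -
    have "Cf k c \<le> (\<Sum>c\<in>{0, 1}. Cf k c)"
      using that Cf(1)[OF that(1)] by (intro member_le_sum) (auto intro: less_imp_le)
    also have "\<dots> \<le> C" unfolding C_def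
      using that Cf(1) by (intro member_le_sum[of k "{..n}" "\<lambda>k. \<Sum>c\<in>{0, 1}. Cf k c"] sum_nonneg) (auto intro: less_imp_le)
    finally show ?thesis .
  qed
  have "smooth_step n \<psi> C"
    unfolding smooth_step_def
  proof (intro conjI allI impI)
    show "0 < C" using Cf(1)[of 0 0] CfC[of 0 0] by simp
    show "(\<psi> k has_real_derivative \<psi> (Suc k) \<theta>) (at \<theta>)" for k \<theta>
      using poly_DERIV[of "(pderiv ^^ k) P" \<theta>] by (simp add: \<psi>_def)
    show "\<psi> 0 0 = 0" "\<psi> 0 1 = 1" using \<open>0 < L\<close> by (auto simp: \<psi>_def P_def L_def)
    show "0 < \<psi> 1 \<theta>" if "0 < \<theta> \<and> \<theta> < 1" for \<theta>
      using that p_pos[of \<theta>] \<open>0 < L\<close> by (simp add: \<psi>_def P')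
    show "\<psi> k c = 0" if "1 \<le> k \<and> k \<le> n \<and> c \<in> {0, 1}" for k c using root that by auto
    show "\<bar>\<psi> k \<theta> - \<psi> k c\<bar> \<le> C * (\<theta> - c)\<^sup>2" if "k \<le> n \<and> c \<in> {0, 1} \<and> \<theta> \<in> {0..1}" for k c \<theta>
    proof -
      have "\<bar>\<psi> k \<theta> - \<psi> k c\<bar> \<le> Cf k c * (\<theta> - c)\<^sup>2" using that by (intro Cf(2)) auto
      also have "\<dots> \<le> C * (\<theta> - c)\<^sup>2" using that by (intro mult_right_mono CfC) auto
      finally show ?thesis .
    qed
  qed
  then show ?thesis by blast
qed

text \<open>
  The open intervals between neighbouring points of \<open>K\<close>; for closed \<open>K\<close> these are the bounded
  components of the complement.
\<close>

definition gap :: "real set \<Rightarrow> real \<Rightarrow> real \<Rightarrow> bool" where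
  "gap K p q \<longleftrightarrow> p \<in> K \<and> q \<in> K \<and> p < q \<and> {p<..<q} \<inter> K = {}"

text \<open>
  The data for the construction of a function that takes the value \<open>x\<close> at \<open>g x\<close> for \<open>x\<close> in \<open>K\<close>, and is
  a rescaled step over each gap. The first smallness assumption says that this function is flat along
  \<open>g ` K\<close>. In the second one \<open>e\<close> is the endpoint of the gap on the side of \<open>x0\<close>, and \<open>s\<close> is the distance of
  a point of \<open>[g p, g q]\<close> to \<open>g e\<close>; the left hand side is, up to a constant, the bound for the
  derivative of order \<open>n - 1\<close> of the rescaled step at that point.
\<close>

locale gap_glue =
  fixes K :: "real set" and g :: "real \<Rightarrow> real" and n :: nat and lo hi :: real
    and \<psi> :: "nat \<Rightarrow> real \<Rightarrow> real" and C :: real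
  assumes compact: "compact K" and ends: "lo \<in> K" "hi \<in> K" "K \<subseteq> {lo..hi}"
    and cont: "continuous_on K g" and mono: "\<And>s t. s \<in> K \<Longrightarrow> t \<in> K \<Longrightarrow> s < t \<Longrightarrow> g s < g t"
    and n: "1 \<le> n"
    and step: "smooth_step n \<psi> C"
    and flat_points: "\<And>x0 \<epsilon>. x0 \<in> K \<Longrightarrow> 0 < \<epsilon> \<Longrightarrow> \<exists>\<eta>>0. \<forall>x\<in>K. \<bar>g x - g x0\<bar> < \<eta> \<longrightarrow> \<bar>x - x0\<bar> \<le> \<epsilon> * \<bar>g x - g x0\<bar>"
    and flat_gaps: "\<And>x0 \<epsilon>. x0 \<in> K \<Longrightarrow> 0 < \<epsilon> \<Longrightarrow> \<exists>\<eta>>0. \<forall>p q e s. gap K p q \<longrightarrow>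
      (e = p \<and> x0 \<le> p) \<or> (e = q \<and> q \<le> x0) \<longrightarrow> 0 \<le> s \<longrightarrow> s \<le> g q - g p \<longrightarrow> \<bar>g e - g x0\<bar> + s < \<eta> \<longrightarrow>
      (q - p) / (g q - g p) ^ (n - 1) * (s / (g q - g p))\<^sup>2 \<le> \<epsilon> * (\<bar>g e - g x0\<bar> + s)"
begin

abbreviation "T \<equiv> {g lo..g hi}"
abbreviation "Z \<equiv> g ` K"

lemma psi: "0 < C" "(\<psi> k has_real_derivative \<psi> (Suc k) \<theta>) (at \<theta>)" "\<psi> 0 0 = 0" "\<psi> 0 1 = 1"
  "0 < \<theta> \<Longrightarrow> \<theta> < 1 \<Longrightarrow> 0 < \<psi> 1 \<theta>" "1 \<le> k \<Longrightarrow> k \<le> n \<Longrightarrow> c \<in> {0, 1} \<Longrightarrow> \<psi> k c = 0"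
  "k \<le> n \<Longrightarrow> c \<in> {0, 1} \<Longrightarrow> \<theta> \<in> {0..1} \<Longrightarrow> \<bar>\<psi> k \<theta> - \<psi> k c\<bar> \<le> C * (\<theta> - c)\<^sup>2"
  using step unfolding smooth_step_def by blast+

lemma g_le: "s \<in> K \<Longrightarrow> t \<in> K \<Longrightarrow> g s \<le> g t \<longleftrightarrow> s \<le> t"
  using mono[of s t] mono[of t s] by (cases s t rule: linorder_cases) auto

lemma g_less: "s \<in> K \<Longrightarrow> t \<in> K \<Longrightarrow> g s < g t \<longleftrightarrow> s < t"
  using g_le[of t s] by auto

lemma inj: "inj_on g K"
  by (rule inj_onI) (metis g_le order_antisym order_refl)

lemma Z_T: "Z \<subseteq> T"
  using g_le ends by auto

lemma gap_exists:
  assumes "u \<in> T" "u \<notin> Z"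
  shows "\<exists>p q. gap K p q \<and> g p < u \<and> u < g q"
proof -
  have cZ: "compact Z" using compact cont by (intro compact_continuous_image)
  have "compact (Z \<inter> {..u})" "Z \<inter> {..u} \<noteq> {}" "compact (Z \<inter> {u..})" "Z \<inter> {u..} \<noteq> {}"
    using cZ assms ends by (auto intro: compact_Int_closed)
  then obtain L R where L: "L \<in> Z \<inter> {..u}" "\<forall>z\<in>Z \<inter> {..u}. z \<le> L" and R: "R \<in> Z \<inter> {u..}" "\<forall>z\<in>Z \<inter> {u..}. R \<le> z"
    using compact_attains_sup compact_attains_inf by metis
  obtain p q where pq: "p \<in> K" "L = g p" "q \<in> K" "R = g q" using L R by auto
  have less: "g p < u" "u < g q" using L R assms pq by (auto simp: less_le)
  have "x \<notin> K" if "p < x" "x < q" for x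
  proof
    assume x: "x \<in> K"
    then have "g p < g x" "g x < g q" using that pq mono by auto
    moreover have "g x \<in> Z" using x by blast
    ultimately show False using L(2) R(2) pq(2,4) by (cases "g x \<le> u") force+
  qed
  moreover have "p < q" using less g_less[of p q] pq by auto
  ultimately have "gap K p q" using pq unfolding gap_def by auto
  then show ?thesis using less by blast
qed

text \<open>
  The left and the right endpoint of the gap over which \<open>u\<close> lies.
\<close>

definition "P u = fst (SOME (p, q). gap K p q \<and> g p < u \<and> u < g q)"
definition "Q u = snd (SOME (p, q). gap K p q \<and> g p < u \<and> u < g q)"

lemma gap_unique:
  assumes "gap K p q" "g p < u" "u < g q" "gap K p' q'" "g p' < u" "u < g q'"
  shows "p = p'" "q = q'"
proof -
  have K: "p \<in> K" "q \<in> K" "p' \<in> K" "q' \<in> K" using assms by (auto simp: gap_def)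
  have "p < q'" "p' < q" using assms K g_less[of p q'] g_less[of p' q] by auto
  then show "p = p'" "q = q'"
    using assms(1,4) K unfolding gap_def disjoint_iff greaterThanLessThan_iff
    by (metis linorder_neqE)+
qed

lemma PQ:
  assumes "gap K p q" "g p < u" "u < g q"
  shows "P u = p" "Q u = q"
proof -
  have "case (SOME (p, q). gap K p q \<and> g p < u \<and> u < g q) of (p, q) \<Rightarrow> gap K p q \<and> g p < u \<and> u < g q"
    by (rule someI[of _ "(p, q)"]) (use assms in simp)
  then have "gap K (P u) (Q u) \<and> g (P u) < u \<and> u < g (Q u)"
    unfolding P_def Q_def by (simp add: case_prod_unfold)
  then show "P u = p" "Q u = q" using gap_unique assms by blast+
qed

text \<open>
  \<open>H 0\<close> is the glued function, and \<open>H k\<close> for \<open>k > 0\<close> is its derivative of order \<open>k\<close> (lemma \<open>H_deriv\<close> below);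
  the latter is set to \<open>0\<close> on \<open>g ` K\<close>.
\<close>

definition "H k u = (if u \<in> Z then (if k = 0 then inv_into K g u else 0)
   else (if k = 0 then P u else 0) + (Q u - P u) / (g (Q u) - g (P u)) ^ k * \<psi> k ((u - g (P u)) / (g (Q u) - g (P u))))"

lemma H_Z: "x \<in> K \<Longrightarrow> H 0 (g x) = x" "x \<in> K \<Longrightarrow> 1 \<le> k \<Longrightarrow> H k (g x) = 0"
  using inj by (auto simp: H_def)

lemma gap_notin_Z:
  assumes "gap K p q" "g p < u" "u < g q" shows "u \<notin> Z" "u \<in> T"
proof -
  have K: "p \<in> K" "q \<in> K" using assms by (auto simp: gap_def)
  show "u \<notin> Z"
  proof
    assume "u \<in> Z"
    then obtain x where x: "x \<in> K" "u = g x" by auto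
    then have "p < x" "x < q" using assms K g_less by auto
    then show False using x assms(1) by (auto simp: gap_def)
  qed
  have "g lo \<le> g p" "g q \<le> g hi" using K ends g_le by auto
  then show "u \<in> T" using assms by auto
qed

lemma H_gap:
  assumes "gap K p q" "g p < u" "u < g q"
  shows "H k u = (if k = 0 then p else 0) + (q - p) / (g q - g p) ^ k * \<psi> k ((u - g p) / (g q - g p))"
  using gap_notin_Z[OF assms] PQ[OF assms] by (simp add: H_def)

lemma H_deriv_gap:
  assumes "gap K p q" "g p < u" "u < g q"
  shows "(H k has_real_derivative H (Suc k) u) (at u)"
proof -
  define \<tau> where "\<tau> = g q - g p"
  have \<tau>: "\<tau> > 0" using assms by (simp add: \<tau>_def)
  have "((\<lambda>u. (u - g p) / \<tau>) has_real_derivative 1 / \<tau>) (at u)"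
    using \<tau> by (auto intro!: derivative_eq_intros)
  from DERIV_chain2[OF psi(2)[of k "(u - g p) / \<tau>"] this]
  have "((\<lambda>u. \<psi> k ((u - g p) / \<tau>)) has_real_derivative \<psi> (Suc k) ((u - g p) / \<tau>) * (1 / \<tau>)) (at u)" .
  from DERIV_add[OF DERIV_const DERIV_cmult[OF this, of "(q - p) / \<tau> ^ k"], of "if k = 0 then p else 0"]
  have "((\<lambda>u. (if k = 0 then p else 0) + (q - p) / \<tau> ^ k * \<psi> k ((u - g p) / \<tau>)) has_real_derivative H (Suc k) u) (at u)"
    by (rule DERIV_cong) (use H_gap[OF assms, of "Suc k"] \<tau> in \<open>simp add: \<tau>_def\<close>)
  then show ?thesis
    by (rule has_field_derivative_transform_within_open[where S = "{g p<..<g q}"])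
       (use assms H_gap[OF assms(1)] in \<open>auto simp: \<tau>_def\<close>)
qed

text \<open>
  The increment of \<open>H k\<close> from a point of \<open>g ` K\<close> to a point over a gap is estimated from the endpoint
  \<open>e\<close> of that gap facing the given point. Orders below \<open>n - 1\<close> reduce to order \<open>n - 1\<close> since the lengths
  \<open>g q - g p\<close> are bounded by \<open>U\<close>.
\<close>

lemma H_deriv_Z:
  assumes x0: "x0 \<in> K" and k: "k < n"
  shows "(H k has_real_derivative H (Suc k) (g x0)) (at (g x0) within T)"
proof -
  have H': "H (Suc k) (g x0) = 0" using H_Z(2) x0 by simp
  define U where "U = max 1 (g hi - g lo)"
  have U: "1 \<le> U" by (simp add: U_def)
  have CU: "0 \<le> C * U ^ n" using psi(1) U by simp
  have "\<exists>\<eta>>0. \<forall>y\<in>T. \<bar>y - g x0\<bar> < \<eta> \<longrightarrow> \<bar>H k y - H k (g x0)\<bar> \<le> \<epsilon> * \<bar>y - g x0\<bar>" if \<epsilon>: "0 < \<epsilon>" for \<epsilon>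
  proof -
    define \<epsilon>' where "\<epsilon>' = \<epsilon> / (1 + C * U ^ n)"
    have \<epsilon>': "0 < \<epsilon>'" "(1 + C * U ^ n) * \<epsilon>' = \<epsilon>" using \<epsilon> CU by (auto simp: \<epsilon>'_def add_nonneg_eq_0_iff)
    have \<epsilon>le: "\<epsilon>' \<le> \<epsilon>" "C * U ^ n * \<epsilon>' \<le> \<epsilon>"
      using \<epsilon>' CU mult_nonneg_nonneg[OF CU less_imp_le[OF \<epsilon>'(1)]] unfolding distrib_right by linarith+
    obtain \<eta>1 where \<eta>1: "0 < \<eta>1" "\<forall>x\<in>K. \<bar>g x - g x0\<bar> < \<eta>1 \<longrightarrow> \<bar>x - x0\<bar> \<le> \<epsilon>' * \<bar>g x - g x0\<bar>"
      using flat_points[OF x0 \<epsilon>'(1)] by blast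
    obtain \<eta>2 where \<eta>2: "0 < \<eta>2" "\<And>p q e s. gap K p q \<Longrightarrow>
      (e = p \<and> x0 \<le> p) \<or> (e = q \<and> q \<le> x0) \<Longrightarrow> 0 \<le> s \<Longrightarrow> s \<le> g q - g p \<Longrightarrow> \<bar>g e - g x0\<bar> + s < \<eta>2 \<Longrightarrow>
      (q - p) / (g q - g p) ^ (n - 1) * (s / (g q - g p))\<^sup>2 \<le> \<epsilon>' * (\<bar>g e - g x0\<bar> + s)"
      using flat_gaps[OF x0 \<epsilon>'(1)] by blast
    have "\<bar>H k y - H k (g x0)\<bar> \<le> \<epsilon> * \<bar>y - g x0\<bar>" if y: "y \<in> T" "\<bar>y - g x0\<bar> < min \<eta>1 \<eta>2" for y
    proof (cases "y \<in> Z")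
      case True
      then obtain x where x: "x \<in> K" "y = g x" by auto
      show ?thesis
      proof (cases "k = 0")
        case True
        have "\<bar>x - x0\<bar> \<le> \<epsilon>' * \<bar>g x - g x0\<bar>" using \<eta>1 x y by auto
        also have "\<dots> \<le> \<epsilon> * \<bar>g x - g x0\<bar>" using \<epsilon>le by (intro mult_right_mono) auto
        finally show ?thesis using x x0 True H_Z(1) by simp
      next
        case False
        then show ?thesis using x x0 H_Z(2) \<epsilon> by simp
      qed
    next
      case False
      then obtain p q where pq: "gap K p q" "g p < y" "y < g q" using gap_exists y by blast
      define \<tau> where "\<tau> = g q - g p"
      have K: "p \<in> K" "q \<in> K" "p < q" using pq by (auto simp: gap_def)
      have \<tau>: "0 < \<tau>" "\<tau> \<le> U"
        using pq K ends g_le[of lo p] g_le[of q hi] by (auto simp: \<tau>_def U_def)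
      define \<theta> where "\<theta> = (y - g p) / \<tau>"
      have \<theta>: "\<theta> \<in> {0..1}" using pq \<tau> by (auto simp: \<theta>_def \<tau>_def)
      have "x0 \<le> p \<or> q \<le> x0" using x0 pq(1) unfolding gap_def disjoint_iff greaterThanLessThan_iff by (meson not_less)
      then obtain e s c where e: "(e = p \<and> x0 \<le> p \<and> c = 0) \<or> (e = q \<and> q \<le> x0 \<and> c = 1)"
        and s: "0 \<le> s" "s \<le> \<tau>" "(\<theta> - c)\<^sup>2 = (s / \<tau>)\<^sup>2" "\<bar>y - g x0\<bar> = \<bar>g e - g x0\<bar> + s"
      proof
        assume "x0 \<le> p"
        then have "g x0 \<le> g p" using g_le x0 K by simp
        then show thesis using that[of p 0 "y - g p"] pq \<open>x0 \<le> p\<close> by (auto simp: \<theta>_def \<tau>_def)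
      next
        assume "q \<le> x0"
        then have "g q \<le> g x0" using g_le x0 K by simp
        moreover have "(\<theta> - 1)\<^sup>2 = ((g q - y) / \<tau>)\<^sup>2"
        proof -
          have "\<theta> - 1 = - ((g q - y) / \<tau>)" using \<tau> by (simp add: \<theta>_def field_simps \<tau>_def)
          then show ?thesis by simp
        qed
        ultimately show thesis using that[of q 1 "g q - y"] pq \<open>q \<le> x0\<close> by (auto simp: \<tau>_def)
      qed
      have eK: "e \<in> K" and c01: "c \<in> {0, 1}" using e K by auto
      have near: "\<bar>g e - g x0\<bar> + s < \<eta>2" "\<bar>g e - g x0\<bar> < \<eta>1" using y s by auto
      have main: "\<bar>(q - p) / \<tau> ^ k * (\<psi> k \<theta> - \<psi> k c)\<bar> \<le> C * U ^ n * \<epsilon>' * \<bar>y - g x0\<bar>"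
      proof -
        have "\<bar>(q - p) / \<tau> ^ k * (\<psi> k \<theta> - \<psi> k c)\<bar> = (q - p) / \<tau> ^ k * \<bar>\<psi> k \<theta> - \<psi> k c\<bar>"
          using K \<tau> by (simp add: abs_mult)
        also have "\<dots> \<le> (q - p) / \<tau> ^ k * (C * (s / \<tau>)\<^sup>2)"
          using psi(7)[of k c \<theta>] k c01 \<theta> s(3) K \<tau> by (intro mult_left_mono) auto
        also have "\<dots> = C * \<tau> ^ (n - 1 - k) * ((q - p) / \<tau> ^ (n - 1) * (s / \<tau>)\<^sup>2)"
        proof -
          have "\<tau> ^ (n - 1) = \<tau> ^ k * \<tau> ^ (n - 1 - k)" using k by (simp flip: power_add)
          then have "(q - p) / \<tau> ^ k = \<tau> ^ (n - 1 - k) * ((q - p) / \<tau> ^ (n - 1))" using \<tau> by simp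
          then show ?thesis by simp
        qed
        also have "\<dots> \<le> C * U ^ n * (\<epsilon>' * (\<bar>g e - g x0\<bar> + s))"
        proof (rule mult_mono)
          have "\<tau> ^ (n - 1 - k) \<le> U ^ (n - 1 - k)" using \<tau> by (intro power_mono) auto
          also have "\<dots> \<le> U ^ n" using U by (intro power_increasing) auto
          finally show "C * \<tau> ^ (n - 1 - k) \<le> C * U ^ n"
            using psi(1) by (intro mult_left_mono) auto
          have "(q - p) / (g q - g p) ^ (n - 1) * (s / (g q - g p))\<^sup>2 \<le> \<epsilon>' * (\<bar>g e - g x0\<bar> + s)"
            using e s(2) unfolding \<tau>_def by (intro \<eta>2(2) pq near(1) s(1)) auto
          then show "(q - p) / \<tau> ^ (n - 1) * (s / \<tau>)\<^sup>2 \<le> \<epsilon>' * (\<bar>g e - g x0\<bar> + s)"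
            unfolding \<tau>_def .
          show "0 \<le> C * U ^ n" by (rule CU)
          show "0 \<le> (q - p) / \<tau> ^ (n - 1) * (s / \<tau>)\<^sup>2"
            using K \<tau> by (intro mult_nonneg_nonneg divide_nonneg_nonneg) auto
        qed
        finally show ?thesis using s(4) by (simp add: mult.assoc)
      qed
      have Hy: "H k y = (if k = 0 then p else 0) + (q - p) / \<tau> ^ k * \<psi> k \<theta>"
        using H_gap[OF pq] by (simp add: \<tau>_def \<theta>_def)
      show ?thesis
      proof (cases "k = 0")
        case True
        have "H k y - H k (g x0) = (q - p) / \<tau> ^ k * (\<psi> k \<theta> - \<psi> k c) + (e - x0)"
          using e True H_Z(1)[OF x0] psi(3,4) unfolding Hy by (auto simp: algebra_simps)
        then have "\<bar>H k y - H k (g x0)\<bar> \<le> \<bar>(q - p) / \<tau> ^ k * (\<psi> k \<theta> - \<psi> k c)\<bar> + \<bar>e - x0\<bar>"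
          by (simp only: abs_triangle_ineq)
        then have "\<bar>H k y - H k (g x0)\<bar> \<le> C * U ^ n * \<epsilon>' * \<bar>y - g x0\<bar> + \<bar>e - x0\<bar>"
          using add_right_mono[OF main] by (rule order.trans)
        also have "\<bar>e - x0\<bar> \<le> \<epsilon>' * \<bar>g e - g x0\<bar>" using \<eta>1 near eK by auto
        also have "\<dots> \<le> \<epsilon>' * \<bar>y - g x0\<bar>" using s \<epsilon>' by (intro mult_left_mono) auto
        finally show ?thesis unfolding \<epsilon>'(2)[symmetric] by (simp add: algebra_simps)
      next
        case False
        then have "H k y - H k (g x0) = (q - p) / \<tau> ^ k * (\<psi> k \<theta> - \<psi> k c)"
          using H_Z(2)[OF x0, of k] psi(6)[of k c] c01 k unfolding Hy by simp
        then have "\<bar>H k y - H k (g x0)\<bar> \<le> C * U ^ n * \<epsilon>' * \<bar>y - g x0\<bar>" using main by simp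
        also have "\<dots> \<le> \<epsilon> * \<bar>y - g x0\<bar>" using \<epsilon>le by (intro mult_right_mono) auto
        finally show ?thesis .
      qed
    qed
    then show ?thesis using \<eta>1(1) \<eta>2(1) by (intro exI[of _ "min \<eta>1 \<eta>2"]) auto
  qed
  then show ?thesis
    unfolding has_field_derivative_def has_derivative_within_alt H' by (simp add: bounded_linear_mult_right)
qed

lemma H_deriv:
  assumes "u \<in> T" "k < n" shows "(H k has_real_derivative H (Suc k) u) (at u within T)"
proof (cases "u \<in> Z")
  case True
  then show ?thesis using H_deriv_Z assms by auto
next
  case False
  then obtain p q where "gap K p q" "g p < u" "u < g q" using gap_exists assms by blast
  then show ?thesis by (rule has_field_derivative_at_within[OF H_deriv_gap])
qed

lemma H_cont: "continuous_on T (H 0)"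
  using H_deriv n by (intro DERIV_continuous_on[of T "H 0" "H (Suc 0)"]) auto

lemma H1_pos: "u \<in> T \<Longrightarrow> u \<notin> Z \<Longrightarrow> 0 < H 1 u"
proof -
  assume "u \<in> T" "u \<notin> Z"
  then obtain p q where pq: "gap K p q" "g p < u" "u < g q" using gap_exists by blast
  then have "p < q" "g p < g q" by (auto simp: gap_def)
  then show ?thesis using psi(5)[of "(u - g p) / (g q - g p)"] pq
    unfolding H_gap[OF pq] by auto
qed

lemma H1_nonneg: "u \<in> T \<Longrightarrow> 0 \<le> H 1 u"
  using H1_pos[of u] H_Z(2)[of _ 1] by (cases "u \<in> Z") auto

lemma H_deriv_interior:
  assumes "g lo < w" "w < g hi" shows "(H 0 has_real_derivative H 1 w) (at w)"
  using H_deriv[of w 0] n assms by (simp add: at_within_Icc_at)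

lemma H_mono: assumes "u \<in> T" "u' \<in> T" "u \<le> u'" shows "H 0 u \<le> H 0 u'"
proof (cases "u = u'")
  case False
  show ?thesis
  proof (rule DERIV_nonneg_imp_increasing_open[where f = "H 0" and a = u and b = u'])
    show "\<exists>y. (H 0 has_real_derivative y) (at x) \<and> 0 \<le> y" if "u < x" "x < u'" for x
      using H_deriv_interior[of x] H1_nonneg[of x] that assms by auto
    show "continuous_on {u..u'} (H 0)"
      using H_cont by (rule continuous_on_subset) (use assms in auto)
  qed (use assms in simp)
qed simp

text \<open>
  A plateau would consist of points of \<open>g ` K\<close>, on which \<open>H 0\<close> is injective.
\<close>

lemma H_strict_mono: assumes "u \<in> T" "u' \<in> T" "u < u'" shows "H 0 u < H 0 u'"
proof (rule ccontr)
  assume "\<not> ?thesis"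
  then have eq: "H 0 u = H 0 u'" using H_mono[of u u'] assms by simp
  have inZ: "w \<in> Z" if w: "u < w" "w < u'" for w
  proof (rule ccontr)
    assume "w \<notin> Z"
    then have "0 < H 1 w" using w assms by (intro H1_pos) auto
    then obtain d where d: "d > 0" "\<And>h. 0 < h \<Longrightarrow> h < d \<Longrightarrow> H 0 w < H 0 (w + h)"
      using DERIV_pos_inc_right[OF H_deriv_interior[of w]] w assms by auto
    define h where "h = min (d / 2) (u' - w)"
    have h: "0 < h" "h < d" "w + h \<le> u'" using d w by (auto simp: h_def)
    have "H 0 u \<le> H 0 w" "H 0 (w + h) \<le> H 0 u'" using w h assms by (auto intro!: H_mono)
    with d(2)[OF h(1,2)] eq show False by simp
  qed
  have const: "H 0 w = H 0 u" if "u < w" "w < u'" for w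
    using H_mono[of u w] H_mono[of w u'] that assms eq by auto
  obtain w where w: "u < w" "w < u'" using assms dense by blast
  obtain w' where w': "w < w'" "w' < u'" using w dense by blast
  obtain x x' where x: "x \<in> K" "w = g x" "x' \<in> K" "w' = g x'"
    using inZ[of w] inZ[of w'] w w' by fastforce
  then have "x = x'" using const[of w] const[of w'] w w' H_Z(1) by auto
  then show False using x w' by simp
qed

lemma homeomorphism_exists:
  assumes ab: "a < b" "lo \<le> a" "b \<le> hi"
  shows "\<exists>h h'. homeomorphism {a..b} {a..b} h h' \<and> n_times_differentiable_on n h {a..b} \<and>
     K \<inter> {a..b} = h ` {x \<in> {a..b}. \<forall>i\<in>{1..n}. nderiv_within {a..b} i h x = 0}"
proof -
  have gg: "g lo \<le> g hi" using g_le ends ab by auto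
  have Hends: "H 0 (g lo) = lo" "H 0 (g hi) = hi" using H_Z(1) ends by auto
  obtain ua where ua: "ua \<in> T" "H 0 ua = a"
    using IVT'[of "H 0" "g lo" a "g hi"] Hends gg H_cont ab by auto
  obtain ub where ub: "ub \<in> T" "H 0 ub = b"
    using IVT'[of "H 0" "g lo" b "g hi"] Hends gg H_cont ab by auto
  have uab: "ua < ub" using H_mono[of ub ua] ua ub ab by (cases "ua < ub") auto
  \<comment> \<open>restrict \<open>H 0\<close> to the preimage \<open>[ua, ub]\<close> of \<open>[a, b]\<close>, reparametrized affinely over \<open>[a, b]\<close>\<close>
  define \<kappa> where "\<kappa> = (ub - ua) / (b - a)"
  have \<kappa>: "0 < \<kappa>" "(b - a) * \<kappa> = ub - ua" using uab ab by (auto simp: \<kappa>_def)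
  define \<phi> where "\<phi> x = ua + (x - a) * \<kappa>" for x
  have \<phi>_mono: "\<phi> x < \<phi> y" if "x < y" for x y using that \<kappa> by (simp add: \<phi>_def)
  have \<phi>_ends: "\<phi> a = ua" "\<phi> b = ub" using \<kappa> by (auto simp: \<phi>_def)
  have \<phi>_in: "\<phi> x \<in> {ua..ub}" "\<phi> x \<in> T" if "x \<in> {a..b}" for x
  proof -
    have "ua \<le> \<phi> x" "\<phi> x \<le> ub" using \<phi>_mono[of a x] \<phi>_mono[of x b] \<phi>_ends that by (cases "x = a"; cases "x = b"; auto)+
    then show "\<phi> x \<in> {ua..ub}" "\<phi> x \<in> T" using ua ub by auto
  qed
  have \<phi>_surj: "\<exists>x\<in>{a..b}. \<phi> x = w" if "w \<in> {ua..ub}" for w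
  proof -
    have "0 \<le> (w - ua) / \<kappa>" "(w - ua) / \<kappa> \<le> b - a" using that \<kappa> by (auto simp: field_simps)
    then show ?thesis using \<kappa> by (intro bexI[of _ "a + (w - ua) / \<kappa>"]) (auto simp: \<phi>_def)
  qed
  define h where "h k x = \<kappa> ^ k * H k (\<phi> x)" for k x
  have hd: "(h i has_real_derivative h (Suc i) x) (at x within {a..b})" if i: "i < n" and x: "x \<in> {a..b}" for i x
  proof -
    have "(H i has_real_derivative H (Suc i) (\<phi> x)) (at (\<phi> x) within \<phi> ` {a..b})"
      by (rule has_field_derivative_subset[OF H_deriv]) (use \<phi>_in x i in auto)
    moreover have "(\<phi> has_real_derivative \<kappa>) (at x within {a..b})"
      unfolding \<phi>_def by (auto intro!: derivative_eq_intros)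
    ultimately have "((H i \<circ> \<phi>) has_real_derivative H (Suc i) (\<phi> x) * \<kappa>) (at x within {a..b})"
      by (rule DERIV_image_chain)
    from DERIV_cmult[OF this, of "\<kappa> ^ i"] show ?thesis
      unfolding h_def comp_def by (rule DERIV_cong) simp
  qed
  have h_mono: "h 0 x < h 0 y" if "x \<in> {a..b}" "y \<in> {a..b}" "x < y" for x y
    using H_strict_mono[OF \<phi>_in(2)[OF that(1)] \<phi>_in(2)[OF that(2)] \<phi>_mono[OF that(3)]] by (simp add: h_def)
  have h_cont: "continuous_on {a..b} (h 0)"
    using hd n by (intro DERIV_continuous_on[of "{a..b}" "h 0" "h (Suc 0)"]) auto
  have h_ends: "h 0 a = a" "h 0 b = b" using \<phi>_ends ua ub by (auto simp: h_def)
  have h_img: "h 0 ` {a..b} = {a..b}"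
  proof
    show "h 0 ` {a..b} \<subseteq> {a..b}"
    proof
      fix y assume "y \<in> h 0 ` {a..b}"
      then obtain x where x: "x \<in> {a..b}" and y: "y = h 0 x" by blast
      from x have "h 0 a \<le> h 0 x" "h 0 x \<le> h 0 b"
        using h_mono[of a x] h_mono[of x b] ab by (cases "x = a"; cases "x = b"; auto)+
      then show "y \<in> {a..b}" by (simp add: h_ends y)
    qed
    show "{a..b} \<subseteq> h 0 ` {a..b}"
    proof
      fix y assume "y \<in> {a..b}"
      then obtain x where "x \<in> {a..b}" "h 0 x = y"
        using IVT'[of "h 0" a y b] h_ends h_cont ab by auto
      then show "y \<in> h 0 ` {a..b}" by auto
    qed
  qed
  have "inj_on (h 0) {a..b}"
  proof (rule inj_onI)
    fix x y assume "x \<in> {a..b}" "y \<in> {a..b}" "h 0 x = h 0 y"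
    then show "x = y" using h_mono[of x y] h_mono[of y x] by (cases x y rule: linorder_cases) auto
  qed
  then obtain h' where hom: "homeomorphism {a..b} {a..b} (h 0) h'"
    using homeomorphism_compact[OF _ h_cont h_img] by auto
  have nd: "n_times_differentiable_on n (h 0) {a..b}"
    by (rule n_times_differentiable_onI[of a b n h, OF ab(1) hd])
  have flat: "(\<forall>i\<in>{1..n}. nderiv_within {a..b} i (h 0) x = 0) \<longleftrightarrow> \<phi> x \<in> Z" if x: "x \<in> {a..b}" for x
  proof -
    have e: "nderiv_within {a..b} i (h 0) x = 0 \<longleftrightarrow> H i (\<phi> x) = 0" if "i \<in> {1..n}" for i
      using nderiv_within_eq[of a b n h i x, OF ab(1) hd] that x \<kappa> by (simp add: h_def)
    show ?thesis
    proof
      assume *: "\<forall>i\<in>{1..n}. nderiv_within {a..b} i (h 0) x = 0"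
      have "1 \<in> {1..n}" using n by simp
      then have "H 1 (\<phi> x) = 0" using * e by blast
      then show "\<phi> x \<in> Z" using H1_pos[OF \<phi>_in(2)[OF x]] by force
    next
      assume "\<phi> x \<in> Z"
      then show "\<forall>i\<in>{1..n}. nderiv_within {a..b} i (h 0) x = 0" using e H_Z(2) by auto
    qed
  qed
  have "K \<inter> {a..b} = h 0 ` {x \<in> {a..b}. \<phi> x \<in> Z}"
  proof
    show "K \<inter> {a..b} \<subseteq> h 0 ` {x \<in> {a..b}. \<phi> x \<in> Z}"
    proof
      fix y assume y: "y \<in> K \<inter> {a..b}"
      have gT: "g y \<in> T" using Z_T y by auto
      have Hy: "H 0 (g y) = y" using H_Z(1) y by simp
      have "ua \<le> g y" "g y \<le> ub"
        using H_strict_mono[OF gT ua(1)] H_strict_mono[OF ub(1) gT] Hy ua ub y by (auto simp: not_less[symmetric])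
      then obtain x where "x \<in> {a..b}" "\<phi> x = g y" using \<phi>_surj[of "g y"] by auto
      then show "y \<in> h 0 ` {x \<in> {a..b}. \<phi> x \<in> Z}"
        using y Hy by (intro image_eqI[of _ _ x]) (auto simp: h_def)
    qed
    show "h 0 ` {x \<in> {a..b}. \<phi> x \<in> Z} \<subseteq> K \<inter> {a..b}"
    proof
      fix z assume "z \<in> h 0 ` {x \<in> {a..b}. \<phi> x \<in> Z}"
      then obtain x y where x: "x \<in> {a..b}" "z = h 0 x" and y: "\<phi> x = g y" "y \<in> K" by blast
      then have "z = y" using H_Z(1) by (simp add: h_def)
      then show "z \<in> K \<inter> {a..b}" using h_img x y by blast
    qed
  qed
  also have "{x \<in> {a..b}. \<phi> x \<in> Z} = {x \<in> {a..b}. \<forall>i\<in>{1..n}. nderiv_within {a..b} i (h 0) x = 0}"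
    using flat by blast
  finally show ?thesis using hom nd by blast
qed

end

section \<open>From finite variation to a flat homeomorphism\<close>

lemma power_of_powr:
  fixes x a :: real
  assumes "0 < x" shows "(x powr a) ^ m = x powr (a * real m)"
  using assms by (simp add: powr_realpow[symmetric] powr_powr)

text \<open>
  The estimate for a single gap: \<open>y\<close> is its length, \<open>w\<close> its length in the scale of \<open>v\<close> and \<open>\<tau>\<close> its
  length in the scale of \<open>g\<close>; \<open>d\<close> and \<open>D\<close> are the distances from the gap to the given point in the scales
  of \<open>v\<close> and \<open>g\<close>, and \<open>c\<close> is the large factor gained by the time change. A gap that is short compared to
  its distance is controlled by \<open>D\<close>, one that is long compared to its distance by \<open>s\<close>, and a gap longer than
  a fixed scale by the quadratic flatness of the step.
\<close>

lemma gap_estimate: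
  fixes w d D s \<tau> \<epsilon> \<delta> \<gamma> y c :: real and n :: nat
  assumes n: "2 \<le> n" and \<gamma>: "\<gamma> = 1 / real n" and w: "0 < w" "w \<le> \<tau>" and d: "0 \<le> d" "d \<le> D"
    and s: "0 \<le> s" "s \<le> \<tau>" and y: "0 \<le> y" "y \<le> w ^ (n - 1)" and \<delta>: "0 < \<delta>"
    and near: "w + d \<le> \<delta> \<Longrightarrow> c * w * (w + d) powr (-\<gamma>) \<le> \<tau>"
      "0 < d \<Longrightarrow> d \<le> \<delta> \<Longrightarrow> c * d * d powr (-\<gamma>) \<le> D"
    and c: "2 \<le> c" "2 / c \<le> \<epsilon>" and small: "D + s < \<delta> / 2" "D + s \<le> \<epsilon> * \<delta>\<^sup>2 / 4"
  shows "y / \<tau> ^ (n - 1) * (s / \<tau>)\<^sup>2 \<le> \<epsilon> * (D + s)"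
proof -
  have \<tau>: "0 < \<tau>" using w by simp
  have \<epsilon>: "0 < \<epsilon>" using c by (meson divide_pos_pos less_le_trans zero_less_numeral)
  have \<gamma>': "0 < \<gamma>" "\<gamma> < 1" and n1: "\<gamma> * real (n - 1) = 1 - \<gamma>" and nn: "(1 - \<gamma>) * real n = real (n - 1)"
    using n by (auto simp: \<gamma> field_simps of_nat_diff)
  have st: "0 \<le> s / \<tau>" "s / \<tau> \<le> 1" using s \<tau> by auto
  then have st2: "(s / \<tau>)\<^sup>2 \<le> s / \<tau>" "(s / \<tau>)\<^sup>2 \<le> 1"
    using power_decreasing[of 1 2 "s / \<tau>"] power_le_one[of "s / \<tau>" 2] by auto
  have D: "0 \<le> D" using d by simp
  have y_le: "y / \<tau> ^ (n - 1) \<le> (w / \<tau>) ^ (n - 1)"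
    using y \<tau> by (simp add: power_divide divide_right_mono)
  consider "w + d \<le> \<delta>" "w \<le> d" | "w + d \<le> \<delta>" "d < w" | "\<delta> < w + d" by linarith
  then show ?thesis
  proof cases
    case 1
    have d0: "0 < d" using 1 w by simp
    have "w / \<tau> \<le> (2 * d) powr \<gamma> / c"
    proof -
      have "c * w * (2 * d) powr (-\<gamma>) \<le> c * w * (w + d) powr (-\<gamma>)"
        using 1 w c \<gamma>' by (intro mult_left_mono powr_mono2') auto
      also have "\<dots> \<le> \<tau>" by (rule near(1)[OF 1(1)])
      finally show ?thesis using \<tau> c d0 by (simp add: powr_minus field_simps)
    qed
    then have "(w / \<tau>) ^ (n - 1) \<le> ((2 * d) powr \<gamma> / c) ^ (n - 1)"
      using w \<tau> by (intro power_mono) auto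
    also have "\<dots> = (2 * d) powr (1 - \<gamma>) / c ^ (n - 1)"
      using power_of_powr[of "2 * d" \<gamma> "n - 1"] d0 by (simp only: power_divide n1)
    also have "\<dots> \<le> (2 * d) powr (1 - \<gamma>)"
    proof -
      have "1 \<le> c ^ (n - 1)" using c by (intro one_le_power) auto
      then have "(2 * d) powr (1 - \<gamma>) / c ^ (n - 1) \<le> (2 * d) powr (1 - \<gamma>) / 1"
        by (intro divide_left_mono) auto
      then show ?thesis by simp
    qed
    also have "\<dots> = 2 powr (1 - \<gamma>) * d powr (1 - \<gamma>)" by (rule powr_mult)
    also have "\<dots> \<le> 2 * d powr (1 - \<gamma>)"
      using powr_mono[of "1 - \<gamma>" 1 2] \<gamma>' by (intro mult_right_mono) auto
    also have "d powr (1 - \<gamma>) \<le> D / c"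
    proof -
      have "d * d powr (-\<gamma>) = d powr (1 - \<gamma>)" using d0 powr_add[of d 1 "-\<gamma>"] by simp
      moreover have "c * d * d powr (-\<gamma>) \<le> D" using near(2) d0 1 w by simp
      ultimately show ?thesis using c by (simp add: field_simps)
    qed
    finally have "(w / \<tau>) ^ (n - 1) \<le> 2 / c * D" by simp
    also have "\<dots> \<le> \<epsilon> * D" using c D by (intro mult_right_mono) auto
    finally have "y / \<tau> ^ (n - 1) \<le> \<epsilon> * D" using y_le by linarith
    then have "y / \<tau> ^ (n - 1) * (s / \<tau>)\<^sup>2 \<le> \<epsilon> * D * 1"
      using st2 D \<epsilon> by (intro mult_mono) auto
    also have "\<dots> \<le> \<epsilon> * (D + s)" using \<epsilon> s by simp
    finally show ?thesis .
  next
    case 2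
    have half: "c / 2 * w powr (1 - \<gamma>) \<le> \<tau>"
    proof -
      have "w powr (1 - \<gamma>) = w * w powr (-\<gamma>)" using w powr_add[of w 1 "-\<gamma>"] by simp
      then have "c / 2 * w powr (1 - \<gamma>) = c * w * (2 powr (-1) * w powr (-\<gamma>))" by simp
      also have "\<dots> \<le> c * w * (2 powr (-\<gamma>) * w powr (-\<gamma>))"
        using c w \<gamma>' by (intro mult_left_mono mult_right_mono powr_mono) auto
      also have "\<dots> = c * w * (2 * w) powr (-\<gamma>)" by (simp only: powr_mult)
      also have "\<dots> \<le> c * w * (w + d) powr (-\<gamma>)"
        using 2 w c d \<gamma>' by (intro mult_left_mono powr_mono2') auto
      also have "\<dots> \<le> \<tau>" by (rule near(1)[OF 2(1)])
      finally show ?thesis .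
    qed
    have "y / \<tau> ^ (n - 1) * (s / \<tau>)\<^sup>2 \<le> (w / \<tau>) ^ (n - 1) * (s / \<tau>)"
      using y_le st2 w \<tau> by (intro mult_mono) auto
    also have "\<dots> = (w powr (1 - \<gamma>) / \<tau>) ^ n * s"
    proof -
      have "(w powr (1 - \<gamma>)) ^ n = w ^ (n - 1)"
        using w by (simp add: powr_realpow[symmetric] powr_powr nn)
      moreover have "\<tau> ^ n = \<tau> ^ (n - 1) * \<tau>" using n by (cases n) auto
      ultimately show ?thesis by (simp add: power_divide)
    qed
    also have "\<dots> \<le> (2 / c) ^ n * s"
      using half c \<tau> s by (intro mult_right_mono power_mono) (auto simp: field_simps)
    also have "\<dots> \<le> (2 / c) ^ 1 * s"
      using c n s by (intro mult_right_mono power_decreasing) auto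
    also have "\<dots> \<le> \<epsilon> * (D + s)" using c s D \<epsilon> by (intro mult_mono) auto
    finally show ?thesis .
  next
    case 3
    have w\<delta>: "\<delta> / 2 < w" using 3 d small s by linarith
    have "(w / \<tau>) ^ (n - 1) \<le> 1" using w \<tau> by (intro power_le_one) auto
    then have "y / \<tau> ^ (n - 1) \<le> 1" using y_le by linarith
    then have "y / \<tau> ^ (n - 1) * (s / \<tau>)\<^sup>2 \<le> 1 * (s / \<tau>)\<^sup>2"
      by (intro mult_right_mono) auto
    also have "\<dots> \<le> (s / (\<delta> / 2))\<^sup>2"
      using w\<delta> w s \<delta> \<tau> unfolding mult_1 by (intro power_mono divide_left_mono mult_pos_pos) auto
    also have "\<dots> = s * (4 * s / \<delta>\<^sup>2)" by (simp add: power2_eq_square)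
    also have "\<dots> \<le> s * \<epsilon>"
    proof (rule mult_left_mono)
      have "s \<le> \<epsilon> * \<delta>\<^sup>2 / 4" using small D by linarith
      then show "4 * s / \<delta>\<^sup>2 \<le> \<epsilon>" using \<delta> by (simp add: field_simps)
    qed (rule s)
    also have "\<dots> \<le> \<epsilon> * (D + s)" using \<epsilon> D by (simp add: algebra_simps)
    finally show ?thesis .
  qed
qed

context flat_image begin

lemma length_le_power:
  assumes "s \<in> K" "t \<in> K" "s < t"
  shows "t - s \<le> (v t - v s) ^ (n - 1)"
proof -
  have n1: "\<alpha> * real (n - 1) = 1" using n by (simp add: of_nat_diff)
  have "t - s = ((t - s) powr \<alpha>) ^ (n - 1)"
  proof -
    have "((t - s) powr \<alpha>) ^ (n - 1) = (t - s) powr (\<alpha> * real (n - 1))"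
      using assms(3) by (intro power_of_powr) simp
    then show ?thesis using assms(3) unfolding n1 by simp
  qed
  also have "\<dots> \<le> (v t - v s) ^ (n - 1)"
    using v_increment[OF assms] by (intro power_mono) auto
  finally show ?thesis .
qed

text \<open>
  The map \<open>g = G \<circ> v\<close> provided by the time change meets all requirements.
\<close>

lemma gap_glue_if_GV_finite:
  fixes A :: "nat \<Rightarrow> real set"
  assumes clK: "closed K" and ends: "lo \<in> K" "hi \<in> K"
    and A: "\<And>m. A m \<subseteq> K" "\<And>m. GV n id (A m) K < \<infinity>" and K_eq: "K = (\<Union>m. A m)"
    and step: "smooth_step n \<psi> C"
  shows "\<exists>g. gap_glue K g n lo hi \<psi> C"
proof -
  obtain G \<delta> where Gc: "continuous_on UNIV G" and \<delta>: "\<And>k. 0 < \<delta> k"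
    and G1: "\<And>t t'. 0 \<le> t \<Longrightarrow> t \<le> t' \<Longrightarrow> t' \<le> V \<Longrightarrow> t' - t \<le> G t' - G t"
    and G2: "\<And>k m x0 t t' r. m \<le> k \<Longrightarrow> x0 \<in> A m \<Longrightarrow> 0 \<le> t \<Longrightarrow> t \<le> t' \<Longrightarrow> t' \<le> V \<Longrightarrow>
         \<bar>t - v x0\<bar> \<le> r \<Longrightarrow> \<bar>t' - v x0\<bar> \<le> r \<Longrightarrow> r \<le> \<delta> k \<Longrightarrow>
         2 ^ k * (t' - t) * r powr (-\<gamma>) \<le> G t' - G t"
    by (rule time_change_v[of A, OF A]) (rule that)
  define g where "g x = G (v x)" for x
  have vg: "v t - v s \<le> g t - g s" if "s \<in> K" "t \<in> K" "s \<le> t" for s t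
    unfolding g_def using that v_range v_le_iff by (intro G1) auto
  have g_mono: "g s < g t" if "s \<in> K" "t \<in> K" "s < t" for s t
    using vg[of s t] v_strict[of s t] that by simp
  have abs_vg: "\<bar>v s - v t\<bar> \<le> \<bar>g s - g t\<bar>" if "s \<in> K" "t \<in> K" for s t
    using vg[of s t] vg[of t s] v_le_iff[of s t] v_le_iff[of t s] that by (cases "s \<le> t") auto
  have choose_k: "\<exists>k\<ge>m. 2 \<le> (2::real) ^ k \<and> 2 / 2 ^ k \<le> \<epsilon>" if "0 < \<epsilon>" for m and \<epsilon> :: real
  proof -
    have "\<exists>N. (1 / 2) ^ N < \<epsilon> / 2" by (rule real_arch_pow_inv) (use that in auto)
    then obtain N where N: "(1 / 2) ^ N < \<epsilon> / 2" by blast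
    define k where "k = Suc (max m N)"
    have "2 / 2 ^ k = 2 * (1 / 2 :: real) ^ k" by (simp add: power_one_over)
    also have "\<dots> \<le> 2 * (1 / 2) ^ N" unfolding k_def by (intro mult_left_mono power_decreasing) auto
    finally have "2 / 2 ^ k \<le> \<epsilon>" using N by simp
    moreover have "(2::real) ^ 1 \<le> 2 ^ k" unfolding k_def by (intro power_increasing) auto
    ultimately show ?thesis by (intro exI[of _ k]) (auto simp: k_def)
  qed
  have near: "2 ^ k * \<bar>v x - v x0\<bar> * \<bar>v x - v x0\<bar> powr (-\<gamma>) \<le> \<bar>g x - g x0\<bar>"
    if "m \<le> k" "x0 \<in> A m" "x \<in> K" "\<bar>v x - v x0\<bar> \<le> \<delta> k" for m k x x0
  proof -
    have x0: "x0 \<in> K" using A(1) that by auto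
    show ?thesis
    proof (cases "v x0 \<le> v x")
      case True
      then have "2 ^ k * (v x - v x0) * (v x - v x0) powr (-\<gamma>) \<le> g x - g x0"
        unfolding g_def using that v_range[OF x0] v_range[of x] by (intro G2[of m k x0]) auto
      then show ?thesis using True by simp
    next
      case False
      then have "2 ^ k * (v x0 - v x) * (v x0 - v x) powr (-\<gamma>) \<le> g x0 - g x"
        unfolding g_def using that v_range[OF x0] v_range[of x] by (intro G2[of m k x0]) auto
      then show ?thesis using False by simp
    qed
  qed
  have "gap_glue K g n lo hi \<psi> C"
  proof
    show "compact K"
      using clK bounded_subset[OF bounded_closed_interval K] by (simp add: compact_eq_bounded_closed)
    show "lo \<in> K" "hi \<in> K" "K \<subseteq> {lo..hi}" "1 \<le> n" "smooth_step n \<psi> C" using ends K n step by auto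
    show "continuous_on K g"
      unfolding g_def by (rule continuous_on_compose2[OF Gc v_continuous]) auto
    show "g s < g t" if "s \<in> K" "t \<in> K" "s < t" for s t by (rule g_mono[OF that])
    show "\<exists>\<eta>>0. \<forall>x\<in>K. \<bar>g x - g x0\<bar> < \<eta> \<longrightarrow> \<bar>x - x0\<bar> \<le> \<epsilon> * \<bar>g x - g x0\<bar>"
      if x0: "x0 \<in> K" and \<epsilon>: "0 < \<epsilon>" for x0 \<epsilon>
    proof -
      obtain m where m: "x0 \<in> A m" using x0 K_eq by blast
      obtain k where k: "m \<le> k" "2 \<le> (2::real) ^ k" "2 / 2 ^ k \<le> \<epsilon>" using choose_k[OF \<epsilon>] by blast
      have "\<bar>x - x0\<bar> \<le> \<epsilon> * \<bar>g x - g x0\<bar>" if x: "x \<in> K" "\<bar>g x - g x0\<bar> < min 1 (\<delta> k)" for x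
      proof (cases "x = x0")
        case False
        define d where "d = \<bar>v x - v x0\<bar>"
        have d: "0 < d" "d < 1" "d < \<delta> k"
          using abs_vg[OF x(1) x0] x v_strict[of x x0] v_strict[of x0 x] x0 False
          by (auto simp: d_def) (meson linorder_neqE less_irrefl)
        have "\<bar>x - x0\<bar> \<le> d ^ (n - 1)"
          using length_le_power[of x x0] length_le_power[of x0 x] x0 x(1) False
            v_strict[of x x0] v_strict[of x0 x]
          by (cases "x < x0") (auto simp: d_def abs_if)
        also have "\<dots> \<le> d ^ 1" using d n by (intro power_decreasing) auto
        also have "\<dots> \<le> d * d powr (-\<gamma>)"
        proof -
          have "1 powr (-\<gamma>) \<le> d powr (-\<gamma>)" using d \<gamma> by (intro powr_mono2') auto
          then show ?thesis using d by simp
        qed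
        also have "\<dots> \<le> \<epsilon> * \<bar>g x - g x0\<bar>"
        proof -
          have "2 ^ k * d * d powr (-\<gamma>) \<le> \<bar>g x - g x0\<bar>"
            unfolding d_def using near[OF k(1) m x(1)] d by (simp add: d_def)
          then have "d * d powr (-\<gamma>) \<le> 1 / 2 ^ k * \<bar>g x - g x0\<bar>" by (simp add: field_simps)
          also have "\<dots> \<le> \<epsilon> * \<bar>g x - g x0\<bar>"
          proof (rule mult_right_mono)
            have "1 / 2 ^ k \<le> 2 / (2::real) ^ k" by (intro divide_right_mono) auto
            then show "1 / 2 ^ k \<le> \<epsilon>" using k(3) by (rule order.trans)
          qed simp
          finally show ?thesis .
        qed
        finally show ?thesis .
      qed (use \<epsilon> in auto)
      then show ?thesis using \<delta>[of k] by (intro exI[of _ "min 1 (\<delta> k)"]) auto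
    qed
    show "\<exists>\<eta>>0. \<forall>p q e s. gap K p q \<longrightarrow>
      (e = p \<and> x0 \<le> p) \<or> (e = q \<and> q \<le> x0) \<longrightarrow> 0 \<le> s \<longrightarrow> s \<le> g q - g p \<longrightarrow> \<bar>g e - g x0\<bar> + s < \<eta> \<longrightarrow>
      (q - p) / (g q - g p) ^ (n - 1) * (s / (g q - g p))\<^sup>2 \<le> \<epsilon> * (\<bar>g e - g x0\<bar> + s)"
      if x0: "x0 \<in> K" and \<epsilon>: "0 < \<epsilon>" for x0 \<epsilon>
    proof -
      obtain m where m: "x0 \<in> A m" using x0 K_eq by blast
      obtain k where k: "m \<le> k" "2 \<le> (2::real) ^ k" "2 / 2 ^ k \<le> \<epsilon>" using choose_k[OF \<epsilon>] by blast
      define \<eta> where "\<eta> = min (\<delta> k / 2) (\<epsilon> * (\<delta> k)\<^sup>2 / 4)"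
      have "0 < \<eta>" using \<delta>[of k] \<epsilon> by (auto simp: \<eta>_def)
      moreover have "(q - p) / (g q - g p) ^ (n - 1) * (s / (g q - g p))\<^sup>2 \<le> \<epsilon> * (\<bar>g e - g x0\<bar> + s)"
        if pq: "gap K p q" and e: "(e = p \<and> x0 \<le> p) \<or> (e = q \<and> q \<le> x0)"
          and s: "0 \<le> s" "s \<le> g q - g p" and small: "\<bar>g e - g x0\<bar> + s < \<eta>" for p q e s
      proof -
        have K': "p \<in> K" "q \<in> K" "p < q" "e \<in> K" using pq e by (auto simp: gap_def)
        have vpq: "v p < v q" using v_strict K' by simp
        have vx0: "v x0 \<le> v p \<or> v q \<le> v x0" using e v_le_iff x0 K' by auto
        show ?thesis
        proof (rule gap_estimate[where w = "v q - v p" and d = "\<bar>v e - v x0\<bar>" and \<delta> = "\<delta> k" and c = "2 ^ k"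
              and \<gamma> = \<gamma>])
          show "v q - v p \<le> g q - g p" using vg K' by simp
          show "\<bar>v e - v x0\<bar> \<le> \<bar>g e - g x0\<bar>" using abs_vg K' x0 by simp
          show "q - p \<le> (v q - v p) ^ (n - 1)" using length_le_power K' by simp
          show "2 ^ k * (v q - v p) * (v q - v p + \<bar>v e - v x0\<bar>) powr - \<gamma> \<le> g q - g p"
            if "v q - v p + \<bar>v e - v x0\<bar> \<le> \<delta> k"
            unfolding g_def
          proof (rule G2[OF k(1) m])
            show "\<bar>v p - v x0\<bar> \<le> v q - v p + \<bar>v e - v x0\<bar>" "\<bar>v q - v x0\<bar> \<le> v q - v p + \<bar>v e - v x0\<bar>"
              using e vpq by (auto simp: abs_if)
          qed (use v_range[OF K'(1)] v_range[OF K'(2)] vpq that in auto)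
          show "2 ^ k * \<bar>v e - v x0\<bar> * \<bar>v e - v x0\<bar> powr - \<gamma> \<le> \<bar>g e - g x0\<bar>"
            if "\<bar>v e - v x0\<bar> \<le> \<delta> k" by (rule near[OF k(1) m K'(4) that])
          show "2 \<le> n" by (rule n)
        qed (use vpq K' s k \<delta>[of k] small in \<open>auto simp: \<eta>_def\<close>)
      qed
      ultimately show ?thesis by blast
    qed
  qed
  then show ?thesis by blast
qed

end

text \<open>
  Adding a point beyond either end of \<open>[a, b]\<close> increases the variation by at most twice
  \<open>(b - a + 2) powr \<alpha>\<close>.
\<close>

lemma frac_variation_insert_ends:
  assumes ab: "a < b" and K: "K \<subseteq> {a..b}" and n: "n \<ge> 2"
    and fin: "frac_variation (1 / (real n - 1)) id K < \<infinity>"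
  shows "frac_variation (1 / (real n - 1)) id (insert (a - 1) (insert (b + 1) K)) < \<infinity>"
proof -
  interpret flat_image n K a b by (rule flat_image.intro[OF n K fin])
  define c where "c = (b - a + 2) powr \<alpha>"
  define W where "W t = (if t < a then 0 else if b < t then 2 * c + V else c + v t)" for t
  have c0: "0 \<le> c" by (simp add: c_def)
  have le_c: "(t - s) powr \<alpha> \<le> c" if "a - 1 \<le> s" "s \<le> t" "t \<le> b + 1" for s t
    unfolding c_def using that \<alpha> by (intro powr_mono2) auto
  have vr: "0 \<le> v t \<and> v t \<le> V \<and> a \<le> t \<and> t \<le> b" if "t \<in> K" for t using v_range that K by auto
  have "frac_variation \<alpha> id (insert (a - 1) (insert (b + 1) K)) \<le> ennreal (2 * c + V - 0)"
  proof (rule frac_variation_id_le[where W = W])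
    fix s t assume st: "s \<in> insert (a - 1) (insert (b + 1) K)" "t \<in> insert (a - 1) (insert (b + 1) K)" "s < t"
    then consider "s = a - 1" "t = b + 1" | "s = a - 1" "t \<in> K" | "s \<in> K" "t = b + 1" | "s \<in> K" "t \<in> K"
      using vr ab by force
    then show "(t - s) powr \<alpha> \<le> W t - W s"
    proof cases
      case 1
      then show ?thesis using le_c[of s t] V_nonneg c0 ab by (simp add: W_def)
    next
      case 2
      then show ?thesis using le_c[of s t] vr[of t] by (simp add: W_def)
    next
      case 3
      then show ?thesis using le_c[of s t] vr[of s] by (simp add: W_def)
    next
      case 4
      then show ?thesis using v_increment[of s t] st(3) vr[of s] vr[of t] by (simp add: W_def)
    qed
  next
    fix z assume "z \<in> insert (a - 1) (insert (b + 1) K)"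
    then show "0 \<le> W z \<and> W z \<le> 2 * c + V" using vr[of z] c0 V_nonneg by (auto simp: W_def)
  qed (use c0 V_nonneg in simp)
  also have "\<dots> < \<infinity>" by simp
  finally show ?thesis .
qed

lemma GV_singleton: "GV n f {z} K = 0"
proof -
  have "GV n f {z} K \<le> 0"
  proof (rule GV_least)
    fix N and x y :: "nat \<Rightarrow> real"
    assume *: "nonoverlapping N x y" "\<And>i. i < N \<Longrightarrow> x i \<in> {z} \<and> y i \<in> {z}"
    have "N = 0"
    proof (rule ccontr)
      assume "N \<noteq> 0"
      then have "x 0 < y 0" "x 0 = z" "y 0 = z" using * by (auto simp: nonoverlapping_iff)
      then show False by simp
    qed
    then show "gen_variation_sum n f K N x y \<le> 0" by (simp add: gen_variation_sum_def)
  qed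
  then show ?thesis by simp
qed

lemma GV_le_if_agree:
  assumes "\<And>x y. x \<in> A \<Longrightarrow> y \<in> A \<Longrightarrow> K \<inter> {x..y} = L \<inter> {x..y}"
  shows "GV n f A K \<le> GV n f A L"
proof (rule GV_least)
  fix N x y
  assume *: "nonoverlapping N x y" "\<And>i. i < N \<Longrightarrow> x i \<in> A \<and> y i \<in> A"
  have "gen_variation_sum n f K N x y = gen_variation_sum n f L N x y"
    unfolding gen_variation_sum_def using *(2) assms by (intro sum.cong) auto
  also have "\<dots> \<le> GV n f A L" by (rule GV_upper[OF *])
  finally show "gen_variation_sum n f K N x y \<le> GV n f A L" .
qed

lemma homeomorphism_if_GV_cover:
  fixes a b :: real and K :: "real set" and n :: nat
  assumes ab: "a < b" and clK: "closed K" and Kab: "K \<subseteq> {a..b}" and n: "n \<ge> 2"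
    and fin: "frac_variation (1 / (real n - 1)) id K < \<infinity>" and cover: "GV_cover n a b K"
  shows "\<exists>h g. homeomorphism {a..b} {a..b} h g \<and> n_times_differentiable_on n h {a..b} \<and>
          K = h ` {x \<in> {a..b}. \<forall>i\<in>{1..n}. nderiv_within {a..b} i h x = 0}"
proof -
  obtain M :: "nat set" and A where MA: "\<forall>m\<in>M. closed (A m) \<and> A m \<subseteq> {a..b}"
    "K = (\<Union>m\<in>M. A m)" "\<forall>m\<in>M. GV n id (A m) K < \<infinity>"
    using cover unfolding GV_cover_def by blast
  define K' where "K' = insert (a - 1) (insert (b + 1) K)"
  \<comment> \<open>the two added points form sets of their own in the cover\<close>
  define A' where "A' m = (case m of 0 \<Rightarrow> {a - 1} | Suc 0 \<Rightarrow> {b + 1} | Suc (Suc j) \<Rightarrow> if j \<in> M then A j else {})" for m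
  have fin': "frac_variation (1 / (real n - 1)) id K' < \<infinity>"
    unfolding K'_def by (rule frac_variation_insert_ends[OF ab Kab n fin])
  have K': "K' \<subseteq> {a - 1..b + 1}" using Kab ab by (auto simp: K'_def)
  interpret flat_image n K' "a - 1" "b + 1"
    by (rule flat_image.intro[OF n K' fin'])
  have AK: "A j \<subseteq> K" if "j \<in> M" for j using MA(2) that by blast
  have A'K: "A' m \<subseteq> K'" for m
    using AK by (auto simp: A'_def K'_def split: nat.splits if_splits)
  have A'GV: "GV n id (A' m) K' < \<infinity>" for m
  proof -
    consider "m = 0" | "m = Suc 0" | j where "m = Suc (Suc j)" by (metis not0_implies_Suc)
    then show ?thesis
    proof cases
      case (3 j)
      show ?thesis
      proof (cases "j \<in> M")
        case True
        have "GV n id (A j) K' \<le> GV n id (A j) K"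
          using AK[OF True] Kab by (intro GV_le_if_agree) (force simp: K'_def)
        also have "\<dots> < \<infinity>" using MA(3) True by blast
        finally show ?thesis using 3 True by (simp add: A'_def)
      qed (simp add: 3 A'_def GV_empty)
    qed (simp_all add: A'_def GV_singleton)
  qed
  have "K' = (\<Union>m. A' m)"
  proof
    show "K' \<subseteq> (\<Union>m. A' m)"
    proof
      fix z assume "z \<in> K'"
      then consider "z = a - 1" | "z = b + 1" | "z \<in> K" by (auto simp: K'_def)
      then have "\<exists>m. z \<in> A' m"
      proof cases
        case 1
        then show ?thesis by (intro exI[of _ 0]) (simp add: A'_def)
      next
        case 2
        then show ?thesis by (intro exI[of _ "Suc 0"]) (simp add: A'_def)
      next
        case 3
        then obtain j where "j \<in> M" "z \<in> A j" using MA(2) by blast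
        then show ?thesis by (intro exI[of _ "Suc (Suc j)"]) (simp add: A'_def)
      qed
      then show "z \<in> (\<Union>m. A' m)" by blast
    qed
    show "(\<Union>m. A' m) \<subseteq> K'" using A'K by blast
  qed
  moreover have "closed K'" unfolding K'_def using clK by (intro closed_insert)
  moreover obtain \<psi> C where step: "smooth_step n \<psi> C" using smooth_step_exists by blast
  ultimately obtain g where "gap_glue K' g n (a - 1) (b + 1) \<psi> C"
    using gap_glue_if_GV_finite[of A' \<psi> C, OF _ _ _ A'K A'GV] unfolding K'_def by blast
  then interpret gg: gap_glue K' g n "a - 1" "b + 1" \<psi> C .
  have "K' \<inter> {a..b} = K" using Kab by (auto simp: K'_def)
  with gg.homeomorphism_exists[OF ab] show ?thesis by simp
qed

section \<open>The characterization\<close>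

theorem theorem5p1:
  fixes a b :: real and K :: "real set" and n :: nat
  assumes "a < b" and "closed K" and "K \<subseteq> {a..b}" and "n \<ge> 2"
  shows
    "((\<exists>h g. homeomorphism {a..b} {a..b} h g \<and> n_times_differentiable_on n h {a..b} \<and>
          K = h ` {x \<in> {a..b}. \<forall>i\<in>{1..n}. nderiv_within {a..b} i h x = 0})
      \<longleftrightarrow>
      (frac_variation (1 / (real n - 1)) id K < \<infinity> \<and>
        (\<exists>(M :: nat set) (A :: nat \<Rightarrow> real set).
          (\<forall>m\<in>M. closed (A m) \<and> A m \<subseteq> {a..b}) \<and> K = (\<Union>m\<in>M. A m) \<and>
          (\<forall>m\<in>M. GV n id (A m) K < \<infinity>))))
    \<and>
     ((frac_variation (1 / (real n - 1)) id K < \<infinity> \<and>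
        (\<exists>(M :: nat set) (A :: nat \<Rightarrow> real set).
          (\<forall>m\<in>M. closed (A m) \<and> A m \<subseteq> {a..b}) \<and> K = (\<Union>m\<in>M. A m) \<and>
          (\<forall>m\<in>M. GV n id (A m) K < \<infinity>)))
      \<longleftrightarrow>
      (frac_variation (1 / (real n - 1)) id K < \<infinity> \<and>
        (\<exists>(A :: nat \<Rightarrow> real set) (\<delta> :: nat \<Rightarrow> real).
          (\<forall>m. closed (A m) \<and> A m \<subseteq> {a..b} \<and> \<delta> m > 0) \<and> K = (\<Union>m. A m) \<and>
          (\<forall>m. A m \<subseteq> A (Suc m)) \<and>
          (\<lambda>m. GV_bar n (\<delta> m) id (A m) K) \<longlonglongrightarrow> 0)))"
proof -
  let ?fin = "frac_variation (1 / (real n - 1)) id K < \<infinity>"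
  have "?fin \<and> GV_cover n a b K"
    if hom: "homeomorphism {a..b} {a..b} h g" and flat: "n_times_differentiable_on n h {a..b}"
      "K = h ` {x \<in> {a..b}. \<forall>i\<in>{1..n}. nderiv_within {a..b} i h x = 0}" for h g
  proof -
    obtain \<sigma> where "\<sigma> = 1 \<or> \<sigma> = - 1"
      "\<And>s t. s \<in> {a..b} \<Longrightarrow> t \<in> {a..b} \<Longrightarrow> s < t \<Longrightarrow> \<sigma> * g s < \<sigma> * g t"
      by (rule homeomorphism_real_interval_monotone[OF hom]) (rule that)
    then interpret flat_homeo a b K n h g \<sigma>
      by (rule flat_homeo.intro[OF assms hom flat])
    show ?thesis using frac_variation_finite GV_cover by blast
  qed
  then have "(\<exists>h g. homeomorphism {a..b} {a..b} h g \<and> n_times_differentiable_on n h {a..b} \<and>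
          K = h ` {x \<in> {a..b}. \<forall>i\<in>{1..n}. nderiv_within {a..b} i h x = 0}) \<longleftrightarrow> ?fin \<and> GV_cover n a b K"
    using homeomorphism_if_GV_cover[OF assms] by blast
  moreover have "?fin \<and> GV_cover n a b K \<longleftrightarrow> ?fin \<and> (\<exists>(A :: nat \<Rightarrow> real set) (\<delta> :: nat \<Rightarrow> real).
          (\<forall>m. closed (A m) \<and> A m \<subseteq> {a..b} \<and> \<delta> m > 0) \<and> K = (\<Union>m. A m) \<and>
          (\<forall>m. A m \<subseteq> A (Suc m)) \<and>
          (\<lambda>m. GV_bar n (\<delta> m) id (A m) K) \<longlonglongrightarrow> 0)"
    using GV_cover_iff_GV_bar[OF assms] by (rule conj_cong[OF refl])
  ultimately show ?thesis unfolding GV_cover_def by (rule conjI)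
qed

end
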